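(* Let $X \colon \mathbf{CommRing} \to \mathbf{Set}$ be a functor that is tame and multiplicative. Then, as formal Dirichlet series, \[ \widehat{Z}_X(s) = \prod_{p \in \mathbb{P}} \exp\left( \sum_{n \ge 1} \frac{|X(\mathbb{F}_{p^n})|}{n}\, p^{-ns} \right), \] where $\mathbb{P}$ is the set of prime numbers and $\mathbb{F}_{p^n}$ is the field with $p^n$ elements.
   Context: $\mathbf{CommRing}$ is the category of commutative rings. A functor $X\colon \mathbf{CommRing}\to\mathbf{Set}$ is called tame if $X(k)$ is a finite set whenever $k$ is a finite semisimple commutative ring (equivalently, a finite product of finite fields, including the one-element ring as the empty product), and multiplicative if it preserves products. A species is a functor from the groupoid of finite sets and bijections to $\mathbf{Set}$; it is tame if all its values are finite sets. The zeta species $Z_X$ of $X$ is the species such that $Z_X(S)$, for a finite set $S$, is the set of pairs consisting of a way to make $S$ into a semisimple commutative ring, say $k$ (i.e. a choice of addition and multiplication on $S$ making it such a ring), and an element of $X(k)$; bijections act by transport of structure. For a tame species $F$, its Dirichlet series is the formal series $\widehat{F}(s)=\sum_{n\ge1}\frac{|F(n)|}{n!}n^{-s}$, where $F(n)$ denotes the value of $F$ on an $n$-element set. Formal Dirichlet series $\sum_{n\ge1}a_n n^{-s}$ are multiplied by $(\sum a_n n^{-s})(\sum b_m m^{-s})=\sum_N(\sum_{nm=N}a_nb_m)N^{-s}$; for a series $f$ with zero coefficient of $1^{-s}$, $\exp(f)=\sum_{m\ge0}f^m/m!$; an infinite product over primes of series each of which has coefficient $1$ at $1^{-s}$ and nonzero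 other coefficients only at powers of $p$ is defined coefficientwise (each coefficient involves only finitely many factors nontrivially). *)

theory Defs
  imports Complex_Main "HOL-Algebra.Ring" "HOL-Algebra.RingHom" "HOL-Computational_Algebra.Primes"
begin

text \<open>The category of commutative rings is modelled by HOL-Algebra records of type
  nat ring satisfying cring (all commutative rings with carrier a subset of nat,
  i.e. up to isomorphism all countable commutative rings), with morphisms the ring
  homomorphisms (as functions, identified when they agree on the carrier).
  A functor to Set is a pair (X, Xm): object part X and morphism part Xm.\<close>

definition is_functor ::
  "(nat ring \<Rightarrow> 'x set) \<Rightarrow> (nat ring \<Rightarrow> nat ring \<Rightarrow> (nat \<Rightarrow> nat) \<Rightarrow> 'x \<Rightarrow> 'x) \<Rightarrow> bool" where
  "is_functor X Xm \<longleftrightarrow>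
    (\<forall>A B f x. cring A \<and> cring B \<and> f \<in> ring_hom A B \<and> x \<in> X A \<longrightarrow> Xm A B f x \<in> X B) \<and>
    (\<forall>A x. cring A \<and> x \<in> X A \<longrightarrow> Xm A A id x = x) \<and>
    (\<forall>A B f g x. cring A \<and> cring B \<and> f \<in> ring_hom A B \<and> g \<in> ring_hom A B \<and>
        (\<forall>a\<in>carrier A. f a = g a) \<and> x \<in> X A \<longrightarrow> Xm A B f x = Xm A B g x) \<and>
    (\<forall>A B C f g x. cring A \<and> cring B \<and> cring C \<and> f \<in> ring_hom A B \<and> g \<in> ring_hom B C \<and>
        x \<in> X A \<longrightarrow> Xm A C (g \<circ> f) x = Xm B C g (Xm A B f x))"

text \<open>Finite semisimple commutative ring = finite product of finite fields
  (m = 0 gives the one-element ring).\<close>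
definition fin_semisimple :: "nat ring \<Rightarrow> bool" where
  "fin_semisimple R \<longleftrightarrow> cring R \<and>
    (\<exists>(m::nat) (F::nat \<Rightarrow> nat ring) (\<phi>::nat \<Rightarrow> nat \<Rightarrow> nat).
       (\<forall>i<m. field (F i) \<and> finite (carrier (F i)) \<and> \<phi> i \<in> ring_hom R (F i)) \<and>
       bij_betw (\<lambda>x. \<lambda>i\<in>{..<m}. \<phi> i x) (carrier R) (PiE {..<m} (\<lambda>i. carrier (F i))))"

definition tame :: "(nat ring \<Rightarrow> 'x set) \<Rightarrow> bool" where
  "tame X \<longleftrightarrow> (\<forall>R. fin_semisimple R \<longrightarrow> finite (X R))"

text \<open>Preservation of (finite) products: binary products and the terminal object
  (the one-element ring).  In CommRing, C with projections p, q is a product of A and B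
  iff (p, q) is bijective onto carrier A \<times> carrier B.\<close>
definition multiplicative ::
  "(nat ring \<Rightarrow> 'x set) \<Rightarrow> (nat ring \<Rightarrow> nat ring \<Rightarrow> (nat \<Rightarrow> nat) \<Rightarrow> 'x \<Rightarrow> 'x) \<Rightarrow> bool" where
  "multiplicative X Xm \<longleftrightarrow>
    (\<forall>A B C p q. cring A \<and> cring B \<and> cring C \<and> p \<in> ring_hom C A \<and> q \<in> ring_hom C B \<and>
        bij_betw (\<lambda>c. (p c, q c)) (carrier C) (carrier A \<times> carrier B) \<longrightarrow>
        bij_betw (\<lambda>x. (Xm C A p x, Xm C B q x)) (X C) (X A \<times> X B)) \<and>
    (\<forall>C. cring C \<and> card (carrier C) = 1 \<longrightarrow> (\<exists>!x. x \<in> X C))"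

text \<open>Ways to make the n-element set {..<n} into a semisimple commutative ring: a
  ring structure is determined by its addition and multiplication on the carrier, so
  we normalise the operations outside the carrier to 0 to get a bijection.\<close>
definition ring_structs :: "nat \<Rightarrow> nat ring set" where
  "ring_structs n = {R. carrier R = {..<n} \<and> fin_semisimple R \<and>
      (\<forall>x y. x \<notin> {..<n} \<or> y \<notin> {..<n} \<longrightarrow> x \<otimes>\<^bsub>R\<^esub> y = 0 \<and> x \<oplus>\<^bsub>R\<^esub> y = 0)}"

text \<open>Dirichlet series coefficients of the zeta species: |Z_X(n)| / n!.\<close>
definition zeta_coeff :: "(nat ring \<Rightarrow> 'x set) \<Rightarrow> nat \<Rightarrow> real" where
  "zeta_coeff X n = (if n = 0 then 0
     else real (card (SIGMA R:ring_structs n. X R)) / fact n)"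

text \<open>Formal Dirichlet series as coefficient functions (coefficient of n^-s at n \<ge> 1).\<close>
definition dmult :: "(nat \<Rightarrow> real) \<Rightarrow> (nat \<Rightarrow> real) \<Rightarrow> nat \<Rightarrow> real" where
  "dmult f g N = (if N = 0 then 0 else (\<Sum>d\<in>{d. d dvd N}. f d * g (N div d)))"

definition dunit :: "nat \<Rightarrow> real" where
  "dunit N = (if N = 1 then 1 else 0)"

definition dpow :: "(nat \<Rightarrow> real) \<Rightarrow> nat \<Rightarrow> nat \<Rightarrow> real" where
  "dpow f m = (dmult f ^^ m) dunit"

definition dexp :: "(nat \<Rightarrow> real) \<Rightarrow> nat \<Rightarrow> real" where
  "dexp f N = (\<Sum>m. dpow f m N / fact m)"

text \<open>Infinite product over primes, coefficientwise as the (eventually constant) limit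
  of the partial products over the primes p \<le> M.\<close>
definition euler_prod :: "(nat \<Rightarrow> nat \<Rightarrow> real) \<Rightarrow> nat \<Rightarrow> real" where
  "euler_prod E N = lim (\<lambda>M. foldr dmult (map E (sorted_list_of_set {p. prime p \<and> p \<le> M})) dunit N)"

text \<open>A field with p^n elements (any choice; X is a functor so only its iso class matters).\<close>
definition GF :: "nat \<Rightarrow> nat \<Rightarrow> nat ring" where
  "GF p n = (SOME F. field F \<and> finite (carrier F) \<and> card (carrier F) = p ^ n)"

definition local_series :: "(nat ring \<Rightarrow> 'x set) \<Rightarrow> nat \<Rightarrow> nat \<Rightarrow> real" where
  "local_series X p N = (\<Sum>n\<in>{n. 1 \<le> n \<and> p ^ n = N}. real (card (X (GF p n))) / real n)"

end

theory Submission
  imports Defs "HOL-Algebra.Algebraic_Closure" "HOL-Algebra.Chinese_Remainder"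
    "HOL-Algebra.Multiplicative_Group" "HOL-Number_Theory.Residues"
    "HOL-Computational_Algebra.Polynomial"
begin

text \<open>Both sides are Dirichlet series with constant coefficient 1, so it suffices to show that
  they have the same logarithmic derivative, i.e. the same recurrence
  ln N * z N = (sum over Q dvd N of ln Q * b Q * z (N / Q)), where b (p^n) = |X(F_(p^n))| / n and
  b vanishes elsewhere. For the product of exponentials this is the Leibniz rule.

  For the zeta species, a finite semisimple ring R on N points satisfies ln N = (sum of ln |eR|
  over the idempotents e for which the corner eR is a field). A pair (R, e) with |eR| = Q,
  together with bijections of eR and (1 - e)R onto {0..<Q} and {0..<N / Q}, is the same thing as a
  field structure on {0..<Q}, a semisimple ring structure on {0..<N / Q} and a bijection of
  {0..<N} onto {0..<Q} * {0..<N / Q}. Counting both descriptions with weight |X(R)| gives the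
  recurrence, with b Q the weighted number of field structures on Q points divided by Q!.

  That number is |X(F_(p^n))| * Q! / n for Q = p^n because any two fields with p^n elements are
  related by exactly n isomorphisms: the minimal polynomial of a generator of one field divides
  x^Q - x modulo p, hence has exactly n roots in the other field.\<close>

text \<open>The weight \<open>ln\<close> is what lets one recurrence handle rings with any number of
  factors. Counting semisimple structures directly would mean tracking repeated factors and the
  automorphisms permuting them; splitting off a single field factor in every possible way, weighted
  by the logarithm of its size, gives total weight ln N however often that factor occurs. The
  recurrence says nothing at N = 1, because ln 1 = 0, so the one-element ring has to supply the
  constant coefficient separately. Fields here are records with arbitrary carriers, while the
  integer polynomials are a type-class ring; evaluating integer polynomials in records moves
  identities from one setting to the other. Since \<open>GF\<close> chooses among fields with
  carrier in \<open>nat\<close>, such a field must be exhibited for each prime power: it consists of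
  the fixed points of a power of Frobenius in an algebraic closure of the residue ring modulo p,
  relabelled by natural numbers.\<close>

section \<open>Evaluating polynomials in a ring record\<close>

text \<open>The source is a type-class ring (\<open>int\<close>, \<open>int poly\<close>,
  \<open>int poly poly\<close>), the target a record. Identities proved in the source by type-class
  algebra can thus be pushed into any ring record.\<close>

definition type_hom :: "('c::comm_ring_1 \<Rightarrow> 'a) \<Rightarrow> ('a, 'm) ring_scheme \<Rightarrow> bool" where
  "type_hom h R \<longleftrightarrow> (\<forall>x. h x \<in> carrier R) \<and> (\<forall>x y. h (x + y) = h x \<oplus>\<^bsub>R\<^esub> h y) \<and>
     (\<forall>x y. h (x * y) = h x \<otimes>\<^bsub>R\<^esub> h y) \<and> h 1 = \<one>\<^bsub>R\<^esub>"

lemma type_homD: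
  assumes "type_hom h R"
  shows "h x \<in> carrier R" "h (x + y) = h x \<oplus>\<^bsub>R\<^esub> h y" "h (x * y) = h x \<otimes>\<^bsub>R\<^esub> h y" "h 1 = \<one>\<^bsub>R\<^esub>"
  using assms by (auto simp: type_hom_def)

lemma type_hom_zero:
  assumes "type_hom h R" "cring R"
  shows "h 0 = \<zero>\<^bsub>R\<^esub>"
proof -
  interpret cring R by fact
  have "h 0 \<oplus>\<^bsub>R\<^esub> h 0 = h 0" using type_homD(2)[OF assms(1), of 0 0] by simp
  then show ?thesis using type_homD(1)[OF assms(1), of 0]
    by (metis add.r_cancel_one)
qed

lemma type_hom_minus:
  assumes "type_hom h R" "cring R"
  shows "h (- x) = \<ominus>\<^bsub>R\<^esub> h x"
proof -
  interpret cring R by fact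
  have "h (- x) \<oplus>\<^bsub>R\<^esub> h x = \<zero>\<^bsub>R\<^esub>"
    using type_homD(2)[OF assms(1), of "- x" x] type_hom_zero[OF assms] by simp
  then show ?thesis using type_homD(1)[OF assms(1)]
    by (simp add: minus_equality)
qed

lemma type_hom_diff:
  assumes "type_hom h R" "cring R"
  shows "h (x - y) = h x \<ominus>\<^bsub>R\<^esub> h y"
  using type_homD(2)[OF assms(1), of x "- y"] type_hom_minus[OF assms, of y]
  by (simp add: a_minus_def)

lemma type_hom_power:
  assumes "type_hom h R" "cring R"
  shows "h (x ^ n) = h x [^]\<^bsub>R\<^esub> n"
proof -
  interpret cring R by fact
  show ?thesis
    by (induction n)
      (use type_homD[OF assms(1)] in \<open>auto simp: m_comm\<close>)
qed

definition int_emb :: "('a, 'm) ring_scheme \<Rightarrow> int \<Rightarrow> 'a" where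
  "int_emb R k = [k] \<cdot>\<^bsub>R\<^esub> \<one>\<^bsub>R\<^esub>"

lemma type_hom_int_emb:
  fixes R (structure)
  assumes "cring R"
  shows "type_hom (int_emb R) R"
proof -
  interpret cring R by fact
  show ?thesis
    unfolding type_hom_def int_emb_def
  proof (intro conjI allI)
    fix x y :: int
    show "[(x * y)] \<cdot> \<one> = [x] \<cdot> \<one> \<otimes> [y] \<cdot> \<one>"
    proof -
      have "[x] \<cdot> \<one> \<otimes> [y] \<cdot> \<one> = [x] \<cdot> (\<one> \<otimes> [y] \<cdot> \<one>)"
        by (rule add_pow_ldistr_int) auto
      also have "\<dots> = [x] \<cdot> ([y] \<cdot> \<one>)" by (subst l_one) auto
      also have "\<dots> = [(y * x)] \<cdot> \<one>" by (rule add.int_pow_pow) auto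
      finally show ?thesis by (simp only: mult.commute)
    qed
  qed (auto simp: add.int_pow_mult add.int_pow_1)
qed

text \<open>The integers are initial: agreement at 0 and 1 propagates through sums and differences,
  so the two-sided induction reaches every integer. Images of integers under homomorphisms are
  thereby identified without computation.\<close>

lemma type_hom_int_unique:
  assumes "cring R" "type_hom h R"
  shows "h k = int_emb R (k::int)"
proof (induction k rule: int_induct[where k = 0])
  case base
  show ?case using type_hom_zero assms type_hom_int_emb by metis
next
  case (step1 i)
  then show ?case using type_homD[OF assms(2)] type_homD[OF type_hom_int_emb[OF assms(1)]] by metis
next
  case (step2 i)
  then show ?case
    using type_homD(4)[OF assms(2)] type_homD(4)[OF type_hom_int_emb[OF assms(1)]]
     type_hom_diff[OF assms(2,1), of i 1] type_hom_diff[OF type_hom_int_emb[OF assms(1)] assms(1), of i 1]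
    by metis
qed

lemma type_hom_comp:
  assumes "type_hom h R" "\<phi> \<in> ring_hom R S"
  shows "type_hom (\<phi> \<circ> h) S"
  using assms unfolding type_hom_def ring_hom_def by auto

lemma type_hom_int_hom:
  assumes "cring R" "cring S" "\<phi> \<in> ring_hom R S"
  shows "\<phi> (int_emb R k) = int_emb S k"
  using type_hom_int_unique[OF assms(2) type_hom_comp[OF type_hom_int_emb[OF assms(1)] assms(3)]]
  by simp

text \<open>Horner's scheme. The coefficient map \<open>h\<close> is left general because an
  evaluation is itself such a map; nesting two of them evaluates polynomials in two
  variables.\<close>

definition poly_ev :: "('a, 'm) ring_scheme \<Rightarrow> ('c::comm_ring_1 \<Rightarrow> 'a) \<Rightarrow> 'a \<Rightarrow> 'c poly \<Rightarrow> 'a" where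
  "poly_ev R h a f = fold_coeffs (\<lambda>c y. h c \<oplus>\<^bsub>R\<^esub> a \<otimes>\<^bsub>R\<^esub> y) f \<zero>\<^bsub>R\<^esub>"

context
  fixes R (structure) and h :: "'c::comm_ring_1 \<Rightarrow> 'a" and a
  assumes cring: "cring R" and hom: "type_hom h R" and a: "a \<in> carrier R"
begin

interpretation cring R by (rule cring)

lemma poly_ev_0 [simp]: "poly_ev R h a 0 = \<zero>"
  by (simp add: poly_ev_def)

lemma poly_ev_pCons: "poly_ev R h a (pCons c f) = h c \<oplus> a \<otimes> poly_ev R h a f"
proof (cases "c = 0 \<and> f = 0")
  case True
  then show ?thesis using a type_hom_zero[OF hom cring] by simp
next
  case False
  then show ?thesis unfolding poly_ev_def by auto
qed

lemma poly_ev_closed [simp]: "poly_ev R h a f \<in> carrier R"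
  by (induction f) (use a type_homD[OF hom] in \<open>auto simp: poly_ev_pCons\<close>)

lemma poly_ev_add: "poly_ev R h a (f + g) = poly_ev R h a f \<oplus> poly_ev R h a g"
proof (induction f g rule: poly_induct2)
  case 0
  then show ?case by simp
next
  case (pCons c f d g)
  then show ?case
    using a type_homD(1,2)[OF hom] poly_ev_closed
    by (simp add: poly_ev_pCons r_distr add.m_assoc add.m_lcomm)
qed

lemma poly_ev_smult: "poly_ev R h a (smult c f) = h c \<otimes> poly_ev R h a f"
proof (induction f)
  case 0
  then show ?case using type_homD(1)[OF hom] by simp
next
  case (pCons d f)
  then show ?case
    using a type_homD(1,3)[OF hom] poly_ev_closed
    by (simp add: poly_ev_pCons r_distr m_lcomm)
qed

lemma poly_ev_const: "poly_ev R h a [:c:] = h c"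
  using poly_ev_pCons[of c 0] a type_homD(1)[OF hom] by simp

lemma type_hom_poly_ev: "type_hom (poly_ev R h a) R"
  unfolding type_hom_def
proof (intro conjI allI)
  fix f g
  show "poly_ev R h a (f * g) = poly_ev R h a f \<otimes> poly_ev R h a g"
  proof (induction f)
    case 0
    then show ?case using type_homD(1)[OF hom] by simp
  next
    case (pCons d f)
    then show ?case
      using a type_homD(1,3)[OF hom] poly_ev_closed type_hom_zero[OF hom cring]
      by (simp add: poly_ev_pCons poly_ev_add poly_ev_smult l_distr m_assoc)
  qed
qed (auto simp: poly_ev_add poly_ev_const one_pCons type_homD(4)[OF hom])

lemma poly_ev_X: "poly_ev R h a [:0, 1:] = a"
  using a by (simp add: poly_ev_pCons type_hom_zero[OF hom cring] type_homD(4)[OF hom])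

text \<open>Polynomials as lists carry the leading coefficient first, hence \<open>rev\<close>. The
  translation gives access to the root bound over a field.\<close>

lemma poly_ev_eq_eval: "poly_ev R h a f = ring.eval R (map h (rev (coeffs f))) a"
proof (induction f)
  case 0
  then show ?case by simp
next
  case (pCons c f)
  have *: "set (map h (rev (coeffs f))) \<subseteq> carrier R" using type_homD(1)[OF hom] by auto
  have "coeffs (pCons c f) = c # coeffs f" using pCons.hyps by (auto simp: cCons_def)
  then show ?case
    using pCons.IH a type_homD(1)[OF hom] eval_append_aux[OF *, of "h c" a]  poly_ev_closed[of f]
    by (simp add: poly_ev_pCons m_comm a_comm)
qed

end

lemma poly_ev_hom:
  assumes "cring R" "cring S" "\<phi> \<in> ring_hom R S" "a \<in> carrier R"
  shows "\<phi> (poly_ev R (int_emb R) a f) = poly_ev S (int_emb S) (\<phi> a) f"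
proof (induction f)
  case 0
  interpret ring_hom_cring R S \<phi> using assms by (intro ring_hom_cring.intro ring_hom_cring_axioms.intro)
  show ?case by (simp add: poly_ev_def)
next
  case (pCons c f)
  interpret ring_hom_cring R S \<phi> using assms by (intro ring_hom_cring.intro ring_hom_cring_axioms.intro)
  have 1: "type_hom (int_emb R) R" "type_hom (int_emb S) S" using assms type_hom_int_emb by auto
  have "\<phi> a \<in> carrier S" using assms by simp
  then show ?case
    using pCons.IH assms 1 poly_ev_closed[OF assms(1) 1(1) assms(4), of f] type_homD(1)[OF 1(1), of c]
    by (simp add: poly_ev_pCons type_hom_int_hom)
qed

text \<open>Being monic survives the passage to \<open>R\<close>: the list of images starts with the
  unit, so it is a genuine polynomial of unchanged degree and the usual root bound applies.\<close>

lemma card_roots_monic_le: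
  fixes R (structure) and f :: "int poly"
  assumes "field R" "Polynomial.coeff f (Polynomial.degree f) = 1"
  shows "finite {a \<in> carrier R. poly_ev R (int_emb R) a f = \<zero>\<^bsub>R\<^esub>}"
    "card {a \<in> carrier R. poly_ev R (int_emb R) a f = \<zero>\<^bsub>R\<^esub>} \<le> Polynomial.degree f"
proof -
  interpret field R by fact
  have cr: "cring R" ..
  note h = type_hom_int_emb[OF cr]
  define P where "P = map (int_emb R) (rev (coeffs f))"
  have f0: "f \<noteq> 0" using assms(2) by auto
  then have P: "P \<noteq> []" "Polynomials.degree P = Polynomial.degree f"
    by (auto simp: P_def length_coeffs_degree)
  have "hd P = \<one>"
    using f0 assms(2) type_homD(4)[OF h] by (simp add: P_def hd_map hd_rev last_coeffs_eq_coeff_degree)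
  then have "P \<in> carrier (poly_ring R)"
    unfolding univ_poly_carrier[symmetric] polynomial_def using type_homD(1)[OF h] by (auto simp: P_def)
  then have *: "size (roots P) \<le> Polynomials.degree P" "\<And>x. x \<in># roots P \<longleftrightarrow> is_root P x"
    using size_roots_le_degree roots_mem_iff_is_root by auto
  have "poly_ev R (int_emb R) x f = eval P x" if "x \<in> carrier R" for x
    unfolding P_def by (rule poly_ev_eq_eval[OF cr h that])
  then have "{a \<in> carrier R. poly_ev R (int_emb R) a f = \<zero>\<^bsub>R\<^esub>} = set_mset (roots P)"
    using P(1) unfolding set_eq_iff *(2) is_root_def by auto
  moreover have "card (set_mset (roots P)) \<le> size (roots P)"
    using size_mset_mono[OF mset_set_set_mset_msubset[of "roots P"]] by simp 
  ultimately show "finite {a \<in> carrier R. poly_ev R (int_emb R) a f = \<zero>\<^bsub>R\<^esub>}"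
    "card {a \<in> carrier R. poly_ev R (int_emb R) a f = \<zero>\<^bsub>R\<^esub>} \<le> Polynomial.degree f"
    using * P by auto
qed

section \<open>Finite fields\<close>

lemma finite_field_pow_card:
  fixes F (structure)
  assumes "field F" "finite (carrier F)" "x \<in> carrier F"
  shows "x [^] card (carrier F) = x"
proof -
  interpret field F by fact
  interpret G: group "Multiplicative_Group.mult_of F" by (rule field_mult_group)
  have pos: "card (carrier F) > 0" using assms by (auto simp: card_gt_0_iff)
  show ?thesis
  proof (cases "x = \<zero>")
    case True
    then show ?thesis using pos by (simp add: nat_pow_zero)
  next
    case False
    then have "x [^] Coset.order (Multiplicative_Group.mult_of F) = \<one>"
      using G.pow_order_eq_1[of x] assms(3) by (simp add: Multiplicative_Group.nat_pow_mult_of Multiplicative_Group.mult_of_simps)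
    moreover have "card (carrier F) = Suc (Coset.order (Multiplicative_Group.mult_of F))"
      using pos order_mult_of[OF assms(2)] by (simp add: Coset.order_def)
    ultimately show ?thesis using assms(3) by simp
  qed
qed

text \<open>The prime is the least positive integer whose image vanishes; finiteness provides one,
  and the absence of zero divisors makes it prime.\<close>

lemma finite_field_char:
  fixes F (structure)
  assumes "field F" "finite (carrier F)"
  obtains p :: nat where "Factorial_Ring.prime p" "\<And>k. int_emb F k = \<zero> \<longleftrightarrow> int p dvd k"
proof -
  interpret field F by fact
  have cr: "cring F" ..
  note h = type_hom_int_emb[OF cr]
  note z = type_hom_zero[OF h cr]
  let ?P = "\<lambda>k::nat. k > 0 \<and> int_emb F (int k) = \<zero>"
  have "\<exists>k. ?P k"
  proof -
    have "\<not> inj (\<lambda>k::nat. int_emb F (int k))"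
    proof
      assume "inj (\<lambda>k::nat. int_emb F (int k))"
      moreover have "range (\<lambda>k::nat. int_emb F (int k)) \<subseteq> carrier F" using type_homD(1)[OF h] by auto
      ultimately show False using assms(2) by (meson finite_imageD finite_subset infinite_UNIV_nat)
    qed
    then obtain i j :: nat where ij: "i < j" "int_emb F (int i) = int_emb F (int j)"
      unfolding inj_def by (metis linorder_neqE_nat)
    have "int_emb F (int (j - i)) = \<zero>"
      using type_hom_diff[OF h cr, of "int j" "int i"] ij type_homD(1)[OF h] by (simp add: of_nat_diff)
    then show ?thesis using ij(1) by (metis zero_less_diff)
  qed
  define p where "p = (LEAST k. ?P k)"
  have p: "p > 0" "int_emb F (int p) = \<zero>" using LeastI_ex[OF \<open>\<exists>k. ?P k\<close>] by (auto simp: p_def)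
  have min: "p \<le> k" if "k > 0" "int_emb F (int k) = \<zero>" for k
    using Least_le[of ?P k] that by (simp add: p_def)
  have iff: "int_emb F k = \<zero> \<longleftrightarrow> int p dvd k" for k
  proof -
    have "int_emb F k = int_emb F (int p * (k div int p) + k mod int p)" by simp
    also have "\<dots> = int_emb F (int p) \<otimes> int_emb F (k div int p) \<oplus> int_emb F (k mod int p)"
      by (simp only: type_homD[OF h])
    also have "\<dots> = int_emb F (k mod int p)"
      using type_homD(1)[OF h] p(2) by simp
    finally have e: "int_emb F k = int_emb F (k mod int p)" .
    have "k mod int p = 0" if "int_emb F (k mod int p) = \<zero>"
    proof (rule ccontr)
      assume "k mod int p \<noteq> 0"
      then have "nat (k mod int p) > 0" "nat (k mod int p) < p"
        using p(1) pos_mod_bound[of "int p" k] pos_mod_sign[of "int p" k] by linarith+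
      then show False using min[of "nat (k mod int p)"] that by simp
    qed
    then show ?thesis using e z by auto
  qed
  have "Factorial_Ring.prime p"
  proof (rule prime_natI)
    have "p \<noteq> 1" using p(2) type_homD(4)[OF h] one_not_zero by auto
    then show "p \<ge> 2" using p(1) by linarith
    fix m n assume mn: "p dvd m * n"
    then have "int_emb F (int m * int n) = \<zero>" by (simp add: iff flip: of_nat_mult)
    then have "int_emb F (int m) = \<zero> \<or> int_emb F (int n) = \<zero>"
      using type_homD[OF h] integral by metis
    then show "p dvd m \<or> p dvd n" by (simp add: iff)
  qed
  then show thesis using that iff by blast
qed

text \<open>Pseudo-division multiplies the dividend by a power of the leading coefficient of the
  divisor. Here that is 1, so division with remainder works over the integers.\<close>

lemma poly_division_monic:
  fixes f m :: "'a::idom poly"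
  assumes "Polynomial.coeff m (Polynomial.degree m) = 1"
  obtains u r where "f = m * u + r" "r = 0 \<or> Polynomial.degree r < Polynomial.degree m"
proof -
  obtain q r where qr: "pseudo_divmod f m = (q, r)" by fastforce
  have "m \<noteq> 0" using assms by auto
  from pseudo_divmod[OF this qr] show thesis using that assms by auto
qed

text \<open>These are the canonical representatives of Z[x] modulo p and a monic polynomial of
  degree n; their number yields the cardinality of a finite field.\<close>

lemma card_bounded_polys:
  "card {r :: int poly. \<forall>i. Polynomial.coeff r i \<in> {0..<int p} \<and> (n \<le> i \<longrightarrow> Polynomial.coeff r i = 0)} = p ^ n"
  if "p > 0"
proof -
  let ?S = "{r :: int poly. \<forall>i. Polynomial.coeff r i \<in> {0..<int p} \<and> (n \<le> i \<longrightarrow> Polynomial.coeff r i = 0)}"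
  let ?F = "\<lambda>r. restrict (Polynomial.coeff r) {..<n}"
  have "bij_betw ?F ?S (PiE {..<n} (\<lambda>_. {0..<int p}))"
  proof (rule bij_betw_imageI)
    show "inj_on ?F ?S"
    proof (rule inj_onI)
      fix r s assume rs: "r \<in> ?S" "s \<in> ?S" "?F r = ?F s"
      show "r = s"
      proof (rule poly_eqI)
        fix i show "Polynomial.coeff r i = Polynomial.coeff s i"
          using rs(1,2) fun_cong[OF rs(3), of i] by (cases "i < n") simp_all
      qed
    qed
    show "?F ` ?S = PiE {..<n} (\<lambda>_. {0..<int p})"
    proof (intro equalityI subsetI)
      fix f assume f: "f \<in> PiE {..<n} (\<lambda>_. {0..<int p})"
      define r where "r = Poly (map f [0..<n])"
      have c: "Polynomial.coeff r i = (if i < n then f i else 0)" for i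
        by (simp add: r_def coeff_Poly_eq nth_default_def)
      have "r \<in> ?S" using f that by (auto simp: c PiE_def Pi_def)
      moreover have "?F r = f" using f by (auto simp: c fun_eq_iff PiE_def extensional_def)
      ultimately show "f \<in> ?F ` ?S" by blast
    qed (auto split: if_splits simp: linorder_not_less)
  qed
  then show ?thesis by (simp add: bij_betw_same_card card_PiE)
qed

text \<open>This presents F as Z[x]/(p, m). A generator \<open>g\<close> of the cyclic
  multiplicative group makes evaluation at \<open>g\<close> surjective, and \<open>m\<close> is a
  monic integer polynomial of least degree vanishing at \<open>g\<close>. Polynomials over the prime
  field are replaced by integer lifts, at the price of the second ideal generator p.\<close>

lemma finite_field_presentation:
  fixes F (structure)
  assumes "field F" "finite (carrier F)"
  obtains p n g m where "Factorial_Ring.prime p" "n \<ge> 1" "card (carrier F) = p ^ n" "g \<in> carrier F"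
    "\<And>k. int_emb F k = \<zero> \<longleftrightarrow> int p dvd k"
    "\<And>x. x \<in> carrier F \<Longrightarrow> \<exists>f. poly_ev F (int_emb F) g f = x"
    "Polynomial.degree m = n" "Polynomial.coeff m n = 1" "poly_ev F (int_emb F) g m = \<zero>"
    "\<And>f. poly_ev F (int_emb F) g f = \<zero> \<Longrightarrow> \<exists>u v. f = m * u + smult (int p) v"
proof -
  interpret field F by fact
  have cr: "cring F" ..
  note h = type_hom_int_emb[OF cr]
  obtain p where p: "Factorial_Ring.prime p" "\<And>k. int_emb F k = \<zero> \<longleftrightarrow> int p dvd k"
    using finite_field_char[OF assms] by blast
  obtain g where g: "g \<in> carrier F" "carrier (Multiplicative_Group.mult_of F) = {g [^] i | i::nat. i \<in> UNIV}"
    using finite_field_mult_group_has_gen[OF assms(2)] by (auto simp: Multiplicative_Group.carrier_mult_of)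
  let ?ev = "poly_ev F (int_emb F) g"
  note e = type_hom_poly_ev[OF cr h g(1)]
  note ed = type_homD[OF e] and ez = type_hom_zero[OF e cr] and em = type_hom_diff[OF e cr]
  note ec = poly_ev_closed[OF cr h g(1)]
  have ep: "?ev (smult (int p) f) = \<zero>" for f
    using poly_ev_smult[OF cr h g(1)] p(2)[of "int p"] ec[of f] by simp
  have surj: "\<exists>f. ?ev f = x" if "x \<in> carrier F" for x
  proof (cases "x = \<zero>")
    case True
    then show ?thesis using ez by auto
  next
    case False
    then have "x \<in> {g [^] i | i::nat. i \<in> UNIV}"
      using that g(2) by (auto simp: Multiplicative_Group.carrier_mult_of)
    then obtain i :: nat where "x = g [^] i" by blast
    then have "?ev ([:0, 1:] ^ i) = x"
      using type_hom_power[OF e cr] poly_ev_X[OF cr h g(1)] by simp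
    then show ?thesis by blast
  qed
  let ?Q = "card (carrier F)"
  have Q2: "?Q \<ge> 2"
  proof -
    have "card {\<zero>, \<one>} \<le> ?Q" by (rule card_mono) (use assms in auto)
    then show ?thesis using one_not_zero by simp
  qed
  let ?P = "\<lambda>d. \<exists>m. Polynomial.degree m = d \<and> Polynomial.coeff m d = 1 \<and> ?ev m = \<zero>"
  \<comment> \<open>The polynomial x^Q - x vanishes at every element, so monic polynomials
    annihilating \<open>g\<close> exist and a least degree makes sense.\<close>
  have "?P ?Q"
  proof (intro exI conjI)
    let ?f = "Polynomial.monom 1 ?Q - [:0, 1::int:]"
    show "Polynomial.degree ?f = ?Q"
      using Q2 by (subst diff_conv_add_uminus, subst degree_add_eq_left) (auto simp: degree_monom_eq)
    show "Polynomial.coeff ?f ?Q = 1" using Q2 by (simp add: coeff_pCons split: nat.split)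
    have "?ev ([:0,1:] ^ ?Q) = g [^] ?Q"
      using type_hom_power[OF e cr] poly_ev_X[OF cr h g(1)] by simp
    then have "?ev (Polynomial.monom 1 ?Q) = g"
      using finite_field_pow_card[OF assms g(1)] by (simp add: monom_altdef)
    then show "?ev ?f = \<zero>" using em poly_ev_X[OF cr h g(1)] g(1) by simp
  qed
  define n where "n = (LEAST d. ?P d)"
  obtain m where m: "Polynomial.degree m = n" "Polynomial.coeff m n = 1" "?ev m = \<zero>"
    using LeastI[of ?P, OF \<open>?P ?Q\<close>] unfolding n_def by blast
  have min: "n \<le> Polynomial.degree f"
    if "Polynomial.coeff f (Polynomial.degree f) = 1" "?ev f = \<zero>" for f
    unfolding n_def by (rule Least_le) (use that in blast)
  have n1: "n \<ge> 1"
  proof (rule ccontr)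
    assume "\<not> n \<ge> 1"
    then have "m = 1" using m by (metis One_nat_def degree_0_id less_one linorder_not_less one_pCons)
    then show False using m(3) ed(4) one_not_zero by simp
  qed
  \<comment> \<open>A nonzero \<open>f\<close> could be made monic modulo p: multiply by an inverse
    \<open>a\<close> of its leading coefficient and add a multiple of p in the top degree. This
    contradicts the minimality of n. The bound on absolute values fits differences of polynomials
    with coefficients in [0, p).\<close>
  have ev0: "f = 0 \<or> (\<forall>i. Polynomial.coeff f i = 0)"
    if "?ev f = \<zero>" "f = 0 \<or> Polynomial.degree f < n" "\<And>i. \<bar>Polynomial.coeff f i\<bar> < int p" for f
  proof (rule ccontr)
    assume "\<not> ?thesis"
    then have f0: "f \<noteq> 0" by auto
    define l where "l = Polynomial.coeff f (Polynomial.degree f)"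
    have "l \<noteq> 0" "\<bar>l\<bar> < int p" using f0 that by (auto simp: l_def)
    then have "\<not> int p dvd l" using zdvd_not_zless[of "\<bar>l\<bar>" "int p"] by auto
    then have "coprime l (int p)" using p(1)
      by (metis coprime_commute prime_imp_coprime prime_nat_int_transfer)
    then obtain a b where ab: "a * l + b * int p = 1"
      by (metis bezout_int coprime_imp_gcd_eq_1)
    define f' where "f' = smult a f + smult (int p) (Polynomial.monom b (Polynomial.degree f))"
    have c: "Polynomial.coeff f' (Polynomial.degree f) = 1"
      using ab by (simp add: f'_def l_def mult.commute)
    have "Polynomial.degree f' \<le> Polynomial.degree f"
      by (auto simp: f'_def intro!: degree_add_le order.trans[OF degree_smult_le] degree_monom_le)
    then have d: "Polynomial.degree f' = Polynomial.degree f"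
      using c le_degree[of f' "Polynomial.degree f"] by simp
    have "?ev f' = \<zero>"
      unfolding f'_def using ed(2) ep poly_ev_smult[OF cr h g(1)] that(1) type_homD(1)[OF h] by simp
    then have "n \<le> Polynomial.degree f" using min[of f'] c d by simp
    then show False using that(2) f0 by simp
  qed
  let ?S = "{r :: int poly. \<forall>i. Polynomial.coeff r i \<in> {0..<int p} \<and> (n \<le> i \<longrightarrow> Polynomial.coeff r i = 0)}"
  have inj: "r = s" if "r \<in> ?S" "s \<in> ?S" "?ev r = ?ev s" for r s
  proof -
    have "Polynomial.coeff (r - s) i = 0" if "n \<le> i" for i using \<open>r \<in> ?S\<close> \<open>s \<in> ?S\<close> that by simp
    then have "r - s = 0 \<or> Polynomial.degree (r - s) < n"
      by (metis leading_coeff_0_iff linorder_not_less)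
    moreover have "\<bar>Polynomial.coeff (r - s) i\<bar> < int p" for i
    proof -
      have "Polynomial.coeff r i \<in> {0..<int p}" "Polynomial.coeff s i \<in> {0..<int p}" using that by auto
      then show ?thesis by auto
    qed
    moreover have "?ev (r - s) = \<zero>" using em that(3) ec by simp
    ultimately have "r - s = 0" using ev0 by (metis leading_coeff_0_iff)
    then show ?thesis by simp
  qed
  have red: "\<exists>u v r. f = m * u + smult (int p) v + r \<and> r \<in> ?S" for f
  proof -
    obtain u t where t: "f = m * u + t" "t = 0 \<or> Polynomial.degree t < n"
      using poly_division_monic[of m f] m by metis
    define r where "r = map_poly (\<lambda>c. c mod int p) t"
    define v where "v = map_poly (\<lambda>c. c div int p) t"
    have "t = smult (int p) v + r"
      by (rule poly_eqI) (simp add: r_def v_def coeff_map_poly)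
    moreover have "Polynomial.coeff t i = 0" if "n \<le> i" for i
      using t(2) that by (auto intro: coeff_eq_0)
    then have "r \<in> ?S" using p(1) prime_gt_0_nat[of p] by (auto simp: r_def coeff_map_poly)
    ultimately have "f = m * u + smult (int p) v + r \<and> r \<in> ?S" using t(1) by (simp add: add.assoc)
    then show ?thesis by blast
  qed
  have evred: "?ev (m * u + smult (int p) v + r) = ?ev r" for u v r
    using ed(2,3) ep m(3) ec by simp
  have "bij_betw ?ev ?S (carrier F)"
  proof (rule bij_betw_imageI)
    show "inj_on ?ev ?S" using inj by (auto intro!: inj_onI)
    show "?ev ` ?S = carrier F"
    proof (intro equalityI subsetI)
      fix x assume "x \<in> carrier F"
      then obtain f where "x = ?ev f" using surj by blast
      moreover obtain u v r where r: "f = m * u + smult (int p) v + r" "r \<in> ?S" using red[of f] by blast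
      ultimately have "x = ?ev r" using evred by simp
      then show "x \<in> ?ev ` ?S" using r(2) by (rule image_eqI)
    qed (use ec in auto)
  qed
  then have card: "card (carrier F) = p ^ n"
    using card_bounded_polys[of p n, OF prime_gt_0_nat[OF p(1)]] by (simp only: bij_betw_same_card)
  have ker: "\<exists>u v. f = m * u + smult (int p) v" if "?ev f = \<zero>" for f
  proof -
    obtain u v r where r: "f = m * u + smult (int p) v + r" "r \<in> ?S" using red[of f] by blast
    then have "?ev r = ?ev 0" using that evred ez by simp
    then have "r = 0" using inj[of r 0] r(2) p(1) prime_gt_0_nat[of p] by simp
    then show ?thesis using r(1) by auto
  qed
  show thesis by (rule that[of p n g m]) (use p n1 card g(1) surj m ker in auto)
qed

section \<open>Homomorphisms between finite fields of equal size\<close>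

lemma finite_field_card:
  assumes "field F" "finite (carrier F)"
  obtains p n where "Factorial_Ring.prime p" "n \<ge> 1" "card (carrier F) = p ^ n"
  using finite_field_presentation[OF assms] by metis

text \<open>A homomorphism is determined by the image of \<open>g\<close>, which must be a root of
  \<open>m\<close> in F'. Conversely each root defines a homomorphism, because the kernel of
  evaluation at \<open>g\<close> is generated by \<open>m\<close> and p, both of which vanish at the
  root. Extensionality counts each map on the carrier once.\<close>

lemma card_finite_field_hom:
  fixes F :: "('a, 'm) ring_scheme" and F' :: "('b, 'n) ring_scheme"
  assumes F: "field F" "finite (carrier F)" and F': "field F'" "finite (carrier F')"
    and p: "Factorial_Ring.prime p" "card (carrier F) = p ^ n" "card (carrier F') = p ^ n" and n: "n \<ge> 1"
  shows "card {\<phi> \<in> extensional (carrier F). \<phi> \<in> ring_hom F F'} = n"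
proof -
  interpret F: field F by fact
  interpret F': field F' by fact
  have cr: "cring F" "cring F'" by unfold_locales
  note h = type_hom_int_emb[OF cr(1)] and h' = type_hom_int_emb[OF cr(2)]
  obtain p1 n1 g m where P: "Factorial_Ring.prime p1" "n1 \<ge> 1" "card (carrier F) = p1 ^ n1" "g \<in> carrier F"
    "\<And>k. int_emb F k = \<zero>\<^bsub>F\<^esub> \<longleftrightarrow> int p1 dvd k"
    "\<And>x. x \<in> carrier F \<Longrightarrow> \<exists>f. poly_ev F (int_emb F) g f = x"
    "Polynomial.degree m = n1" "Polynomial.coeff m n1 = 1" "poly_ev F (int_emb F) g m = \<zero>\<^bsub>F\<^esub>"
    "\<And>f. poly_ev F (int_emb F) g f = \<zero>\<^bsub>F\<^esub> \<Longrightarrow> \<exists>u v. f = m * u + smult (int p1) v"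
    using finite_field_presentation[OF F] by blast
  obtain p2 n2 where P': "Factorial_Ring.prime p2" "n2 \<ge> 1" "card (carrier F') = p2 ^ n2"
    "\<And>k. int_emb F' k = \<zero>\<^bsub>F'\<^esub> \<longleftrightarrow> int p2 dvd k"
    using finite_field_presentation[OF F'] by metis
  have eq: "p1 = p" "n1 = n" "p2 = p"
    using prime_power_inj''[of p1 p n1 n] prime_power_inj''[of p2 p n2 n] P(1-3) P'(1-3) p n by auto
  note P = P[unfolded eq] and P' = P'[unfolded eq]
  let ?Q = "p ^ n"
  let ?ev = "poly_ev F (int_emb F) g"
  let ?ev' = "\<lambda>a. poly_ev F' (int_emb F') a"
  note e = type_hom_poly_ev[OF cr(1) h P(4)]
  note e' = type_hom_poly_ev[OF cr(2) h']
  have evp': "?ev' a (smult (int p) f) = \<zero>\<^bsub>F'\<^esub>" if "a \<in> carrier F'" for a f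
    using poly_ev_smult[OF cr(2) h' that] P'(4)[of "int p"] poly_ev_closed[OF cr(2) h' that] by simp
  have frob: "type_hom f R \<Longrightarrow> cring R \<Longrightarrow> f (Polynomial.monom 1 ?Q - [:0, 1::int:]) = f [:0, 1:] [^]\<^bsub>R\<^esub> ?Q \<ominus>\<^bsub>R\<^esub> f [:0, 1:]"
    for f :: "int poly \<Rightarrow> 'c" and R :: "('c, 'd) ring_scheme"
    by (simp add: type_hom_diff monom_altdef type_hom_power)
  define f where "f = Polynomial.monom 1 ?Q - [:0, 1::int:]"
  have f0: "?ev f = \<zero>\<^bsub>F\<^esub>"
    unfolding f_def using frob[OF e cr(1)] finite_field_pow_card[OF F P(4)] poly_ev_X[OF cr(1) h P(4)] P(4) p(2)
    by (simp add: F.r_right_minus_eq)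
  have f0': "?ev' a f = \<zero>\<^bsub>F'\<^esub>" if "a \<in> carrier F'" for a
    unfolding f_def using frob[OF e'[OF that] cr(2)] finite_field_pow_card[OF F' that] poly_ev_X[OF cr(2) h' that] that p(3)
    by (simp add: F'.r_right_minus_eq)
  have pn: "p > 1" "n < ?Q" using prime_gt_1_nat[OF p(1)] by (auto intro: power_gt_expt)
  then have Q2: "?Q > 1" using n by linarith
  have df: "Polynomial.degree f = ?Q"
    unfolding f_def using Q2 pn n by (subst diff_conv_add_uminus, subst degree_add_eq_left) (auto simp: degree_monom_eq)
  have cf: "Polynomial.coeff f ?Q = 1"
    unfolding f_def using Q2 n pn(1) by (simp add: coeff_pCons split: nat.split)
  obtain u r where ur: "f = m * u + r" "r = 0 \<or> Polynomial.degree r < n"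
    using poly_division_monic[of m f] P(7,8) by metis
  have evr: "?ev r = \<zero>\<^bsub>F\<^esub>"
    using f0 ur(1) P(9) type_homD[OF e] by simp
  \<comment> \<open>The remainder is divisible by p. Its coefficients from degree n on vanish, so
    after the cofactor of \<open>m\<close> has been reduced modulo p to \<open>v'\<close>, a nonzero
    \<open>v'\<close> would give \<open>m * v'\<close> a leading coefficient not divisible by p in a
    degree where \<open>r\<close> vanishes.\<close>
  obtain s where s: "r = smult (int p) s"
  proof -
    obtain u' v where v: "r = m * u' + smult (int p) v" using P(10)[OF evr] by blast
    obtain w where "r = smult (int p) w"
    proof -
      have "int p dvd Polynomial.coeff r i" for i
      proof -
        define v' where "v' = map_poly (\<lambda>c. c mod int p) u'"
        define w' where "w' = map_poly (\<lambda>c. c div int p) u'"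
        have u': "u' = smult (int p) w' + v'"
          by (rule poly_eqI) (simp add: v'_def w'_def coeff_map_poly)
        have r: "r = m * v' + smult (int p) (m * w' + v)"
          unfolding v u' by (simp add: algebra_simps smult_add_right)
        have "v' = 0"
        proof (rule ccontr)
          assume "v' \<noteq> 0"
          define j where "j = Polynomial.degree v'"
          define l where "l = Polynomial.coeff v' j"
          have "l \<noteq> 0" using \<open>v' \<noteq> 0\<close> by (simp add: l_def j_def)
          moreover have "0 \<le> l" "l < int p" using pn by (auto simp: l_def v'_def coeff_map_poly)
          ultimately have nd: "\<not> int p dvd l" using zdvd_not_zless by force
          have "Polynomial.coeff (m * v') (n + j) = l"
            using coeff_mult_degree_sum[of m v'] P(7,8) by (simp add: l_def j_def)
          moreover have "Polynomial.coeff r (n + j) = 0" using ur(2) by (auto intro: coeff_eq_0)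
          ultimately have "l + int p * Polynomial.coeff (m * w' + v) (n + j) = 0"
            by (subst (asm) r) simp
          then show False using nd by (metis dvd_add_left_iff dvd_triv_left dvd_0_right)
        qed
        then show ?thesis using r by simp
      qed
      then have "[:int p:] dvd r" by (simp add: const_poly_dvd_iff)
      then show thesis using that by (auto elim!: dvdE simp: mult.commute)
    qed
    then show thesis using that by blast
  qed
  \<comment> \<open>Since \<open>f\<close> and \<open>m\<close> are monic and \<open>r\<close> has
    degree below n, the cofactor \<open>u\<close> is monic of the complementary degree, which bounds
    the number of its roots by Q - n.\<close>
  have u: "Polynomial.degree u = ?Q - n \<and> Polynomial.coeff u (Polynomial.degree u) = 1"
  proof -
    have "n < ?Q" by (rule pn)
    have d: "Polynomial.degree (m * u) = ?Q \<and> Polynomial.coeff (m * u) ?Q = 1"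
    proof -
      have mu: "m * u = f - r" using ur(1) by simp
      have "Polynomial.coeff r ?Q = 0" using ur(2) \<open>n < ?Q\<close> by (auto intro: coeff_eq_0)
      then have c: "Polynomial.coeff (m * u) ?Q = 1" using cf mu by simp
      have "Polynomial.degree (f - r) \<le> ?Q"
        using df ur(2) \<open>n < ?Q\<close> by (intro degree_diff_le) auto
      then show ?thesis using c mu le_degree[of "m * u" ?Q] by auto
    qed
    then have "u \<noteq> 0" "m \<noteq> 0" using Q2 by (auto simp del: One_nat_def)
    then have "Polynomial.degree (m * u) = n + Polynomial.degree u" using P(7) by (simp add: degree_mult_eq)
    then show ?thesis using d P(7,8) coeff_mult_degree_sum[of m u] by auto
  qed
  \<comment> \<open>\<open>f = x^Q - x\<close> vanishes on \<open>F'\<close> and equals \<open>m * u\<close> modulo \<open>p\<close>, so each of the \<open>Q\<close> elements is a root of \<open>m\<close> or \<open>u\<close>.\<close>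
  define A where "A = {a \<in> carrier F'. ?ev' a m = \<zero>\<^bsub>F'\<^esub>}"
  define B where "B = {a \<in> carrier F'. ?ev' a u = \<zero>\<^bsub>F'\<^esub>}"
  have "carrier F' \<subseteq> A \<union> B"
  proof
    fix a assume a: "a \<in> carrier F'"
    have "?ev' a m \<otimes>\<^bsub>F'\<^esub> ?ev' a u = \<zero>\<^bsub>F'\<^esub>"
      using f0'[OF a] ur(1) s evp'[OF a] type_homD[OF e'[OF a]] by simp
    then show "a \<in> A \<union> B" using a F'.integral type_homD(1)[OF e'[OF a]] by (auto simp: A_def B_def)
  qed
  moreover have "finite A" "card A \<le> n" "finite B" "card B \<le> ?Q - n"
    using card_roots_monic_le[OF F'(1), of m] card_roots_monic_le[OF F'(1), of u] P(7,8) u by (auto simp: A_def B_def)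
  \<comment> \<open>The Q elements are covered by at most n roots of \<open>m\<close> and at most Q
    - n roots of \<open>u\<close>, so both bounds are attained.\<close>
  ultimately have "?Q \<le> card A + card B"
    using p(3) by (metis card_mono card_Un_le finite_UnI order.trans)
  then have cA: "card A = n" using \<open>card A \<le> n\<close> \<open>card B \<le> ?Q - n\<close> pn by linarith
  let ?H = "{\<phi> \<in> extensional (carrier F). \<phi> \<in> ring_hom F F'}"
  have ev_hom: "\<phi> (?ev f) = ?ev' (\<phi> g) f" if "\<phi> \<in> ring_hom F F'" for \<phi> f
    using poly_ev_hom[OF cr that P(4)] .
  have hz: "\<phi> \<zero>\<^bsub>F\<^esub> = \<zero>\<^bsub>F'\<^esub>" if "\<phi> \<in> ring_hom F F'" for \<phi>
    using ring_hom_zero[OF that] F.ring_axioms F'.ring_axioms by blast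
  have "bij_betw (\<lambda>\<phi>. \<phi> g) ?H A"
  proof (rule bij_betw_imageI)
    show "inj_on (\<lambda>\<phi>. \<phi> g) ?H"
    proof (rule inj_onI)
      fix \<phi> \<psi> assume H: "\<phi> \<in> ?H" "\<psi> \<in> ?H" "\<phi> g = \<psi> g"
      show "\<phi> = \<psi>"
      proof (rule extensionalityI)
        fix x assume "x \<in> carrier F"
        then obtain f where "x = ?ev f" using P(6) by metis
        then show "\<phi> x = \<psi> x" using ev_hom[of \<phi> f] ev_hom[of \<psi> f] H by simp
      qed (use H in auto)
    qed
    show "(\<lambda>\<phi>. \<phi> g) ` ?H = A"
    proof (intro equalityI subsetI)
      fix a assume "a \<in> (\<lambda>\<phi>. \<phi> g) ` ?H"
      then obtain \<phi> where \<phi>: "\<phi> \<in> ring_hom F F'" "a = \<phi> g" by auto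
      then show "a \<in> A" using P(4,9) ev_hom[OF \<phi>(1), of m] hz[OF \<phi>(1)] ring_hom_closed[OF \<phi>(1)]
        by (simp add: A_def)
    next
      fix a assume a: "a \<in> A"
      then have aF: "a \<in> carrier F'" by (simp add: A_def)
      note ea = type_homD[OF e'[OF aF]]
      \<comment> \<open>Two polynomials with the same value at \<open>g\<close> differ by an element
        of the ideal (m, p), which vanishes at \<open>a\<close>; hence the map below does not depend
        on the chosen preimage.\<close>
      have wd: "?ev' a f = ?ev' a f'" if "?ev f = ?ev f'" for f f'
      proof -
        have "?ev (f - f') = \<zero>\<^bsub>F\<^esub>"
          using type_hom_diff[OF e cr(1)] that type_homD(1)[OF e] by simp
        then obtain u v where "f - f' = m * u + smult (int p) v" using P(10) by blast
        then have "?ev' a (f - f') = \<zero>\<^bsub>F'\<^esub>"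
          using ea evp'[OF aF] a by (simp add: A_def)
        then show ?thesis
          using type_hom_diff[OF e'[OF aF] cr(2)] ea(1) by (simp add: F'.r_right_minus_eq)
      qed
      define \<phi> where "\<phi> = restrict (\<lambda>x. ?ev' a (SOME f. ?ev f = x)) (carrier F)"
      have \<phi>: "\<phi> (?ev f) = ?ev' a f" for f
      proof -
        have "?ev (SOME f'. ?ev f' = ?ev f) = ?ev f" by (rule someI[of _ f]) simp
        then have "?ev' a (SOME f'. ?ev f' = ?ev f) = ?ev' a f" by (rule wd)
        then show ?thesis unfolding \<phi>_def restrict_apply using type_homD(1)[OF e, of f] by simp
      qed
      have "\<phi> \<in> ring_hom F F'"
      proof (rule ring_hom_memI)
        fix x y assume "x \<in> carrier F" "y \<in> carrier F"
        then obtain f1 f2 where *: "?ev f1 = x" "?ev f2 = y" using P(6) by blast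
        show "\<phi> (x \<otimes>\<^bsub>F\<^esub> y) = \<phi> x \<otimes>\<^bsub>F'\<^esub> \<phi> y" "\<phi> (x \<oplus>\<^bsub>F\<^esub> y) = \<phi> x \<oplus>\<^bsub>F'\<^esub> \<phi> y"
          unfolding *[symmetric] type_homD(2,3)[OF e, symmetric] \<phi> ea(2,3) by (rule refl)+
      next
        show "\<phi> \<one>\<^bsub>F\<^esub> = \<one>\<^bsub>F'\<^esub>" using \<phi>[of 1] type_homD(4)[OF e] ea(4) by simp
      qed (auto simp: \<phi>_def ea)
      moreover have "\<phi> g = a"
        using \<phi>[of "[:0, 1:]"] poly_ev_X[OF cr(1) h P(4)] poly_ev_X[OF cr(2) h' aF] by simp
      moreover have "\<phi> \<in> extensional (carrier F)" by (simp add: \<phi>_def)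
      ultimately show "a \<in> (\<lambda>\<phi>. \<phi> g) ` ?H" by blast
    qed
  qed
  then show ?thesis using cA by (simp add: bij_betw_same_card)
qed

lemma field_hom_imp_iso:
  assumes "field F" "field F'" "finite (carrier F')" "card (carrier F) = card (carrier F')" "\<phi> \<in> ring_hom F F'"
  shows "\<phi> \<in> ring_iso F F'"
proof -
  have "inj_on \<phi> (carrier F)"
    using non_trivial_field_hom_is_inj[OF assms(5,1,2)] .
  moreover have "\<phi> ` carrier F \<subseteq> carrier F'" using ring_hom_closed[OF assms(5)] by auto
  ultimately have "bij_betw \<phi> (carrier F) (carrier F')"
    using assms(3,4) by (metis bij_betw_def card_image card_subset_eq)
  then show ?thesis using assms(5) by (simp add: ring_iso_def)
qed

section \<open>Existence of finite fields\<close>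

text \<open>The middle binomial coefficients are divisible by p. The error term stays explicit
  because the identity is used in Z[x, y], where p is not zero, and only afterwards evaluated in
  characteristic p.\<close>

lemma prime_binomial_power:
  fixes x y :: "'a::comm_ring_1"
  assumes "Factorial_Ring.prime p"
  shows "\<exists>g. (x + y) ^ p = x ^ p + y ^ p + of_nat p * g"
proof -
  have p: "p > 0" using assms prime_gt_0_nat by simp
  have dvd: "p dvd (p choose k)" if "k \<in> {1..<p}" for k
    using that assms by (intro dvd_choose_prime) auto
  have "(x + y) ^ p = (\<Sum>k\<le>p. of_nat (p choose k) * x ^ k * y ^ (p - k))"
    by (rule binomial_ring)
  also have "{..p} = insert 0 (insert p {1..<p})" using p by auto
  also have "(\<Sum>k\<in>\<dots>. of_nat (p choose k) * x ^ k * y ^ (p - k)) =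
     y ^ p + (x ^ p + (\<Sum>k\<in>{1..<p}. of_nat (p choose k) * x ^ k * y ^ (p - k)))"
    using p by (subst sum.insert, simp, simp, subst sum.insert) auto
  also have "(\<Sum>k\<in>{1..<p}. of_nat (p choose k) * x ^ k * y ^ (p - k)) =
     (\<Sum>k\<in>{1..<p}. of_nat p * (of_nat ((p choose k) div p) * x ^ k * y ^ (p - k)))"
  proof (rule sum.cong)
    fix k assume "k \<in> {1..<p}"
    then have "of_nat (p choose k) = (of_nat p * of_nat ((p choose k) div p) :: 'a)"
      using dvd[of k] by (simp flip: of_nat_mult)
    then show "of_nat (p choose k) * x ^ k * y ^ (p - k) =
        of_nat p * (of_nat ((p choose k) div p) * x ^ k * y ^ (p - k))" by (simp add: mult.assoc)
  qed simp
  finally have "(x + y) ^ p = y ^ p + (x ^ p + of_nat p *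
      (\<Sum>k\<in>{1..<p}. of_nat ((p choose k) div p) * x ^ k * y ^ (p - k)))"
    by (simp only: sum_distrib_left)
  then show ?thesis
    by (intro exI[of _ "\<Sum>k\<in>{1..<p}. of_nat ((p choose k) div p) * x ^ k * y ^ (p - k)"])
      (simp only: add.assoc add.left_commute)
qed

text \<open>Additivity of Frobenius comes from a universal identity: expand in
  \<open>int poly poly\<close>, evaluate the two variables at \<open>a\<close> and \<open>b\<close>,
  and the multiple of p vanishes. Iteration gives the n-th power.\<close>

lemma char_p_power_add:
  fixes R (structure)
  assumes "cring R" "Factorial_Ring.prime p" "int_emb R (int p) = \<zero>" "a \<in> carrier R" "b \<in> carrier R"
  shows "(a \<oplus> b) [^] (p ^ n) = a [^] (p ^ n) \<oplus> b [^] (p ^ n)"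
proof -
  interpret cring R by fact
  note h = type_hom_int_emb[OF assms(1)]
  have step: "(a \<oplus> b) [^] p = a [^] p \<oplus> b [^] p" if ab: "a \<in> carrier R" "b \<in> carrier R" for a b
  proof -
    note h1 = type_hom_poly_ev[OF assms(1) h ab(1)]
    note h2 = type_hom_poly_ev[OF assms(1) h1 ab(2)]
    let ?ev = "poly_ev R (poly_ev R (int_emb R) a) b"
    let ?x = "[:[:0, 1:]:] :: int poly poly" and ?y = "[:0, 1:] :: int poly poly"
    have x: "?ev ?x = a" using poly_ev_const[OF assms(1) h1 ab(2)] poly_ev_X[OF assms(1) h ab(1)] by simp
    have y: "?ev ?y = b" using poly_ev_X[OF assms(1) h1 ab(2)] by simp
    \<comment> \<open>Along the constants the nested evaluation is a homomorphism from the integers,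
      hence equals \<open>int_emb\<close>; so it sends p to zero.\<close>
    have "type_hom (\<lambda>k::int. ?ev (of_int k)) R" using h2 by (simp add: type_hom_def)
    then have "?ev (of_int (int p)) = int_emb R (int p)"
      using type_hom_int_unique[OF assms(1)] by blast
    then have p: "?ev (of_nat p) = \<zero>" using assms(3) by simp
    obtain g where "(?x + ?y) ^ p = ?x ^ p + ?y ^ p + of_nat p * g" using prime_binomial_power[OF assms(2)] by blast
    then have "?ev ((?x + ?y) ^ p) = ?ev (?x ^ p + ?y ^ p + of_nat p * g)" by simp
    then have "(?ev ?x \<oplus> ?ev ?y) [^] p = ?ev ?x [^] p \<oplus> ?ev ?y [^] p \<oplus> ?ev (of_nat p) \<otimes> ?ev g"
      by (simp only: type_homD(2,3)[OF h2] type_hom_power[OF h2 assms(1)])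
    then show ?thesis using x y p type_homD(1)[OF h2, of g] ab by simp
  qed
  show ?thesis
  proof (induction n)
    case 0
    then show ?case using assms by simp
  next
    case (Suc n)
    have e: "c [^] (p ^ Suc n) = (c [^] (p ^ n)) [^] p" if "c \<in> carrier R" for c
      using that by (simp add: nat_pow_pow mult.commute)
    show ?case using Suc assms(4,5) by (simp only: e step a_closed nat_pow_closed)
  qed
qed

lemma ring_hom_nat_pow:
  assumes "cring R" "cring S" "\<phi> \<in> ring_hom R S" "x \<in> carrier R"
  shows "\<phi> (x [^]\<^bsub>R\<^esub> (n::nat)) = \<phi> x [^]\<^bsub>S\<^esub> n"
proof -
  interpret R: cring R by fact
  interpret S: cring S by fact
  show ?thesis by (induction n) (use assms in \<open>auto simp: ring_hom_one ring_hom_mult\<close>)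
qed

text \<open>The field is an algebraic closure of the residue ring modulo p, and the unusual element
  type is the one in which that closure is built. The image of p vanishes already in the residue
  ring.\<close>

lemma exists_char_p_closed_field:
  assumes "Factorial_Ring.prime p"
  obtains L :: "((int list \<times> nat) multiset \<Rightarrow> int) ring" where "algebraically_closed L" "int_emb L (int p) = \<zero>\<^bsub>L\<^esub>"
proof -
  interpret K: residues_prime p "residue_ring (int p)"
    by (simp add: residues_prime_def assms)
  let ?K = "residue_ring (int p)"
  obtain L :: "((int list \<times> nat) multiset \<Rightarrow> int) ring"
    where L: "algebraic_closure L (K.indexed_const ` (carrier ?K))" and h: "K.indexed_const \<in> ring_hom ?K L"
    using K.exists_closure by blast
  interpret L: algebraic_closure L "K.indexed_const ` (carrier ?K)" by (rule L)
  have cr: "cring ?K" "cring L" by unfold_locales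
  have "type_hom (\<lambda>k. k mod int p) ?K"
    unfolding type_hom_def
    by (intro conjI allI) (rule K.mod_in_carrier K.add_cong[symmetric] K.mult_cong[symmetric] K.one_cong[symmetric])+
  then have "int_emb ?K (int p) = \<zero>\<^bsub>?K\<^esub>"
    using type_hom_int_unique[OF cr(1), of "\<lambda>k. k mod int p" "int p"] by (simp add: K.zero_cong)
  then have "int_emb L (int p) = K.indexed_const \<zero>\<^bsub>?K\<^esub>"
    using type_hom_int_hom[OF cr h, of "int p"] by simp
  also have "\<dots> = \<zero>\<^bsub>L\<^esub>"
    by (rule ring_hom_zero[OF h K.ring_axioms L.ring_axioms])
  finally show thesis using that[of L] L.algebraically_closed_axioms by blast
qed

text \<open>The polynomial X^q - X has degree q and splits over \<open>L\<close>, so it has q roots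
  counted with multiplicity; simplicity of every root turns this multiset into a set of q
  elements.\<close>

lemma card_frobenius_fixed_points:
  fixes L (structure)
  assumes "algebraically_closed L" "Factorial_Ring.prime p" "int_emb L (int p) = \<zero>" "n \<ge> 1"
  shows "finite {a \<in> carrier L. a [^] (p ^ n) = a}" "card {a \<in> carrier L. a [^] (p ^ n) = a} = p ^ n"
proof -
  interpret algebraically_closed L by fact
  define q where "q = p ^ n"
  have q: "q > 1" unfolding q_def using assms(2,4) prime_gt_1_nat[of p] by (intro one_less_power) auto
  let ?U = "poly_ring L"
  interpret U: domain ?U by (rule univ_poly_is_domain[OF carrier_is_subring])
  have crU: "cring ?U" and crL: "cring L" by unfold_locales
  note xc = var_closed[OF carrier_is_subring]
  have cst: "poly_of_const \<in> ring_hom L ?U"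
    using canonical_embedding_is_hom[OF carrier_is_subring] by simp
  have pU: "int_emb ?U (int p) = \<zero>\<^bsub>?U\<^esub>"
    using type_hom_int_hom[OF crL crU cst, of "int p"] assms(3)
      ring_hom_zero[OF cst ring_axioms U.ring_axioms] by simp
  define P where "P = X [^]\<^bsub>?U\<^esub> q \<ominus>\<^bsub>?U\<^esub> X"
  have Pc: "P \<in> carrier ?U" using xc by (simp add: P_def)
  have degX: "Polynomials.degree X = 1" by (simp add: var_def)
  have degP: "Polynomials.degree P = q"
  proof -
    have d1: "Polynomials.degree (X [^]\<^bsub>?U\<^esub> q) = q"
      using polynomial_pow_degree[OF xc(1)] degX by simp
    have d2: "Polynomials.degree (\<ominus>\<^bsub>?U\<^esub> X) = 1"
      using univ_poly_a_inv_degree[OF carrier_is_subring xc(1)] degX by simp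
    have pl: "polynomial (carrier L) (X [^]\<^bsub>?U\<^esub> q)" "polynomial (carrier L) (\<ominus>\<^bsub>?U\<^esub> X)"
      using xc(1) by (auto simp: univ_poly_carrier)
    have "Polynomials.degree (X [^]\<^bsub>?U\<^esub> q) \<noteq> Polynomials.degree (\<ominus>\<^bsub>?U\<^esub> X)"
      unfolding d1 d2 using q by linarith
    from poly_add_degree_eq[OF carrier_is_subring pl this]
    have "Polynomials.degree (poly_add (X [^]\<^bsub>?U\<^esub> q) (\<ominus>\<^bsub>?U\<^esub> X)) = max q 1"
      unfolding d1 d2 .
    then show ?thesis
      using q unfolding P_def a_minus_def univ_poly_add by linarith
  qed
  have ev: "eval P a = a [^] q \<ominus> a" if "a \<in> carrier L" for a
  proof -
    interpret E: ring_hom_cring ?U L "\<lambda>p. eval p a"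
      by (intro ring_hom_cring.intro ring_hom_cring_axioms.intro crL crU eval_is_hom carrier_is_subring that)
    have "eval (X [^]\<^bsub>?U\<^esub> q) a = a [^] q"
      using ring_hom_nat_pow[OF crU crL E.homh xc(1)] eval_var[OF that] by simp
    then show ?thesis unfolding P_def a_minus_def using xc(1) eval_var[OF that]
      by (simp only: E.hom_add E.hom_a_inv U.nat_pow_closed U.a_inv_closed)
  qed
  have P0: "P \<noteq> []" using degP q by (intro notI) simp
  have root: "is_root P a \<longleftrightarrow> a \<in> carrier L \<and> a [^] q = a" for a
    using ev[of a] P0 by (cases "a \<in> carrier L") (auto simp: is_root_def r_right_minus_eq)
  \<comment> \<open>With \<open>Y = X - a\<close>, the Frobenius map gives \<open>X^q - X = Y^q - Y = Y * (Y^(q-1) - 1)\<close>, and the second factor is nonzero at \<open>a\<close>.\<close>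
  have simple: "alg_mult P a \<le> 1" if a: "a \<in> carrier L" "a [^] q = a" for a
  proof (rule ccontr)
    let ?Y = "[\<one>, \<ominus> a]"
    assume "\<not> alg_mult P a \<le> 1"
    then have dv: "(?Y [^]\<^bsub>?U\<^esub> (2::nat)) pdivides P"
      using le_alg_mult_imp_pdivides[OF a(1) Pc, of 2] by simp
    have Y: "?Y \<in> carrier ?U" using a by (auto simp: univ_poly_carrier[symmetric] polynomial_def)
    obtain g where g: "g \<in> carrier ?U" "P = (?Y [^]\<^bsub>?U\<^esub> (2::nat)) \<otimes>\<^bsub>?U\<^esub> g"
      using dv unfolding pdivides_def by auto
    let ?c = "poly_of_const a"
    have c: "?c \<in> carrier ?U" using ring_hom_closed[OF cst a(1)] .
    have X: "X = ?Y \<oplus>\<^bsub>?U\<^esub> ?c"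
      using a(1) by (simp add: univ_poly_add var_def poly_of_const_def l_neg)
    have cq: "?c [^]\<^bsub>?U\<^esub> q = ?c"
      using ring_hom_nat_pow[OF crL crU cst a(1), of "q"] a(2) by simp
    have "P = ?Y [^]\<^bsub>?U\<^esub> q \<ominus>\<^bsub>?U\<^esub> ?Y"
      unfolding P_def X char_p_power_add[OF crU assms(2) pU Y c, of n, folded q_def] cq a_minus_def
      using Y c U.nat_pow_closed[OF Y, of "q"] by (simp add: U.minus_add U.a_ac U.r_neg1 U.r_neg2 U.r_neg)
    also have "\<dots> = ?Y \<otimes>\<^bsub>?U\<^esub> (?Y [^]\<^bsub>?U\<^esub> (q - 1) \<ominus>\<^bsub>?U\<^esub> \<one>\<^bsub>?U\<^esub>)"
    proof -
      have "?Y [^]\<^bsub>?U\<^esub> q = ?Y \<otimes>\<^bsub>?U\<^esub> ?Y [^]\<^bsub>?U\<^esub> (q - 1)"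
        using q U.nat_pow_Suc2[OF Y, of "q - 1"] by simp
      then show ?thesis using Y by (simp add: U.r_minus U.r_distr a_minus_def)
    qed
    finally have "?Y \<otimes>\<^bsub>?U\<^esub> (?Y [^]\<^bsub>?U\<^esub> (q - 1) \<ominus>\<^bsub>?U\<^esub> \<one>\<^bsub>?U\<^esub>) = ?Y \<otimes>\<^bsub>?U\<^esub> (?Y \<otimes>\<^bsub>?U\<^esub> g)"
      using g Y by (simp add: numeral_2_eq_2 U.m_assoc)
    \<comment> \<open>After one factor \<open>?Y\<close> is cancelled, evaluation at
      \<open>a\<close> gives 0^(q-1) - 1 = 0, which is impossible because q > 1.\<close>
    then have "?Y [^]\<^bsub>?U\<^esub> (q - 1) \<ominus>\<^bsub>?U\<^esub> \<one>\<^bsub>?U\<^esub> = ?Y \<otimes>\<^bsub>?U\<^esub> g"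
      using U.m_lcancel[of ?Y] Y g(1) by (simp add: univ_poly_zero)
    then have eq: "eval (?Y [^]\<^bsub>?U\<^esub> (q - 1) \<ominus>\<^bsub>?U\<^esub> \<one>\<^bsub>?U\<^esub>) a = eval (?Y \<otimes>\<^bsub>?U\<^esub> g) a" by simp
    interpret E: ring_hom_cring ?U L "\<lambda>p. eval p a"
      by (intro ring_hom_cring.intro ring_hom_cring_axioms.intro crL crU eval_is_hom carrier_is_subring a(1))
    have eY: "eval ?Y a = \<zero>" using a(1) by (simp add: r_neg)
    have "eval ?Y a [^] (q - 1) \<ominus> \<one> = eval ?Y a \<otimes> eval g a"
      using eq Y g(1) by (simp only: a_minus_def E.hom_add E.hom_a_inv E.hom_one E.hom_mult
          ring_hom_nat_pow[OF crU crL E.homh] U.nat_pow_closed U.one_closed U.a_inv_closed)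
    then have "\<zero> [^] (q - 1) \<ominus> \<one> = \<zero>"
      unfolding eY using g(1) E.hom_closed by simp
    moreover have "\<zero> [^] (q - 1) = \<zero>" by (rule nat_pow_zero) (use q in linarith)
    ultimately have "\<ominus> \<one> = \<zero>" by (simp add: a_minus_def)
    then have "\<one> = \<zero>" using minus_minus[OF one_closed] by simp
    then show False by simp
  qed
  have "set_mset (roots P) = {a \<in> carrier L. a [^] q = a}"
    using roots_mem_iff_is_root[OF Pc] root by auto
  moreover have "roots P = mset_set (set_mset (roots P))"
  proof (rule multiset_eqI)
    fix a
    have "count (roots P) a = alg_mult P a" using alg_mult_eq_count_roots[OF Pc] by simp
    then have "a \<in># roots P \<Longrightarrow> count (roots P) a = 1"
      using simple root roots_mem_iff_is_root[OF Pc] by (metis count_greater_eq_one_iff le_antisym)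
    then show "count (roots P) a = count (mset_set (set_mset (roots P))) a"
      by (metis count_mset_set(1) count_mset_set(3) finite_set_mset not_in_iff)
  qed
  moreover have "size (roots P) = q"
    using roots_over_carrier[OF Pc] degP by (simp add: splitted_def)
  ultimately show "finite {a \<in> carrier L. a [^] (p ^ n) = a}" "card {a \<in> carrier L. a [^] (p ^ n) = a} = p ^ n"
    unfolding q_def[symmetric] by (metis finite_set_mset, metis size_mset_set)
qed

text \<open>The fixed points of the p^n-th power map are closed under addition by the Frobenius
  identity, and under products and inverses since the map is multiplicative. A bijection onto an
  initial segment then moves the field into the type \<open>nat ring\<close>, as \<open>GF\<close>
  requires.\<close>

lemma exists_finite_field:
  assumes "Factorial_Ring.prime p" "n \<ge> 1"
  shows "\<exists>F::nat ring. field F \<and> finite (carrier F) \<and> card (carrier F) = p ^ n"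
proof -
  obtain L :: "((int list \<times> nat) multiset \<Rightarrow> int) ring"
    where L: "algebraically_closed L" "int_emb L (int p) = \<zero>\<^bsub>L\<^esub>"
    using exists_char_p_closed_field[OF assms(1)] by blast
  interpret algebraically_closed L by fact
  have crL: "cring L" by unfold_locales
  have q: "p ^ n > 1" using assms prime_gt_1_nat[of p] by (intro one_less_power) auto
  let ?S = "{a \<in> carrier L. a [^]\<^bsub>L\<^esub> (p ^ n) = a}"
  note S = card_frobenius_fixed_points[OF L(1) assms(1) L(2) assms(2)]
  note fr = char_p_power_add[OF crL assms(1) L(2)]
  \<comment> \<open>Closure under negation is drawn from additivity, applied to the sum of -a and a,
    which treats p = 2 and odd p alike.\<close>
  have m: "\<ominus>\<^bsub>L\<^esub> a \<in> ?S" if a: "a \<in> ?S" for a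
  proof -
    have "(\<ominus>\<^bsub>L\<^esub> a) [^]\<^bsub>L\<^esub> (p ^ n) \<oplus>\<^bsub>L\<^esub> a [^]\<^bsub>L\<^esub> (p ^ n) = \<zero>\<^bsub>L\<^esub>"
    proof -
      have "\<zero>\<^bsub>L\<^esub> [^]\<^bsub>L\<^esub> (p ^ n) = \<zero>\<^bsub>L\<^esub>" by (rule nat_pow_zero) (use q in linarith)
      then show ?thesis using fr[of "\<ominus>\<^bsub>L\<^esub> a" a n] a by (simp add: l_neg)
    qed
    then have "\<ominus>\<^bsub>L\<^esub> (a [^]\<^bsub>L\<^esub> (p ^ n)) = (\<ominus>\<^bsub>L\<^esub> a) [^]\<^bsub>L\<^esub> (p ^ n)"
      using a by (intro minus_equality) auto
    then show ?thesis using a by simp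
  qed
  have "subfield ?S L"
  proof (rule subfieldI')
    show "subring ?S L"
      by (rule subringI) (use m fr in \<open>auto simp: nat_pow_distrib\<close>)
    fix k assume k: "k \<in> ?S - {\<zero>\<^bsub>L\<^esub>}"
    then have u: "k \<in> Units L" by (simp add: field_Units)
    have "k \<otimes>\<^bsub>L\<^esub> (inv\<^bsub>L\<^esub> k) [^]\<^bsub>L\<^esub> (p ^ n) = (k \<otimes>\<^bsub>L\<^esub> inv\<^bsub>L\<^esub> k) [^]\<^bsub>L\<^esub> (p ^ n)"
      using k u by (subst nat_pow_distrib) auto
    also have "\<dots> = \<one>\<^bsub>L\<^esub>" using u by simp
    finally have "inv\<^bsub>L\<^esub> k = (inv\<^bsub>L\<^esub> k) [^]\<^bsub>L\<^esub> (p ^ n)"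
      using k u by (intro comm_inv_char) auto
    then show "inv\<^bsub>L\<^esub> k \<in> ?S" using u by simp
  qed
  then have K: "field (L\<lparr>carrier := ?S\<rparr>)" by (rule subfield_iff(2))
  obtain f where f: "bij_betw f ?S {0..<card ?S}" using ex_bij_betw_finite_nat[OF S(1)] by blast
  let ?F = "image_ring f (L\<lparr>carrier := ?S\<rparr>)"
  have "field ?F"
    by (rule field.inj_imp_image_ring_is_field[OF K]) (use f in \<open>simp add: bij_betw_def\<close>)
  moreover have "carrier ?F = {0..<p ^ n}"
    using f S(2) by (simp add: image_ring_carrier bij_betw_def)
  ultimately show ?thesis by (intro exI[of _ ?F]) simp
qed

section \<open>Finite semisimple rings and idempotents\<close>

text \<open>Extensionality leaves exactly one function for each bijection, so the set is finite and
  can be counted.\<close>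

definition bijections :: "'a set \<Rightarrow> 'b set \<Rightarrow> ('a \<Rightarrow> 'b) set" where
  "bijections A B = {f \<in> extensional A. bij_betw f A B}"

lemma bijections_alt:
  assumes "finite B" "card A = card B"
  shows "bijections A B = {f \<in> A \<rightarrow>\<^sub>E B. inj_on f A}"
proof -
  have "f ` A = B" if "f \<in> A \<rightarrow> B" "inj_on f A" for f
    using card_subset_eq[OF assms(1), of "f ` A"] that assms(2) by (auto simp: card_image)
  then show ?thesis by (auto simp: bijections_def bij_betw_def PiE_def)
qed

lemma card_bijections:
  assumes "finite A" "finite B" "card A = card B"
  shows "finite (bijections A B)" "card (bijections A B) = fact (card A)"
proof -
  have "finite (A \<rightarrow>\<^sub>E B)" using assms by (simp add: finite_PiE)
  then show "finite (bijections A B)" unfolding bijections_alt[OF assms(2,3)] by simp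
  have "card {f \<in> A \<rightarrow>\<^sub>E B. inj_on f A} = (\<Prod>i\<in>{0..<card A}. card A - i)"
    using card_inj_on_subset_funcset[OF assms(1,2) order_refl] assms(3) by simp
  also have "\<dots> = fact (card A)"
    by (simp add: fact_prod_rev)
  finally show "card (bijections A B) = fact (card A)" unfolding bijections_alt[OF assms(2,3)] .
qed

text \<open>An isomorphism of records respects product, sum and unit but does not mention zero,
  which is a separate component of the record. It has to be matched explicitly until the target is
  known to be a ring.\<close>

lemma ring_iso_imp_cring:
  assumes "cring S" "f \<in> ring_iso S R" "\<zero>\<^bsub>R\<^esub> = f \<zero>\<^bsub>S\<^esub>"
  shows "cring R"
  using cring.ring_iso_imp_img_cring[OF assms(1,2)] assms(3)[symmetric] by simp

lemma ring_iso_imp_field: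
  assumes "field S" "f \<in> ring_iso S R" "\<zero>\<^bsub>R\<^esub> = f \<zero>\<^bsub>S\<^esub>"
  shows "field R"
  using field.ring_iso_imp_img_field[OF assms(1,2)] assms(3)[symmetric] by simp

lemma ring_iso_zero:
  assumes "cring R" "cring S" "f \<in> ring_iso R S"
  shows "f \<zero>\<^bsub>R\<^esub> = \<zero>\<^bsub>S\<^esub>"
  using assms by (auto simp: ring_iso_def cring_def intro: ring_hom_zero)

lemma ring_iso_imp_field':
  assumes "field S" "cring R" "f \<in> ring_iso S R"
  shows "field R"
  using ring_iso_imp_field[OF assms(1,3)] ring_iso_zero[OF _ assms(2,3)] assms(1)
  by (simp add: field_def domain_def)

lemma ring_iso_inv:
  assumes "cring R" "f \<in> ring_iso R S"
  shows "inv_into (carrier R) f \<in> ring_iso S R"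
  using assms by (simp add: ring_iso_set_sym cring_def)

lemma ring_iso_cong:
  assumes "cring R" "f \<in> ring_iso R S" "\<And>x. x \<in> carrier R \<Longrightarrow> f x = g x"
  shows "g \<in> ring_iso R S"
  using ring.ring_iso_restrict[of R f S g] assms by (simp add: cring_def)

section \<open>Binary products and Peirce corners\<close>

lemma RDirProd_simps [simp]:
  "carrier (RDirProd R S) = carrier R \<times> carrier S"
  "(a, b) \<otimes>\<^bsub>RDirProd R S\<^esub> (c, d) = (a \<otimes>\<^bsub>R\<^esub> c, b \<otimes>\<^bsub>S\<^esub> d)"
  "(a, b) \<oplus>\<^bsub>RDirProd R S\<^esub> (c, d) = (a \<oplus>\<^bsub>R\<^esub> c, b \<oplus>\<^bsub>S\<^esub> d)"
  "\<one>\<^bsub>RDirProd R S\<^esub> = (\<one>\<^bsub>R\<^esub>, \<one>\<^bsub>S\<^esub>)" "\<zero>\<^bsub>RDirProd R S\<^esub> = (\<zero>\<^bsub>R\<^esub>, \<zero>\<^bsub>S\<^esub>)"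
  by (auto simp: RDirProd_def DirProd_def monoid.defs)

lemma cring_RDirProd:
  assumes "cring R" "cring S"
  shows "cring (RDirProd R S)"
proof -
  interpret R: cring R by fact
  interpret S: cring S by fact
  interpret P: ring "RDirProd R S" by (intro RDirProd_ring R.ring_axioms S.ring_axioms)
  show ?thesis by unfold_locales (auto simp: R.m_comm S.m_comm)
qed

text \<open>The Peirce corner eR. For idempotent e the ideal generated by e consists of the elements
  fixed by multiplication with e, and e is its unit.\<close>

definition corner :: "('a, 'm) ring_scheme \<Rightarrow> 'a \<Rightarrow> ('a, 'm) ring_scheme" where
  "corner R e = R\<lparr>carrier := {x \<in> carrier R. e \<otimes>\<^bsub>R\<^esub> x = x}, one := e\<rparr>"

lemma corner_simps [simp]:
  "x \<in> carrier (corner R e) \<longleftrightarrow> x \<in> carrier R \<and> e \<otimes>\<^bsub>R\<^esub> x = x" "\<one>\<^bsub>corner R e\<^esub> = e"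
  "\<zero>\<^bsub>corner R e\<^esub> = \<zero>\<^bsub>R\<^esub>" "monoid.mult (corner R e) = monoid.mult R" "add (corner R e) = add R"
  by (simp_all add: corner_def)

context cring
begin

lemma cring_corner:
  assumes e: "e \<in> carrier R" "e \<otimes> e = e"
  shows "cring (corner R e)"
proof (rule cringI)
  show "abelian_group (corner R e)"
  proof (rule abelian_groupI)
    fix x assume "x \<in> carrier (corner R e)"
    then show "\<exists>y\<in>carrier (corner R e). y \<oplus>\<^bsub>corner R e\<^esub> x = \<zero>\<^bsub>corner R e\<^esub>"
      using e by (intro bexI[of _ "\<ominus> x"]) (auto simp: l_neg r_minus)
  qed (use e in \<open>auto simp: r_distr a_ac\<close>)
  show "Group.comm_monoid (corner R e)"
  proof (rule comm_monoidI)
    fix x y assume "x \<in> carrier (corner R e)" "y \<in> carrier (corner R e)"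
    then show "x \<otimes>\<^bsub>corner R e\<^esub> y \<in> carrier (corner R e)"
      using e by (simp add: m_assoc[symmetric])
  qed (use e in \<open>auto simp: m_ac\<close>)
qed (auto simp: l_distr)

lemma corner_proj:
  assumes e: "e \<in> carrier R" "e \<otimes> e = e"
  shows "(\<lambda>x. e \<otimes> x) \<in> ring_hom R (corner R e)"
proof (rule ring_hom_memI)
  fix x y assume xy: "x \<in> carrier R" "y \<in> carrier R"
  show "e \<otimes> (x \<otimes> y) = (e \<otimes> x) \<otimes>\<^bsub>corner R e\<^esub> (e \<otimes> y)"
  proof -
    have "(e \<otimes> x) \<otimes> (e \<otimes> y) = (e \<otimes> e) \<otimes> (x \<otimes> y)" using e(1) xy by (simp add: m_ac)
    then show ?thesis using e by simp
  qed
  show "e \<otimes> x \<in> carrier (corner R e)" using e xy by (simp add: m_assoc[symmetric])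
qed (use e in \<open>auto simp: r_distr\<close>)

lemma complement_idem:
  assumes e: "e \<in> carrier R" "e \<otimes> e = e"
  shows "\<one> \<ominus> e \<in> carrier R" "(\<one> \<ominus> e) \<otimes> (\<one> \<ominus> e) = \<one> \<ominus> e" "e \<otimes> (\<one> \<ominus> e) = \<zero>" "(\<one> \<ominus> e) \<otimes> e = \<zero>"
    "e \<oplus> (\<one> \<ominus> e) = \<one>"
proof -
  show c: "\<one> \<ominus> e \<in> carrier R" using e by simp
  show z: "e \<otimes> (\<one> \<ominus> e) = \<zero>" using e by (simp add: a_minus_def r_distr r_minus r_neg)
  then show z': "(\<one> \<ominus> e) \<otimes> e = \<zero>" using e c by (simp add: m_comm)
  have "(\<one> \<ominus> e) \<otimes> (\<one> \<ominus> e) = (\<one> \<ominus> e) \<otimes> \<one> \<ominus> (\<one> \<ominus> e) \<otimes> e"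
    using e c by (simp add: a_minus_def r_distr r_minus del: r_one)
  then show "(\<one> \<ominus> e) \<otimes> (\<one> \<ominus> e) = \<one> \<ominus> e" using z' c by (simp add: a_minus_def)
  show "e \<oplus> (\<one> \<ominus> e) = \<one>" using e a_lcomm[of e \<one> "\<ominus> e"] by (simp add: a_minus_def r_neg)
qed

text \<open>Peirce decomposition into eR and (1 - e)R. The inverse map is addition, because e + (1 -
  e) = 1 and the two idempotents annihilate each other.\<close>

lemma corner_bij:
  assumes e: "e \<in> carrier R" "e \<otimes> e = e"
  shows "bij_betw (\<lambda>x. (e \<otimes> x, (\<one> \<ominus> e) \<otimes> x)) (carrier R) (carrier (corner R e) \<times> carrier (corner R (\<one> \<ominus> e)))"
proof -
  note c = complement_idem[OF e]
  have h: "e \<otimes> x \<in> carrier (corner R e)" "(\<one> \<ominus> e) \<otimes> x \<in> carrier (corner R (\<one> \<ominus> e))" if "x \<in> carrier R" for x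
    using ring_hom_closed[OF corner_proj[OF e] that] ring_hom_closed[OF corner_proj[OF c(1,2)] that] by auto
  have l: "e \<otimes> x \<oplus> (\<one> \<ominus> e) \<otimes> x = x" if "x \<in> carrier R" for x
    using l_distr[OF e(1) c(1) that] c(5) that by simp
  show ?thesis
  proof (rule bij_betw_byWitness[where f' = "\<lambda>(a, b). a \<oplus> b"])
    show "\<forall>x\<in>carrier R. (case (e \<otimes> x, (\<one> \<ominus> e) \<otimes> x) of (a, b) \<Rightarrow> a \<oplus> b) = x" using l by simp
    show "(\<lambda>x. (e \<otimes> x, (\<one> \<ominus> e) \<otimes> x)) ` carrier R \<subseteq> carrier (corner R e) \<times> carrier (corner R (\<one> \<ominus> e))"
      by (rule image_subsetI, rule SigmaI[OF h])
    show "\<forall>z\<in>carrier (corner R e) \<times> carrier (corner R (\<one> \<ominus> e)).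
        (e \<otimes> (case z of (a, b) \<Rightarrow> a \<oplus> b), (\<one> \<ominus> e) \<otimes> (case z of (a, b) \<Rightarrow> a \<oplus> b)) = z"
    proof
      fix z assume z: "z \<in> carrier (corner R e) \<times> carrier (corner R (\<one> \<ominus> e))"
      obtain a b where ab: "z = (a, b)" "a \<in> carrier R" "e \<otimes> a = a" "b \<in> carrier R" "(\<one> \<ominus> e) \<otimes> b = b"
        using z by (cases z) auto
      have "e \<otimes> b = (e \<otimes> (\<one> \<ominus> e)) \<otimes> b" using ab(4,5) e c(1) by (simp add: m_assoc)
      then have 1: "e \<otimes> b = \<zero>" using c(3) ab(4) by simp
      have "(\<one> \<ominus> e) \<otimes> a = ((\<one> \<ominus> e) \<otimes> e) \<otimes> a" using ab(2,3) e c(1) by (simp add: m_assoc)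
      then have 2: "(\<one> \<ominus> e) \<otimes> a = \<zero>" using c(4) ab(2) by simp
      show "(e \<otimes> (case z of (a, b) \<Rightarrow> a \<oplus> b), (\<one> \<ominus> e) \<otimes> (case z of (a, b) \<Rightarrow> a \<oplus> b)) = z"
        using ab e(1) c(1) 1 2 by (simp add: r_distr)
    qed
    show "(\<lambda>(a, b). a \<oplus> b) ` (carrier (corner R e) \<times> carrier (corner R (\<one> \<ominus> e))) \<subseteq> carrier R"
      by auto
  qed
qed

end

text \<open>For a finite product of fields these are the primitive idempotents, one for each factor.
  Zero is excluded because its corner is trivial.\<close>

definition field_idems :: "('a, 'm) ring_scheme \<Rightarrow> 'a set" where
  "field_idems R = {e \<in> carrier R. e \<otimes>\<^bsub>R\<^esub> e = e \<and> field (corner R e)}"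

text \<open>The data of \<open>fin_semisimple\<close>, with an arbitrary finite index set in place
  of an initial segment, so that one factor can be deleted without renumbering.\<close>

definition field_decomp :: "nat ring \<Rightarrow> 'i set \<Rightarrow> ('i \<Rightarrow> nat ring) \<Rightarrow> ('i \<Rightarrow> nat \<Rightarrow> nat) \<Rightarrow> bool" where
  "field_decomp R I F \<phi> \<longleftrightarrow> finite I \<and>
     (\<forall>i\<in>I. field (F i) \<and> finite (carrier (F i)) \<and> \<phi> i \<in> ring_hom R (F i)) \<and>
     bij_betw (\<lambda>x. \<lambda>i\<in>I. \<phi> i x) (carrier R) (PiE I (\<lambda>i. carrier (F i)))"

lemma fin_semisimple_iff_decomp:
  "fin_semisimple R \<longleftrightarrow> cring R \<and> (\<exists>(m::nat) F \<phi>. field_decomp R {..<m} F \<phi>)"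
  unfolding fin_semisimple_def field_decomp_def by auto

lemma field_decomp_imp_fin_semisimple:
  assumes "cring R" and d: "field_decomp R (I :: 'i set) F \<phi>"
  shows "fin_semisimple R"
proof -
  note D = d[unfolded field_decomp_def]
  obtain h where h: "bij_betw h {0..<card I} I" using D ex_bij_betw_nat_finite by blast
  then have h': "bij_betw h {..<card I} I" by (simp add: lessThan_atLeast0)
  then have hI: "h i \<in> I" if "i < card I" for i using that by (auto simp: bij_betw_def)
  have "bij_betw (\<lambda>f. \<lambda>i\<in>{..<card I}. f (h i)) (PiE I (\<lambda>i. carrier (F i))) (PiE {..<card I} (\<lambda>i. carrier (F (h i))))"
  proof (rule bij_betw_byWitness[where f' = "\<lambda>g. \<lambda>i\<in>I. g (inv_into {..<card I} h i)"])
    show "\<forall>a\<in>Pi\<^sub>E I (\<lambda>i. carrier (F i)).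
       (\<lambda>i\<in>I. (\<lambda>i\<in>{..<card I}. a (h i)) (inv_into {..<card I} h i)) = a"
    proof (intro ballI ext)
      fix a i assume a: "a \<in> Pi\<^sub>E I (\<lambda>i. carrier (F i))"
      show "(\<lambda>i\<in>I. (\<lambda>i\<in>{..<card I}. a (h i)) (inv_into {..<card I} h i)) i = a i"
        using a bij_betw_inv_into_right[OF h', of i] bij_betwE[OF bij_betw_inv_into[OF h']]
        by (cases "i \<in> I") (auto simp: PiE_def extensional_def)
    qed
    show "\<forall>g\<in>Pi\<^sub>E {..<card I} (\<lambda>i. carrier (F (h i))).
       (\<lambda>i\<in>{..<card I}. (\<lambda>i\<in>I. g (inv_into {..<card I} h i)) (h i)) = g"
    proof (intro ballI ext)
      fix g i assume g: "g \<in> Pi\<^sub>E {..<card I} (\<lambda>i. carrier (F (h i)))"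
      show "(\<lambda>i\<in>{..<card I}. (\<lambda>i\<in>I. g (inv_into {..<card I} h i)) (h i)) i = g i"
        using g hI bij_betw_inv_into_left[OF h', of i]
        by (cases "i < card I") (auto simp: PiE_def extensional_def)
    qed
    show "(\<lambda>f. \<lambda>i\<in>{..<card I}. f (h i)) ` Pi\<^sub>E I (\<lambda>i. carrier (F i))
        \<subseteq> Pi\<^sub>E {..<card I} (\<lambda>i. carrier (F (h i)))"
      using hI by (auto split: if_splits)
    show "(\<lambda>g. \<lambda>i\<in>I. g (inv_into {..<card I} h i)) ` Pi\<^sub>E {..<card I} (\<lambda>i. carrier (F (h i)))
       \<subseteq> Pi\<^sub>E I (\<lambda>i. carrier (F i))"
    proof -
      have "g (inv_into {..<card I} h i) \<in> carrier (F i)"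
        if "g \<in> Pi\<^sub>E {..<card I} (\<lambda>i. carrier (F (h i)))" "i \<in> I" for g i
      proof -
        have "inv_into {..<card I} h i \<in> {..<card I}" using bij_betwE[OF bij_betw_inv_into[OF h']] that(2) by blast
        then have "g (inv_into {..<card I} h i) \<in> carrier (F (h (inv_into {..<card I} h i)))"
          using that(1) by (auto simp: PiE_def Pi_def)
        then show ?thesis using bij_betw_inv_into_right[OF h' that(2)] by simp
      qed
      then show ?thesis by auto
    qed
  qed
  moreover have "bij_betw (\<lambda>x. \<lambda>i\<in>I. \<phi> i x) (carrier R) (PiE I (\<lambda>i. carrier (F i)))" using D by blast
  ultimately have "bij_betw ((\<lambda>f. \<lambda>i\<in>{..<card I}. f (h i)) \<circ> (\<lambda>x. \<lambda>i\<in>I. \<phi> i x)) (carrier R)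
      (PiE {..<card I} (\<lambda>i. carrier (F (h i))))"
    by (rule bij_betw_trans[rotated])
  moreover have "(\<lambda>f. \<lambda>i\<in>{..<card I}. f (h i)) \<circ> (\<lambda>x. \<lambda>i\<in>I. \<phi> i x) = (\<lambda>x. \<lambda>i\<in>{..<card I}. \<phi> (h i) x)"
    using hI by (auto simp: fun_eq_iff)
  ultimately have "field_decomp R {..<card I} (F \<circ> h) (\<phi> \<circ> h)"
    using D hI by (auto simp: field_decomp_def)
  then show ?thesis using assms(1) fin_semisimple_iff_decomp by blast
qed

lemma fin_semisimple_iso:
  assumes "fin_semisimple A" "cring B" "f \<in> ring_iso A B"
  shows "fin_semisimple B"
proof -
  obtain m F \<phi> where d: "field_decomp A {..<m::nat} F \<phi>" and A: "cring A"
    using assms(1) fin_semisimple_iff_decomp by blast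
  let ?g = "inv_into (carrier A) f"
  have g: "?g \<in> ring_iso B A" by (rule ring_iso_inv[OF A assms(3)])
  then have g': "?g \<in> ring_hom B A" "bij_betw ?g (carrier B) (carrier A)" by (auto simp: ring_iso_def)
  have "bij_betw ((\<lambda>x. \<lambda>i\<in>{..<m}. \<phi> i x) \<circ> ?g) (carrier B) (PiE {..<m} (\<lambda>i. carrier (F i)))"
    using bij_betw_trans[OF g'(2)] d unfolding field_decomp_def by blast
  moreover have "(\<lambda>x. \<lambda>i\<in>{..<m}. \<phi> i x) \<circ> ?g = (\<lambda>x. \<lambda>i\<in>{..<m}. (\<phi> i \<circ> ?g) x)" by (simp add: fun_eq_iff)
  ultimately have "field_decomp B {..<m} F (\<lambda>i. \<phi> i \<circ> ?g)"
    using d ring_hom_trans[OF g'(1)] unfolding field_decomp_def by auto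
  then show ?thesis using assms(2) fin_semisimple_iff_decomp by blast
qed

text \<open>The field \<open>A\<close> becomes a new coordinate with index \<open>m\<close> after
  the \<open>m\<close> coordinates of \<open>B\<close>. This leads from a field and a smaller
  semisimple ring back to a semisimple ring.\<close>

lemma fin_semisimple_prod:
  fixes A :: "nat ring"
  assumes "cring R" "field A" "finite (carrier A)" "fin_semisimple B"
    and p: "p \<in> ring_hom R A" and q: "q \<in> ring_hom R B"
    and bij: "bij_betw (\<lambda>x. (p x, q x)) (carrier R) (carrier A \<times> carrier B)"
  shows "fin_semisimple R"
proof -
  obtain m F \<phi> where d: "field_decomp B {..<m::nat} F \<phi>"
    using assms(4) fin_semisimple_iff_decomp by blast
  note D = d[unfolded field_decomp_def]
  let ?F = "F(m := A)" and ?\<phi> = "\<lambda>i. if i = m then p else \<phi> i \<circ> q"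
  let ?h = "\<lambda>(a, b). \<lambda>i\<in>{..<Suc m}. if i = m then a else \<phi> i b"
  have b: "bij_betw (\<lambda>x. \<lambda>i\<in>{..<m}. \<phi> i x) (carrier B) (PiE {..<m} (\<lambda>i. carrier (F i)))" using D by blast
  have "bij_betw ?h (carrier A \<times> carrier B) (PiE {..<Suc m} (\<lambda>i. carrier (?F i)))"
  proof (rule bij_betw_imageI)
    show "inj_on ?h (carrier A \<times> carrier B)"
    proof (rule inj_onI, clarify)
      fix a b a' b' assume ab: "a \<in> carrier A" "b \<in> carrier B" "a' \<in> carrier A" "b' \<in> carrier B"
        and eq: "(\<lambda>i\<in>{..<Suc m}. if i = m then a else \<phi> i b) = (\<lambda>i\<in>{..<Suc m}. if i = m then a' else \<phi> i b')"
      have "a = a'" using fun_cong[OF eq, of m] by simp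
      moreover have "(\<lambda>i\<in>{..<m}. \<phi> i b) = (\<lambda>i\<in>{..<m}. \<phi> i b')"
      proof
        fix i show "(\<lambda>i\<in>{..<m}. \<phi> i b) i = (\<lambda>i\<in>{..<m}. \<phi> i b') i"
          using fun_cong[OF eq, of i] by auto
      qed
      then have "b = b'" using b ab unfolding bij_betw_def inj_on_def by blast
      ultimately show "a = a' \<and> b = b'" by simp
    qed
    show "?h ` (carrier A \<times> carrier B) = PiE {..<Suc m} (\<lambda>i. carrier (?F i))"
    proof (intro equalityI subsetI)
      fix f assume "f \<in> ?h ` (carrier A \<times> carrier B)"
      then obtain a b where ab: "a \<in> carrier A" "b \<in> carrier B" "f = ?h (a, b)" by auto
      have "\<phi> i b \<in> carrier (F i)" if "i < m" for i
        using D that ab(2) ring_hom_closed[of "\<phi> i" B "F i" b] by simp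
      then show "f \<in> PiE {..<Suc m} (\<lambda>i. carrier (?F i))" using ab by auto
    next
      fix f assume f: "f \<in> PiE {..<Suc m} (\<lambda>i. carrier (?F i))"
      then have fm: "f m \<in> carrier A" by (auto simp: PiE_def Pi_def)
      have "f i \<in> carrier (F i)" if "i < m" for i
        using f that by (auto simp: PiE_def Pi_def less_Suc_eq split: if_splits)
      then have "restrict f {..<m} \<in> PiE {..<m} (\<lambda>i. carrier (F i))" by auto
      then obtain b' where b': "b' \<in> carrier B" "restrict f {..<m} = (\<lambda>i\<in>{..<m}. \<phi> i b')"
        using b unfolding bij_betw_def by blast
      have "f = ?h (f m, b')"
      proof
        fix i show "f i = ?h (f m, b') i"
          using fun_cong[OF b'(2), of i] f
          by (cases "i < Suc m") (auto simp: PiE_def extensional_def less_Suc_eq)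
      qed
      then show "f \<in> ?h ` (carrier A \<times> carrier B)" using fm b'(1) by blast
    qed
  qed
  from bij_betw_trans[OF bij this]
  have "bij_betw (\<lambda>x. \<lambda>i\<in>{..<Suc m}. ?\<phi> i x) (carrier R) (PiE {..<Suc m} (\<lambda>i. carrier (?F i)))"
    by (rule bij_betw_cong[THEN iffD1, rotated]) (auto simp: fun_eq_iff)
  moreover have "?\<phi> i \<in> ring_hom R (?F i)" if "i < Suc m" for i
    using D that p ring_hom_trans[OF q] by (auto simp: less_Suc_eq)
  ultimately have "field_decomp R {..<Suc m} ?F ?\<phi>"
    using D assms(2,3) by (auto simp: field_decomp_def less_Suc_eq)
  then show ?thesis using assms(1) fin_semisimple_iff_decomp by blast
qed

section \<open>Primitive idempotents of a product of fields\<close>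

lemma field_idem_cases:
  assumes "field F" "x \<in> carrier F" "x \<otimes>\<^bsub>F\<^esub> x = x"
  shows "x = \<zero>\<^bsub>F\<^esub> \<or> x = \<one>\<^bsub>F\<^esub>"
proof -
  interpret field F by fact
  have "x \<otimes>\<^bsub>F\<^esub> (x \<ominus>\<^bsub>F\<^esub> \<one>\<^bsub>F\<^esub>) = x \<otimes>\<^bsub>F\<^esub> x \<ominus>\<^bsub>F\<^esub> x"
    using assms(2) by (simp add: a_minus_def r_distr r_minus)
  also have "\<dots> = \<zero>\<^bsub>F\<^esub>" using assms(2,3) by (simp add: r_right_minus_eq)
  finally have "x = \<zero>\<^bsub>F\<^esub> \<or> x \<ominus>\<^bsub>F\<^esub> \<one>\<^bsub>F\<^esub> = \<zero>\<^bsub>F\<^esub>"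
    using integral[of x "x \<ominus>\<^bsub>F\<^esub> \<one>\<^bsub>F\<^esub>"] assms(2) by simp
  then show ?thesis using assms(2) by (simp add: r_right_minus_eq)
qed

text \<open>\<open>E i\<close> is the element with coordinate 1 at i and 0 elsewhere. Its corner is
  the i-th factor, and the complementary corner is the product of the others.\<close>

lemma field_decomp_idems:
  fixes R (structure)
  assumes "cring R" and d: "field_decomp R I F \<phi>"
  obtains E where "field_idems R = E ` I" "inj_on E I"
    "\<And>i. i \<in> I \<Longrightarrow> card (carrier (corner R (E i))) = card (carrier (F i))"
    "\<And>i. i \<in> I \<Longrightarrow> fin_semisimple (corner R (\<one> \<ominus> E i))"
proof -
  interpret cring R by fact
  have fI: "finite I" and F: "\<And>i. i \<in> I \<Longrightarrow> field (F i)"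
    and \<phi>: "\<And>i. i \<in> I \<Longrightarrow> \<phi> i \<in> ring_hom R (F i)"
    and bij: "bij_betw (\<lambda>x. \<lambda>i\<in>I. \<phi> i x) (carrier R) (PiE I (\<lambda>i. carrier (F i)))"
    using d unfolding field_decomp_def by auto
  have crF: "cring (F i)" if "i \<in> I" for i using F[OF that] by (simp add: field_def domain_def)
  have fc: "\<one>\<^bsub>F i\<^esub> \<in> carrier (F i)" "\<zero>\<^bsub>F i\<^esub> \<in> carrier (F i)" "\<one>\<^bsub>F i\<^esub> \<noteq> \<zero>\<^bsub>F i\<^esub>" if "i \<in> I" for i
  proof -
    interpret Fi: field "F i" using F[OF that] .
    show "\<one>\<^bsub>F i\<^esub> \<in> carrier (F i)" "\<zero>\<^bsub>F i\<^esub> \<in> carrier (F i)" "\<one>\<^bsub>F i\<^esub> \<noteq> \<zero>\<^bsub>F i\<^esub>" by auto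
  qed
  have fs: "\<one>\<^bsub>F i\<^esub> \<otimes>\<^bsub>F i\<^esub> y = y" "\<zero>\<^bsub>F i\<^esub> \<otimes>\<^bsub>F i\<^esub> y = \<zero>\<^bsub>F i\<^esub>" if "i \<in> I" "y \<in> carrier (F i)" for i y
  proof -
    interpret Fi: cring "F i" using crF[OF that(1)] .
    show "\<one>\<^bsub>F i\<^esub> \<otimes>\<^bsub>F i\<^esub> y = y" "\<zero>\<^bsub>F i\<^esub> \<otimes>\<^bsub>F i\<^esub> y = \<zero>\<^bsub>F i\<^esub>" using that(2) by auto
  qed
  have \<phi>z: "\<phi> i \<zero> = \<zero>\<^bsub>F i\<^esub>" if "i \<in> I" for i
    using ring_hom_zero[OF \<phi>[OF that] ring_axioms] crF[OF that] by (simp add: cring_def)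
  have eqI: "x = y" if "x \<in> carrier R" "y \<in> carrier R" "\<And>i. i \<in> I \<Longrightarrow> \<phi> i x = \<phi> i y" for x y
  proof -
    have "(\<lambda>i\<in>I. \<phi> i x) = (\<lambda>i\<in>I. \<phi> i y)" using that(3) by (auto simp: fun_eq_iff)
    then show ?thesis using bij that(1,2) unfolding bij_betw_def inj_on_def by blast
  qed
  have ex: "\<exists>x\<in>carrier R. \<forall>i\<in>I. \<phi> i x = f i" if "\<And>i. i \<in> I \<Longrightarrow> f i \<in> carrier (F i)" for f
  proof -
    have "restrict f I \<in> PiE I (\<lambda>i. carrier (F i))" using that by auto
    then obtain x where x: "x \<in> carrier R" "restrict f I = (\<lambda>i\<in>I. \<phi> i x)"
      using bij unfolding bij_betw_def by blast
    have "\<phi> i x = f i" if "i \<in> I" for i using fun_cong[OF x(2), of i] that by simp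
    then show ?thesis using x(1) by blast
  qed
  have "\<forall>i\<in>I. \<exists>x\<in>carrier R. \<forall>j\<in>I. \<phi> j x = (if j = i then \<one>\<^bsub>F j\<^esub> else \<zero>\<^bsub>F j\<^esub>)"
    using fc by (intro ballI ex) auto
  then obtain E where E: "\<And>i. i \<in> I \<Longrightarrow> E i \<in> carrier R"
    "\<And>i j. i \<in> I \<Longrightarrow> j \<in> I \<Longrightarrow> \<phi> j (E i) = (if j = i then \<one>\<^bsub>F j\<^esub> else \<zero>\<^bsub>F j\<^esub>)" by metis
  have \<phi>m: "\<phi> j (x \<otimes> y) = \<phi> j x \<otimes>\<^bsub>F j\<^esub> \<phi> j y" if "x \<in> carrier R" "y \<in> carrier R" "j \<in> I" for x y j
    using ring_hom_mult[OF \<phi>[OF that(3)] that(1,2)] .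
  have \<phi>c: "\<phi> j x \<in> carrier (F j)" if "x \<in> carrier R" "j \<in> I" for x j
    using ring_hom_closed[OF \<phi>[OF that(2)] that(1)] .
  have EM: "\<phi> j (E i \<otimes> x) = (if j = i then \<phi> j x else \<zero>\<^bsub>F j\<^esub>)" if "i \<in> I" "j \<in> I" "x \<in> carrier R" for i j x
    using that E \<phi>m \<phi>c fs by simp
  have EE: "E i \<otimes> E i = E i" if "i \<in> I" for i
    by - (rule eqI, use that E EM in auto)
  have corner: "x \<in> carrier (corner R (E i)) \<longleftrightarrow> x \<in> carrier R \<and> (\<forall>j\<in>I. j \<noteq> i \<longrightarrow> \<phi> j x = \<zero>\<^bsub>F j\<^esub>)"
    if "i \<in> I" for i x
  proof -
    have "E i \<otimes> x = x \<longleftrightarrow> (\<forall>j\<in>I. j \<noteq> i \<longrightarrow> \<phi> j x = \<zero>\<^bsub>F j\<^esub>)" if "x \<in> carrier R"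
    proof
      assume "E i \<otimes> x = x"
      then show "\<forall>j\<in>I. j \<noteq> i \<longrightarrow> \<phi> j x = \<zero>\<^bsub>F j\<^esub>" using EM[OF \<open>i \<in> I\<close> _ that] by metis
    next
      assume "\<forall>j\<in>I. j \<noteq> i \<longrightarrow> \<phi> j x = \<zero>\<^bsub>F j\<^esub>"
      then show "E i \<otimes> x = x" by - (rule eqI, use that EM[OF \<open>i \<in> I\<close> _ that] E(1)[OF \<open>i \<in> I\<close>] in auto)
    qed
    then show ?thesis by auto
  qed
  have iso: "\<phi> i \<in> ring_iso (corner R (E i)) (F i)" if i: "i \<in> I" for i
  proof (rule ring_iso_memI)
    show "bij_betw (\<phi> i) (carrier (corner R (E i))) (carrier (F i))"
    proof (rule bij_betw_imageI)
      show "inj_on (\<phi> i) (carrier (corner R (E i)))"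
      proof (rule inj_onI)
        fix x y assume "x \<in> carrier (corner R (E i))" "y \<in> carrier (corner R (E i))" "\<phi> i x = \<phi> i y"
        then show "x = y" unfolding corner[OF i] by - (rule eqI, metis+)
      qed
      show "\<phi> i ` carrier (corner R (E i)) = carrier (F i)"
      proof (intro equalityI subsetI)
        fix y assume y: "y \<in> carrier (F i)"
        have "\<exists>x\<in>carrier R. \<forall>j\<in>I. \<phi> j x = (if j = i then y else \<zero>\<^bsub>F j\<^esub>)"
          by (rule ex) (use y fc in auto)
        then obtain x where x: "x \<in> carrier R" "\<forall>j\<in>I. \<phi> j x = (if j = i then y else \<zero>\<^bsub>F j\<^esub>)" by blast
        have "x \<in> carrier (corner R (E i))" unfolding corner[OF i] using x by simp
        moreover have "\<phi> i x = y" using x i by simp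
        ultimately show "y \<in> \<phi> i ` carrier (corner R (E i))" by blast
      qed (use \<phi>c i in auto)
    qed
  qed (use \<phi>c[OF _ i] \<phi>m[OF _ _ i] ring_hom_add[OF \<phi>[OF i]] E(2)[OF i i] in auto)
  have crE: "cring (corner R (E i))" if "i \<in> I" for i using cring_corner[OF E(1)[OF that] EE[OF that]] .
  have fldE: "field (corner R (E i))" if i: "i \<in> I" for i
    using ring_iso_imp_field'[OF F[OF i] crE[OF i] ring_iso_inv[OF crE[OF i] iso[OF i]]] .
  have fi: "field_idems R = E ` I"
  proof (intro equalityI subsetI)
    \<comment> \<open>The idempotent e is nonzero, so some coordinate of it is a nonzero idempotent
      of a field, hence 1. Then \<open>E i\<close> is a nonzero idempotent of the field eR, so it
      equals the unit e.\<close>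
    fix e assume "e \<in> field_idems R"
    then have e: "e \<in> carrier R" "e \<otimes> e = e" and fe: "field (corner R e)" by (auto simp: field_idems_def)
    have "e \<noteq> \<zero>" using domain.one_not_zero[OF field.axioms(1)[OF fe]] by auto
    have "\<exists>i\<in>I. \<phi> i e \<noteq> \<zero>\<^bsub>F i\<^esub>"
    proof (rule ccontr)
      assume "\<not> ?thesis"
      then have "e = \<zero>" by - (rule eqI, use e(1) \<phi>z in auto)
      then show False using \<open>e \<noteq> \<zero>\<close> by blast
    qed
    then obtain i where i: "i \<in> I" "\<phi> i e \<noteq> \<zero>\<^bsub>F i\<^esub>" by blast
    then have 1: "\<phi> i e = \<one>\<^bsub>F i\<^esub>"
      using field_idem_cases[OF F[OF i(1)] \<phi>c[OF e(1) i(1)]] \<phi>m[OF e(1) e(1) i(1)] e(2) by simp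
    have Ee: "E i \<otimes> e = E i"
      by - (rule eqI, use e(1) E i(1) EM 1 in auto)
    then have "e \<otimes> E i = E i" using e(1) E(1)[OF i(1)] by (simp add: m_comm)
    then have "E i \<in> carrier (corner R e)" using E(1)[OF i(1)] by simp
    from field_idem_cases[OF fe this] have "E i = \<zero> \<or> E i = e" using EE[OF i(1)] by simp
    moreover have "E i \<noteq> \<zero>" using E(2)[OF i(1) i(1)] \<phi>z[OF i(1)] fc(3)[OF i(1)] by auto
    ultimately show "e \<in> E ` I" using i(1) by auto
  next
    fix e assume "e \<in> E ` I"
    then show "e \<in> field_idems R" using E(1) EE fldE by (auto simp: field_idems_def)
  qed
  have inj: "inj_on E I"
  proof (rule inj_onI)
    fix i j assume ij: "i \<in> I" "j \<in> I" "E i = E j"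
    show "i = j"
    proof (rule ccontr)
      assume "i \<noteq> j"
      then show False using E(2)[OF ij(1) ij(1)] E(2)[OF ij(2) ij(1)] ij(3) fc(3)[OF ij(1)] by simp
    qed
  qed
  have cd: "card (carrier (corner R (E i))) = card (carrier (F i))" if "i \<in> I" for i
    using ring_iso_memE(5)[OF iso[OF that]] by (rule bij_betw_same_card)
  have ss: "fin_semisimple (corner R (\<one> \<ominus> E i))" if i: "i \<in> I" for i
  proof (rule field_decomp_imp_fin_semisimple)
    note c = complement_idem[OF E(1)[OF i] EE[OF i]]
    show "cring (corner R (\<one> \<ominus> E i))" using cring_corner[OF c(1,2)] .
    have mem: "x \<in> carrier (corner R (\<one> \<ominus> E i)) \<longleftrightarrow> x \<in> carrier R \<and> \<phi> i x = \<zero>\<^bsub>F i\<^esub>" for x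
    proof -
      have "(\<one> \<ominus> E i) \<otimes> x = x \<longleftrightarrow> E i \<otimes> x = \<zero>" if x: "x \<in> carrier R"
      proof -
        have s: "x = E i \<otimes> x \<oplus> (\<one> \<ominus> E i) \<otimes> x" using l_distr[OF E(1)[OF i] c(1) x] c(5) x by simp
        have cl: "E i \<otimes> x \<in> carrier R" "(\<one> \<ominus> E i) \<otimes> x \<in> carrier R" using E(1)[OF i] x c(1) by auto
        show ?thesis
        proof
          assume "(\<one> \<ominus> E i) \<otimes> x = x"
          then have "E i \<otimes> x \<oplus> x = x" using s by simp
          then show "E i \<otimes> x = \<zero>" using cl(1) x by (simp add: add.r_cancel_one)
        next
          assume "E i \<otimes> x = \<zero>"
          then show "(\<one> \<ominus> E i) \<otimes> x = x" using s cl by simp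
        qed
      qed
      moreover have "E i \<otimes> x = \<zero> \<longleftrightarrow> \<phi> i x = \<zero>\<^bsub>F i\<^esub>" if x: "x \<in> carrier R"
      proof
        assume "E i \<otimes> x = \<zero>"
        then show "\<phi> i x = \<zero>\<^bsub>F i\<^esub>" using EM[OF i i x] \<phi>z[OF i] by simp
      next
        assume "\<phi> i x = \<zero>\<^bsub>F i\<^esub>"
        then show "E i \<otimes> x = \<zero>" by - (rule eqI, use EM[OF i _ x] \<phi>z E(1)[OF i] x in auto)
      qed
      ultimately show ?thesis by auto
    qed
    show "field_decomp (corner R (\<one> \<ominus> E i)) (I - {i}) F \<phi>"
      unfolding field_decomp_def
    proof (intro conjI ballI)
      fix j assume j: "j \<in> I - {i}"
      then show "field (F j)" "finite (carrier (F j))" using d unfolding field_decomp_def by auto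
      show "\<phi> j \<in> ring_hom (corner R (\<one> \<ominus> E i)) (F j)"
      proof (rule ring_hom_memI)
        have jI: "j \<in> I" using j by simp
        have "\<phi> j (\<one> \<ominus> E i) = \<phi> j \<one> \<oplus>\<^bsub>F j\<^esub> \<phi> j (\<ominus> E i)"
          unfolding a_minus_def using ring_hom_add[OF \<phi>[OF jI]] E(1)[OF i] by simp
        \<comment> \<open>Since j differs from i, the coordinate of \<open>E i\<close> at j is zero
          and may be added freely; additivity then cancels it against the coordinate of its
          negative.\<close>
        also have "\<phi> j (\<ominus> E i) = \<phi> j (\<ominus> E i) \<oplus>\<^bsub>F j\<^esub> \<phi> j (E i)"
        proof -
          interpret Fj: cring "F j" using crF[OF jI] .
          show ?thesis using E(2)[OF i jI] j \<phi>c[OF _ jI, of "\<ominus> E i"] E(1)[OF i] by simp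
        qed
        also have "\<dots> = \<phi> j (\<ominus> E i \<oplus> E i)" using ring_hom_add[OF \<phi>[OF jI]] E(1)[OF i] by simp
        also have "\<dots> = \<zero>\<^bsub>F j\<^esub>" using E(1)[OF i] \<phi>z[OF jI] by (simp add: l_neg)
        finally show "\<phi> j \<one>\<^bsub>corner R (\<one> \<ominus> E i)\<^esub> = \<one>\<^bsub>F j\<^esub>"
          using ring_hom_one[OF \<phi>[OF jI]] fc(1)[OF jI] crF[OF jI]
          by (simp add: cring.cring_simprules)
      qed (use j \<phi>c \<phi>m ring_hom_add[OF \<phi>] in auto)
    next
      show "bij_betw (\<lambda>x. \<lambda>j\<in>I - {i}. \<phi> j x) (carrier (corner R (\<one> \<ominus> E i))) (PiE (I - {i}) (\<lambda>j. carrier (F j)))"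
      proof (rule bij_betw_imageI)
        show "inj_on (\<lambda>x. \<lambda>j\<in>I - {i}. \<phi> j x) (carrier (corner R (\<one> \<ominus> E i)))"
        proof (rule inj_onI)
          fix x y assume x: "x \<in> carrier (corner R (\<one> \<ominus> E i))" and y: "y \<in> carrier (corner R (\<one> \<ominus> E i))"
            and eq: "(\<lambda>j\<in>I - {i}. \<phi> j x) = (\<lambda>j\<in>I - {i}. \<phi> j y)"
          have "\<phi> j x = \<phi> j y" if "j \<in> I" "j \<noteq> i" for j using fun_cong[OF eq, of j] that by simp
          then show "x = y" using x y unfolding mem by - (rule eqI, metis+)
        qed
        show "(\<lambda>x. \<lambda>j\<in>I - {i}. \<phi> j x) ` carrier (corner R (\<one> \<ominus> E i)) = PiE (I - {i}) (\<lambda>j. carrier (F j))"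
        proof (intro equalityI subsetI)
          fix f assume "f \<in> (\<lambda>x. \<lambda>j\<in>I - {i}. \<phi> j x) ` carrier (corner R (\<one> \<ominus> E i))"
          then show "f \<in> PiE (I - {i}) (\<lambda>j. carrier (F j))" using \<phi>c by (auto split: if_splits)
        next
          fix f assume f: "f \<in> PiE (I - {i}) (\<lambda>j. carrier (F j))"
          have "\<exists>x\<in>carrier R. \<forall>j\<in>I. \<phi> j x = (if j = i then \<zero>\<^bsub>F j\<^esub> else f j)"
            by (rule ex) (use f fc in \<open>auto simp: PiE_def Pi_def\<close>)
          then obtain x where x: "x \<in> carrier R" "\<forall>j\<in>I. \<phi> j x = (if j = i then \<zero>\<^bsub>F j\<^esub> else f j)"
            by blast
          have "x \<in> carrier (corner R (\<one> \<ominus> E i))" unfolding mem using x i by simp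
          moreover have "f = (\<lambda>j\<in>I - {i}. \<phi> j x)"
          proof
            fix j show "f j = (\<lambda>j\<in>I - {i}. \<phi> j x) j"
              using x(2) f by (cases "j \<in> I - {i}") (auto simp: PiE_def extensional_def)
          qed
          ultimately show "f \<in> (\<lambda>x. \<lambda>j\<in>I - {i}. \<phi> j x) ` carrier (corner R (\<one> \<ominus> E i))" by blast
        qed
      qed
    qed (use fI in auto)
  qed
  show thesis by (rule that[OF fi inj cd ss])
qed

lemma fin_semisimple_cring: "fin_semisimple R \<Longrightarrow> cring R"
  by (simp add: fin_semisimple_def)

lemma fin_semisimple_corner:
  assumes "fin_semisimple R" "e \<in> field_idems R"
  shows "fin_semisimple (corner R (\<one>\<^bsub>R\<^esub> \<ominus>\<^bsub>R\<^esub> e))"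
proof -
  obtain m F \<phi> where d: "field_decomp R {..<m::nat} F \<phi>" "cring R"
    using assms(1) fin_semisimple_iff_decomp by blast
  from field_decomp_idems[OF d(2,1)] assms(2) show ?thesis by (metis imageE)
qed

text \<open>The size of R is the product of the sizes of its factors, and the logarithm turns this
  into a sum. The one-element ring gives the empty sum.\<close>

lemma sum_ln_card_corner:
  assumes "fin_semisimple R"
  shows "finite (field_idems R)" "(\<Sum>e\<in>field_idems R. ln (real (card (carrier (corner R e))))) = ln (real (card (carrier R)))"
proof -
  obtain m F \<phi> where d: "field_decomp R {..<m::nat} F \<phi>" "cring R"
    using assms(1) fin_semisimple_iff_decomp by blast
  obtain E where E: "field_idems R = E ` {..<m}" "inj_on E {..<m}"
    "\<And>i. i \<in> {..<m} \<Longrightarrow> card (carrier (corner R (E i))) = card (carrier (F i))"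
    using field_decomp_idems[OF d(2,1)] by metis
  show "finite (field_idems R)" by (simp add: E(1))
  note D = d(1)[unfolded field_decomp_def]
  have pos: "card (carrier (F i)) > 0" if "i < m" for i
  proof -
    interpret field "F i" using D that by auto
    show ?thesis using D that zero_closed by (auto simp: card_gt_0_iff)
  qed
  have "card (carrier R) = (\<Prod>i<m. card (carrier (F i)))"
  proof -
    have "card (carrier R) = card (PiE {..<m} (\<lambda>i. carrier (F i)))"
      using D bij_betw_same_card by blast
    then show ?thesis by (simp add: card_PiE)
  qed
  then have "ln (real (card (carrier R))) = ln (\<Prod>i<m. real (card (carrier (F i))))" by simp
  also have "\<dots> = (\<Sum>i<m. ln (real (card (carrier (F i)))))"
    using pos by (intro ln_prod) auto
  also have "\<dots> = (\<Sum>i<m. ln (real (card (carrier (corner R (E i))))))" using E(3) by simp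
  also have "\<dots> = (\<Sum>e\<in>field_idems R. ln (real (card (carrier (corner R e)))))"
    unfolding E(1) using E(2) by (simp add: sum.reindex)
  finally show "(\<Sum>e\<in>field_idems R. ln (real (card (carrier (corner R e))))) = ln (real (card (carrier R)))" ..
qed

section \<open>Ring structures on initial segments\<close>

text \<open>The operations are normalised off the carrier as in \<open>ring_structs\<close>, so that
  structures on n points can be compared by equality. Field structures and semisimple structures are
  both carved out of this finite set.\<close>

definition normal_crings :: "nat \<Rightarrow> nat ring set" where
  "normal_crings n = {R. cring R \<and> carrier R = {..<n} \<and>
     (\<forall>x y. x \<notin> {..<n} \<or> y \<notin> {..<n} \<longrightarrow> x \<otimes>\<^bsub>R\<^esub> y = 0 \<and> x \<oplus>\<^bsub>R\<^esub> y = 0)}"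

definition field_structs :: "nat \<Rightarrow> nat ring set" where
  "field_structs n = {R \<in> normal_crings n. field R}"

lemma ring_structs_eq: "ring_structs n = {R \<in> normal_crings n. fin_semisimple R}"
  by (auto simp: ring_structs_def normal_crings_def fin_semisimple_cring)

lemma normal_cringsD:
  assumes "R \<in> normal_crings n"
  shows "cring R" "carrier R = {..<n}"
  using assms by (auto simp: normal_crings_def)

lemma normal_crings_eqI:
  assumes R: "R \<in> normal_crings n" and S: "S \<in> normal_crings n"
    and "\<And>x y. x < n \<Longrightarrow> y < n \<Longrightarrow> x \<otimes>\<^bsub>R\<^esub> y = x \<otimes>\<^bsub>S\<^esub> y"
    and "\<And>x y. x < n \<Longrightarrow> y < n \<Longrightarrow> x \<oplus>\<^bsub>R\<^esub> y = x \<oplus>\<^bsub>S\<^esub> y"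
    and "\<one>\<^bsub>R\<^esub> = \<one>\<^bsub>S\<^esub>" "\<zero>\<^bsub>R\<^esub> = \<zero>\<^bsub>S\<^esub>"
  shows "R = S"
proof -
  have "monoid.mult R = monoid.mult S"
  proof (intro ext)
    fix x y show "x \<otimes>\<^bsub>R\<^esub> y = x \<otimes>\<^bsub>S\<^esub> y"
      using R S assms(3)[of x y] by (cases "x < n \<and> y < n") (auto simp: normal_crings_def)
  qed
  moreover have "add R = add S"
  proof (intro ext)
    fix x y show "x \<oplus>\<^bsub>R\<^esub> y = x \<oplus>\<^bsub>S\<^esub> y"
      using R S assms(4)[of x y] by (cases "x < n \<and> y < n") (auto simp: normal_crings_def)
  qed
  ultimately show ?thesis using R S assms(5,6) by (auto simp: normal_crings_def intro!: ring.equality)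
qed

text \<open>Product, sum, unit and zero can be read back through the injective \<open>f\<close>.
  This makes the unions over structures disjoint in the counts below.\<close>

lemma normal_crings_iso_unique:
  assumes R: "R \<in> normal_crings n" and S: "S \<in> normal_crings n" and T: "cring T"
    and f: "f \<in> ring_iso R T" "f \<in> ring_iso S T"
  shows "R = S"
proof (rule normal_crings_eqI[OF R S])
  note cR = normal_cringsD[OF R] and cS = normal_cringsD[OF S]
  interpret R: cring R by (rule cR(1))
  interpret S: cring S by (rule cS(1))
  note fR = ring_iso_memE[OF f(1), unfolded cR(2) lessThan_iff] and fS = ring_iso_memE[OF f(2), unfolded cS(2) lessThan_iff]
  have eqI: "x = y" if "x < n" "y < n" "f x = f y" for x y
    using fR(5) that by (auto simp: bij_betw_def inj_on_def)
  have c: "\<And>x y. x < n \<Longrightarrow> y < n \<Longrightarrow> x \<otimes>\<^bsub>R\<^esub> y < n" "\<And>x y. x < n \<Longrightarrow> y < n \<Longrightarrow> x \<oplus>\<^bsub>R\<^esub> y < n"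
    "\<one>\<^bsub>R\<^esub> < n" "\<zero>\<^bsub>R\<^esub> < n"
    using R.m_closed R.a_closed R.one_closed R.zero_closed unfolding cR(2) by auto
  have c': "\<And>x y. x < n \<Longrightarrow> y < n \<Longrightarrow> x \<otimes>\<^bsub>S\<^esub> y < n" "\<And>x y. x < n \<Longrightarrow> y < n \<Longrightarrow> x \<oplus>\<^bsub>S\<^esub> y < n"
    "\<one>\<^bsub>S\<^esub> < n" "\<zero>\<^bsub>S\<^esub> < n"
    using S.m_closed S.a_closed S.one_closed S.zero_closed unfolding cS(2) by auto
  show "x \<otimes>\<^bsub>R\<^esub> y = x \<otimes>\<^bsub>S\<^esub> y" if "x < n" "y < n" for x y
    using that c(1) c'(1) fR(2) fS(2) by (intro eqI) simp_all
  show "x \<oplus>\<^bsub>R\<^esub> y = x \<oplus>\<^bsub>S\<^esub> y" if "x < n" "y < n" for x y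
    using that c(2) c'(2) fR(3) fS(3) by (intro eqI) simp_all
  show "\<one>\<^bsub>R\<^esub> = \<one>\<^bsub>S\<^esub>" using c(3) c'(3) fR(4) fS(4) by (intro eqI) simp_all
  show "\<zero>\<^bsub>R\<^esub> = \<zero>\<^bsub>S\<^esub>" using c(4) c'(4) ring_iso_zero[OF cR(1) T f(1)] ring_iso_zero[OF cS(1) T f(2)]
    by (intro eqI) simp_all
qed

lemma ring_iso_same:
  assumes "cring A" "cring F" "u \<in> ring_iso A F" "u \<in> ring_iso A G"
  shows "id \<in> ring_iso F G"
proof (rule ring_iso_cong[OF assms(2)])
  show "u \<circ> inv_into (carrier A) u \<in> ring_iso F G"
    using ring_iso_set_trans[OF ring_iso_inv[OF assms(1,3)] assms(4)] .
  show "(u \<circ> inv_into (carrier A) u) x = id x" if "x \<in> carrier F" for x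
    using bij_betw_inv_into_right[OF ring_iso_memE(5)[OF assms(3)] that] by simp
qed

definition push_ring :: "nat \<Rightarrow> ('a \<Rightarrow> nat) \<Rightarrow> ('a, 'm) ring_scheme \<Rightarrow> nat ring" where
  "push_ring n u A = (let v = inv_into (carrier A) u in
    \<lparr>carrier = {..<n}, monoid.mult = \<lambda>x y. if x < n \<and> y < n then u (v x \<otimes>\<^bsub>A\<^esub> v y) else 0,
     one = u \<one>\<^bsub>A\<^esub>, zero = u \<zero>\<^bsub>A\<^esub>, add = \<lambda>x y. if x < n \<and> y < n then u (v x \<oplus>\<^bsub>A\<^esub> v y) else 0\<rparr>)"

lemma push_ring:
  assumes "cring A" "bij_betw u (carrier A) {..<n}"
  shows "push_ring n u A \<in> normal_crings n" "u \<in> ring_iso A (push_ring n u A)"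
proof -
  have inv: "inv_into (carrier A) u (u x) = x" if "x \<in> carrier A" for x
    using bij_betw_inv_into_left[OF assms(2) that] .
  have u: "u x < n" if "x \<in> carrier A" for x using bij_betwE[OF assms(2)] that by auto
  show iso: "u \<in> ring_iso A (push_ring n u A)"
    by (rule ring_iso_memI) (use assms(2) in \<open>auto simp: push_ring_def inv u Let_def\<close>)
  have "cring (push_ring n u A)"
    by (rule ring_iso_imp_cring[OF assms(1) iso]) (simp add: push_ring_def Let_def)
  then show "push_ring n u A \<in> normal_crings n"
    by (auto simp: normal_crings_def push_ring_def Let_def)
qed

lemma ex_normal_cring:
  assumes "cring A" "bij_betw u (carrier A) {..<n}"
  obtains R where "R \<in> normal_crings n" "u \<in> ring_iso A R"
  using push_ring[OF assms] by blast

text \<open>Transport of structure: each bijection onto a fixed ring pulls back exactly one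
  structure. Counting structures thereby reduces to counting bijections.\<close>

lemma ex1_normal_cring:
  assumes "cring S" "bij_betw \<beta> {..<n} (carrier S)"
  shows "\<exists>!R. R \<in> normal_crings n \<and> \<beta> \<in> ring_iso R S"
proof -
  let ?v = "inv_into {..<n} \<beta>"
  obtain R where R: "R \<in> normal_crings n" "?v \<in> ring_iso S R"
    using ex_normal_cring[OF assms(1) bij_betw_inv_into[OF assms(2)]] .
  have "inv_into (carrier S) ?v \<in> ring_iso R S" by (rule ring_iso_inv[OF assms(1) R(2)])
  moreover have "inv_into (carrier S) ?v x = \<beta> x" if "x \<in> carrier R" for x
  proof -
    have x: "x \<in> {..<n}" using that normal_cringsD(2)[OF R(1)] by simp
    have "inv_into (carrier S) ?v (?v (\<beta> x)) = \<beta> x"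
      by (rule bij_betw_inv_into_left[OF bij_betw_inv_into[OF assms(2)]])
        (use bij_betwE[OF assms(2)] x in blast)
    then show ?thesis using bij_betw_inv_into_left[OF assms(2) x] by simp
  qed
  ultimately have "\<beta> \<in> ring_iso R S"
    by (rule ring_iso_cong[OF normal_cringsD(1)[OF R(1)]])
  then show ?thesis using R(1) normal_crings_iso_unique[OF _ _ assms(1)] by blast
qed

text \<open>A structure is encoded by its unit, its zero and two finite operation tables.\<close>

lemma finite_normal_crings: "finite (normal_crings n)"
proof -
  let ?T = "PiE ({..<n} \<times> {..<n}) (\<lambda>_. {..<n})"
  let ?f = "\<lambda>(o', z, m, a). \<lparr>carrier = {..<n}, monoid.mult = \<lambda>x y. if x < n \<and> y < n then m (x, y) else 0,
     one = o', zero = z, add = \<lambda>x y. if x < n \<and> y < n then a (x, y) else 0\<rparr> :: nat ring"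
  have "finite ({..<n} \<times> {..<n} \<times> ?T \<times> ?T)" by (intro finite_cartesian_product finite_PiE) auto
  moreover have "normal_crings n \<subseteq> ?f ` ({..<n} \<times> {..<n} \<times> ?T \<times> ?T)"
  proof
    fix R assume R: "R \<in> normal_crings n"
    interpret cring R by (rule normal_cringsD(1)[OF R])
    note c = normal_cringsD(2)[OF R]
    let ?m = "\<lambda>p\<in>{..<n} \<times> {..<n}. fst p \<otimes>\<^bsub>R\<^esub> snd p" and ?a = "\<lambda>p\<in>{..<n} \<times> {..<n}. fst p \<oplus>\<^bsub>R\<^esub> snd p"
    show "R \<in> ?f ` ({..<n} \<times> {..<n} \<times> ?T \<times> ?T)"
    proof (rule image_eqI)
      show "R = ?f (\<one>\<^bsub>R\<^esub>, \<zero>\<^bsub>R\<^esub>, ?m, ?a)"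
        using R by (auto simp: normal_crings_def fun_eq_iff intro!: ring.equality)
      have "?m \<in> ?T" "?a \<in> ?T" using m_closed a_closed unfolding c by auto
      moreover have "\<one>\<^bsub>R\<^esub> \<in> {..<n}" "\<zero>\<^bsub>R\<^esub> \<in> {..<n}" using one_closed zero_closed unfolding c by auto
      ultimately show "(\<one>\<^bsub>R\<^esub>, \<zero>\<^bsub>R\<^esub>, ?m, ?a) \<in> {..<n} \<times> {..<n} \<times> ?T \<times> ?T" by blast
    qed
  qed
  ultimately show ?thesis by (rule finite_surj)
qed

lemma finite_ring_structs: "finite (ring_structs n)" "finite (field_structs n)"
  unfolding ring_structs_eq field_structs_def using finite_normal_crings by auto

text \<open>Both products live on the same set and are matched with \<open>R\<close> by the same
  map, so \<open>id\<close> is an isomorphism between them, and the operations can be compared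
  coordinate by coordinate.\<close>

lemma RDirProd_iso_unique:
  assumes F: "F \<in> normal_crings Q" "F' \<in> normal_crings Q" and G: "G \<in> normal_crings M" "G' \<in> normal_crings M"
    and "cring R" and \<beta>: "\<beta> \<in> ring_iso R (RDirProd F G)" "\<beta> \<in> ring_iso R (RDirProd F' G')"
  shows "F = F' \<and> G = G'"
proof -
  note c = normal_cringsD[OF F(1)] normal_cringsD[OF F(2)] normal_cringsD[OF G(1)] normal_cringsD[OF G(2)]
  have iso: "id \<in> ring_iso (RDirProd F G) (RDirProd F' G')"
    using ring_iso_same[OF assms(5) cring_RDirProd[OF c(1,5)] \<beta>] .
  note I = ring_iso_memE[OF iso]
  have z: "id \<zero>\<^bsub>RDirProd F G\<^esub> = \<zero>\<^bsub>RDirProd F' G'\<^esub>"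
    using ring_iso_zero[OF cring_RDirProd[OF c(1,5)] cring_RDirProd[OF c(3,7)] iso] .
  have "0 < Q" "0 < M" using cring.cring_simprules(2)[OF c(1)] cring.cring_simprules(2)[OF c(5)] c by auto
  \<comment> \<open>The 0 here is the natural number, serving as some point of the other carrier and
    not as the zero of a ring: the operation in one coordinate does not depend on the other.\<close>
  then have Q: "(x, 0) \<in> carrier (RDirProd F G)" "(0, y) \<in> carrier (RDirProd F G)" if "x < Q" "y < M" for x y
    using that c by auto
  have "F = F'"
  proof (rule normal_crings_eqI[OF F])
    fix x y assume xy: "x < Q" "y < Q"
    show "x \<otimes>\<^bsub>F\<^esub> y = x \<otimes>\<^bsub>F'\<^esub> y" "x \<oplus>\<^bsub>F\<^esub> y = x \<oplus>\<^bsub>F'\<^esub> y"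
      using I(2,3)[OF Q(1)[OF xy(1) \<open>0 < M\<close>] Q(1)[OF xy(2) \<open>0 < M\<close>]] by simp_all
  qed (use z I(4) in auto)
  moreover have "G = G'"
  proof (rule normal_crings_eqI[OF G])
    fix x y assume xy: "x < M" "y < M"
    show "x \<otimes>\<^bsub>G\<^esub> y = x \<otimes>\<^bsub>G'\<^esub> y" "x \<oplus>\<^bsub>G\<^esub> y = x \<oplus>\<^bsub>G'\<^esub> y"
      using I(2,3)[OF Q(2)[OF \<open>0 < Q\<close> xy(1)] Q(2)[OF \<open>0 < Q\<close> xy(2)]] by simp_all
  qed (use z I(4) in auto)
  ultimately show ?thesis ..
qed

text \<open>The objects of the double count: for fixed R they encode an idempotent with labellings
  of its two corners; as R varies they exhaust all independent choices of the three
  components.\<close>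

definition splittings :: "nat \<Rightarrow> nat \<Rightarrow> nat ring \<Rightarrow> ((nat \<Rightarrow> nat \<times> nat) \<times> nat ring \<times> nat ring) set" where
  "splittings Q M R = {(\<beta>, F, G). \<beta> \<in> bijections (carrier R) ({..<Q} \<times> {..<M}) \<and> F \<in> field_structs Q \<and>
     G \<in> ring_structs M \<and> \<beta> \<in> ring_iso R (RDirProd F G)}"

text \<open>The idempotent is the preimage of (1, 0), and the labellings are the two coordinates of
  \<open>\<beta>\<close> on the corners. Conversely, labellings transport the corner rings to F and
  G and combine to a bijection on R.\<close>

lemma card_splittings:
  fixes R (structure)
  assumes R: "fin_semisimple R" "finite (carrier R)" "card (carrier R) = Q * M" and QM: "Q > 0" "M > 0"
  shows "card (splittings Q M R) = card {e \<in> field_idems R. card (carrier (corner R e)) = Q} * (fact Q * fact M)"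
proof -
  interpret cring R by (rule fin_semisimple_cring[OF R(1)])
  let ?E = "{e \<in> field_idems R. card (carrier (corner R e)) = Q}"
  let ?B = "\<lambda>e. bijections (carrier (corner R e)) {..<Q} \<times> bijections (carrier (corner R (\<one> \<ominus> e))) {..<M}"
  let ?C = "carrier R"
  define \<Phi> where "\<Phi> = (\<lambda>(\<beta> :: nat \<Rightarrow> nat \<times> nat, F :: nat ring, G :: nat ring).
      let e = inv_into ?C \<beta> (\<one>\<^bsub>F\<^esub>, \<zero>\<^bsub>G\<^esub>) in
      (e, restrict (fst \<circ> \<beta>) (carrier (corner R e)), restrict (snd \<circ> \<beta>) (carrier (corner R (\<one> \<ominus> e)))))"
  have idem: "e \<in> ?C" "e \<otimes> e = e" if "e \<in> ?E" for e using that by (auto simp: field_idems_def)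
  have card_cor: "finite (carrier (corner R e))" "finite (carrier (corner R (\<one> \<ominus> e)))"
      "card (carrier (corner R (\<one> \<ominus> e))) = M" if e: "e \<in> ?E" for e
  proof -
    show fin: "finite (carrier (corner R e))" "finite (carrier (corner R (\<one> \<ominus> e)))"
      by (rule finite_subset[OF _ R(2)], auto)+
    have "card ?C = card (carrier (corner R e)) * card (carrier (corner R (\<one> \<ominus> e)))"
      using bij_betw_same_card[OF corner_bij[OF idem[OF e]]] by (simp add: card_cartesian_product)
    then show "card (carrier (corner R (\<one> \<ominus> e))) = M" using e R(3) QM by simp
  qed
  \<comment> \<open>The last conjunct recovers the bijection from its restrictions to the corners,
    which gives injectivity of \<open>\<Phi>\<close>; once the bijection is known, F and G are
    determined by \<open>RDirProd_iso_unique\<close>.\<close>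
  have key: "\<exists>e\<in>?E. \<Phi> (\<beta>, F, G) = (e, restrict (fst \<circ> \<beta>) (carrier (corner R e)), restrict (snd \<circ> \<beta>) (carrier (corner R (\<one> \<ominus> e))))
      \<and> restrict (fst \<circ> \<beta>) (carrier (corner R e)) \<in> bijections (carrier (corner R e)) {..<Q}
      \<and> restrict (snd \<circ> \<beta>) (carrier (corner R (\<one> \<ominus> e))) \<in> bijections (carrier (corner R (\<one> \<ominus> e))) {..<M}
      \<and> (\<forall>r\<in>?C. \<beta> r = (fst (\<beta> (e \<otimes> r)), snd (\<beta> ((\<one> \<ominus> e) \<otimes> r))))"
    if D: "(\<beta>, F, G) \<in> splittings Q M R" for \<beta> F G
  proof -
    have \<beta>: "\<beta> \<in> ring_iso R (RDirProd F G)" and F: "F \<in> normal_crings Q" "field F"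
      and G: "G \<in> normal_crings M" and ext: "\<beta> \<in> extensional ?C"
      using D by (auto simp: splittings_def bijections_def field_structs_def ring_structs_eq)
    note I = ring_iso_memE[OF \<beta>]
    note cF = normal_cringsD[OF F(1)] and cG = normal_cringsD[OF G]
    interpret F: cring F by (rule cF(1))
    interpret G: cring G by (rule cG(1))
    have \<beta>c: "fst (\<beta> x) \<in> carrier F" "snd (\<beta> x) \<in> carrier G" if "x \<in> ?C" for x
      using I(1)[OF that] by (auto simp: mem_Times_iff)
    have \<beta>m: "\<beta> (x \<otimes> y) = (fst (\<beta> x) \<otimes>\<^bsub>F\<^esub> fst (\<beta> y), snd (\<beta> x) \<otimes>\<^bsub>G\<^esub> snd (\<beta> y))"
      if "x \<in> ?C" "y \<in> ?C" for x y
      using I(2)[OF that] RDirProd_simps(2)[where R=F and S=G and a="fst (\<beta> x)" and b="snd (\<beta> x)" and c="fst (\<beta> y)" and d="snd (\<beta> y)"] by simp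
    have \<beta>a: "\<beta> (x \<oplus> y) = (fst (\<beta> x) \<oplus>\<^bsub>F\<^esub> fst (\<beta> y), snd (\<beta> x) \<oplus>\<^bsub>G\<^esub> snd (\<beta> y))"
      if "x \<in> ?C" "y \<in> ?C" for x y
      using I(3)[OF that] RDirProd_simps(3)[where R=F and S=G and a="fst (\<beta> x)" and b="snd (\<beta> x)" and c="fst (\<beta> y)" and d="snd (\<beta> y)"] by simp
    have inj: "x = y" if "x \<in> ?C" "y \<in> ?C" "\<beta> x = \<beta> y" for x y
      using I(5) that unfolding bij_betw_def inj_on_def by blast
    have surj: "\<exists>x\<in>?C. \<beta> x = (a, b)" if "a \<in> carrier F" "b \<in> carrier G" for a b
    proof -
      have "(a, b) \<in> \<beta> ` ?C" using I(5) that by (simp add: bij_betw_def)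
      then show ?thesis by force
    qed
    define e where "e = inv_into ?C \<beta> (\<one>\<^bsub>F\<^esub>, \<zero>\<^bsub>G\<^esub>)"
    have "(\<one>\<^bsub>F\<^esub>, \<zero>\<^bsub>G\<^esub>) \<in> \<beta> ` ?C" using I(5) by (simp add: bij_betw_def)
    then have e: "e \<in> ?C" "\<beta> e = (\<one>\<^bsub>F\<^esub>, \<zero>\<^bsub>G\<^esub>)"
      unfolding e_def by (auto intro: inv_into_into f_inv_into_f)
    have ee: "e \<otimes> e = e" by (rule inj) (use e \<beta>m in auto)
    note c = complement_idem[OF e(1) ee]
    have \<beta>1: "\<beta> \<one> = (\<one>\<^bsub>F\<^esub>, \<one>\<^bsub>G\<^esub>)" using I(4) by simp
    have ce: "\<beta> (\<one> \<ominus> e) = (\<zero>\<^bsub>F\<^esub>, \<one>\<^bsub>G\<^esub>)"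
    proof -
      have "\<beta> (e \<oplus> (\<one> \<ominus> e)) = (\<one>\<^bsub>F\<^esub>, \<one>\<^bsub>G\<^esub>)" unfolding c(5) by (rule \<beta>1)
      then have "\<one>\<^bsub>F\<^esub> \<oplus>\<^bsub>F\<^esub> fst (\<beta> (\<one> \<ominus> e)) = \<one>\<^bsub>F\<^esub>" "\<zero>\<^bsub>G\<^esub> \<oplus>\<^bsub>G\<^esub> snd (\<beta> (\<one> \<ominus> e)) = \<one>\<^bsub>G\<^esub>"
        using \<beta>a[OF e(1) c(1)] e(2) by auto
      then show ?thesis using \<beta>c[OF c(1)] by (simp add: prod_eq_iff)
    qed
    have be: "\<beta> (e \<otimes> r) = (fst (\<beta> r), \<zero>\<^bsub>G\<^esub>)" "\<beta> ((\<one> \<ominus> e) \<otimes> r) = (\<zero>\<^bsub>F\<^esub>, snd (\<beta> r))" if "r \<in> ?C" for r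
      using \<beta>m[OF e(1) that] \<beta>m[OF c(1) that] e(2) ce \<beta>c[OF that] by auto
    have m1: "x \<in> carrier (corner R e) \<longleftrightarrow> x \<in> ?C \<and> snd (\<beta> x) = \<zero>\<^bsub>G\<^esub>" for x
      using be(1)[of x] inj[of "e \<otimes> x" x] e(1) by (auto simp: prod_eq_iff)
    have m2: "x \<in> carrier (corner R (\<one> \<ominus> e)) \<longleftrightarrow> x \<in> ?C \<and> fst (\<beta> x) = \<zero>\<^bsub>F\<^esub>" for x
      using be(2)[of x] inj[of "(\<one> \<ominus> e) \<otimes> x" x] c(1) by (auto simp: prod_eq_iff)
    have b1: "bij_betw (fst \<circ> \<beta>) (carrier (corner R e)) (carrier F)"
    proof (rule bij_betw_imageI)
      show "inj_on (fst \<circ> \<beta>) (carrier (corner R e))"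
        by (rule inj_onI) (auto simp only: m1 comp_def prod_eq_iff intro!: inj)
      show "(fst \<circ> \<beta>) ` carrier (corner R e) = carrier F"
      proof (intro equalityI subsetI)
        fix a assume "a \<in> carrier F"
        then obtain x where "x \<in> ?C" "\<beta> x = (a, \<zero>\<^bsub>G\<^esub>)" using surj G.zero_closed by blast
        then show "a \<in> (fst \<circ> \<beta>) ` carrier (corner R e)" by (intro image_eqI[of _ _ x]) (auto simp only: m1 comp_def fst_conv snd_conv)
      qed (auto simp only: m1 comp_def \<beta>c)
    qed
    have b2: "bij_betw (snd \<circ> \<beta>) (carrier (corner R (\<one> \<ominus> e))) (carrier G)"
    proof (rule bij_betw_imageI)
      show "inj_on (snd \<circ> \<beta>) (carrier (corner R (\<one> \<ominus> e)))"
        by (rule inj_onI) (auto simp only: m2 comp_def prod_eq_iff intro!: inj)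
      show "(snd \<circ> \<beta>) ` carrier (corner R (\<one> \<ominus> e)) = carrier G"
      proof (intro equalityI subsetI)
        fix a assume "a \<in> carrier G"
        then obtain x where "x \<in> ?C" "\<beta> x = (\<zero>\<^bsub>F\<^esub>, a)" using surj F.zero_closed by blast
        then show "a \<in> (snd \<circ> \<beta>) ` carrier (corner R (\<one> \<ominus> e))" by (intro image_eqI[of _ _ x]) (auto simp only: m2 comp_def fst_conv snd_conv)
      qed (auto simp only: m2 comp_def \<beta>c)
    qed
    have crc: "cring (corner R e)" by (rule cring_corner[OF e(1) ee])
    have "fst \<circ> \<beta> \<in> ring_iso (corner R e) F"
      by (rule ring_iso_memI) (use b1 \<beta>c \<beta>m \<beta>a e(2) in auto)
    then have fe: "field (corner R e)"
      using ring_iso_imp_field'[OF F(2) crc ring_iso_inv[OF crc]] by blast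
    have eE: "e \<in> ?E" using e ee fe bij_betw_same_card[OF b1] cF(2) by (simp add: field_idems_def)
    have "\<forall>r\<in>?C. \<beta> r = (fst (\<beta> (e \<otimes> r)), snd (\<beta> ((\<one> \<ominus> e) \<otimes> r)))"
      using be by simp
    moreover have "restrict (fst \<circ> \<beta>) (carrier (corner R e)) \<in> bijections (carrier (corner R e)) {..<Q}"
      using b1 unfolding cF(2) bijections_def by (simp add: bij_betw_def)
    moreover have "restrict (snd \<circ> \<beta>) (carrier (corner R (\<one> \<ominus> e))) \<in> bijections (carrier (corner R (\<one> \<ominus> e))) {..<M}"
      using b2 unfolding cG(2) bijections_def by (simp add: bij_betw_def)
    moreover have "\<Phi> (\<beta>, F, G) = (e, restrict (fst \<circ> \<beta>) (carrier (corner R e)), restrict (snd \<circ> \<beta>) (carrier (corner R (\<one> \<ominus> e))))"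
      by (simp add: \<Phi>_def Let_def e_def)
    ultimately show ?thesis using eE by blast
  qed
  have "bij_betw \<Phi> (splittings Q M R) (SIGMA e:?E. ?B e)"
  proof (rule bij_betw_imageI)
    show "inj_on \<Phi> (splittings Q M R)"
    proof (rule inj_onI)
      fix d d' assume d: "d \<in> splittings Q M R" "d' \<in> splittings Q M R" "\<Phi> d = \<Phi> d'"
      obtain \<beta> F G \<beta>' F' G' where dd: "d = (\<beta>, F, G)" "d' = (\<beta>', F', G')" by (metis prod_cases3)
      obtain e where e: "e \<in> ?E"
        "\<Phi> d = (e, restrict (fst \<circ> \<beta>) (carrier (corner R e)), restrict (snd \<circ> \<beta>) (carrier (corner R (\<one> \<ominus> e))))"
        "\<forall>r\<in>?C. \<beta> r = (fst (\<beta> (e \<otimes> r)), snd (\<beta> ((\<one> \<ominus> e) \<otimes> r)))"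
        using key[OF d(1)[unfolded dd]] unfolding dd by blast
      obtain e' where e': "e' \<in> ?E"
        "\<Phi> d' = (e', restrict (fst \<circ> \<beta>') (carrier (corner R e')), restrict (snd \<circ> \<beta>') (carrier (corner R (\<one> \<ominus> e'))))"
        "\<forall>r\<in>?C. \<beta>' r = (fst (\<beta>' (e' \<otimes> r)), snd (\<beta>' ((\<one> \<ominus> e') \<otimes> r)))"
        using key[OF d(2)[unfolded dd]] unfolding dd by blast
      have ee: "e' = e" using d(3) e(2) e'(2) by simp
      have r1: "restrict (fst \<circ> \<beta>) (carrier (corner R e)) = restrict (fst \<circ> \<beta>') (carrier (corner R e))"
        and r2: "restrict (snd \<circ> \<beta>) (carrier (corner R (\<one> \<ominus> e))) = restrict (snd \<circ> \<beta>') (carrier (corner R (\<one> \<ominus> e)))"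
        using d(3) e(2) e'(2) unfolding ee by auto
      note c = complement_idem[OF idem[OF e(1)]]
      have "\<beta> r = \<beta>' r" if r: "r \<in> ?C" for r
      proof -
        have "e \<otimes> r \<in> carrier (corner R e)" using ring_hom_closed[OF corner_proj[OF idem[OF e(1)]] r] .
        then have "fst (\<beta> (e \<otimes> r)) = fst (\<beta>' (e \<otimes> r))" using fun_cong[OF r1, of "e \<otimes> r"] by (simp del: corner_simps)
        moreover have "(\<one> \<ominus> e) \<otimes> r \<in> carrier (corner R (\<one> \<ominus> e))" using ring_hom_closed[OF corner_proj[OF c(1,2)] r] .
        then have "snd (\<beta> ((\<one> \<ominus> e) \<otimes> r)) = snd (\<beta>' ((\<one> \<ominus> e) \<otimes> r))"
          using fun_cong[OF r2, of "(\<one> \<ominus> e) \<otimes> r"] by (simp del: corner_simps)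
        ultimately show ?thesis using bspec[OF e(3) r] bspec[OF e'(3) r] unfolding ee by simp
      qed
      then have "\<beta> = \<beta>'" using d(1,2) unfolding dd splittings_def bijections_def by (auto intro: extensionalityI)
      moreover have "F = F' \<and> G = G'"
        by (rule RDirProd_iso_unique[of F Q F' G M G' R \<beta>])
          (use d(1,2) \<open>\<beta> = \<beta>'\<close> is_cring in \<open>auto simp: dd splittings_def field_structs_def ring_structs_eq\<close>)
      ultimately show "d = d'" unfolding dd by simp
    qed
    show "\<Phi> ` splittings Q M R = (SIGMA e:?E. ?B e)"
    proof (intro equalityI subsetI)
      fix x assume "x \<in> \<Phi> ` splittings Q M R"
      then obtain \<beta> F G where d: "(\<beta>, F, G) \<in> splittings Q M R" "x = \<Phi> (\<beta>, F, G)" by (metis imageE prod_cases3)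
      then show "x \<in> (SIGMA e:?E. ?B e)" using key[OF d(1)] by auto
    next
      fix x assume "x \<in> (SIGMA e:?E. ?B e)"
      then obtain e u v where x: "x = (e, u, v)" "e \<in> ?E"
        "u \<in> bijections (carrier (corner R e)) {..<Q}" "v \<in> bijections (carrier (corner R (\<one> \<ominus> e))) {..<M}" by auto
      note i = idem[OF x(2)]
      note c = complement_idem[OF i]
      have bu: "bij_betw u (carrier (corner R e)) {..<Q}" "u \<in> extensional (carrier (corner R e))"
        and bv: "bij_betw v (carrier (corner R (\<one> \<ominus> e))) {..<M}" "v \<in> extensional (carrier (corner R (\<one> \<ominus> e)))"
        using x(3,4) by (auto simp: bijections_def)
      have cr: "cring (corner R e)" "cring (corner R (\<one> \<ominus> e))"
        using cring_corner[OF i] cring_corner[OF c(1,2)] .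
      obtain F where F: "F \<in> normal_crings Q" "u \<in> ring_iso (corner R e) F" using ex_normal_cring[OF cr(1) bu(1)] .
      obtain G where G: "G \<in> normal_crings M" "v \<in> ring_iso (corner R (\<one> \<ominus> e)) G" using ex_normal_cring[OF cr(2) bv(1)] .
      have FF: "F \<in> field_structs Q"
        using ring_iso_imp_field'[OF _ normal_cringsD(1)[OF F(1)] F(2)] x(2) F(1)
        by (auto simp: field_structs_def field_idems_def)
      have GG: "G \<in> ring_structs M"
        using fin_semisimple_iso[OF fin_semisimple_corner[OF R(1)] normal_cringsD(1)[OF G(1)] G(2)] x(2) G(1)
        by (auto simp: ring_structs_eq)
      define \<beta> where "\<beta> = (\<lambda>r\<in>?C. (u (e \<otimes> r), v ((\<one> \<ominus> e) \<otimes> r)))"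
      have pe: "e \<otimes> r \<in> carrier (corner R e)" "(\<one> \<ominus> e) \<otimes> r \<in> carrier (corner R (\<one> \<ominus> e))" if "r \<in> ?C" for r
        using ring_hom_closed[OF corner_proj[OF i] that] ring_hom_closed[OF corner_proj[OF c(1,2)] that] .
      have bb: "bij_betw \<beta> ?C ({..<Q} \<times> {..<M})"
      proof -
        have "bij_betw (map_prod u v) (carrier (corner R e) \<times> carrier (corner R (\<one> \<ominus> e))) ({..<Q} \<times> {..<M})"
          using bij_betw_map_prod[OF bu(1) bv(1)] .
        from bij_betw_trans[OF corner_bij[OF i] this]
        show ?thesis by (rule bij_betw_cong[THEN iffD1, rotated]) (simp add: \<beta>_def)
      qed
      note Fm = ring_iso_memE[OF F(2)] and Gm = ring_iso_memE[OF G(2)]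
      note hm = ring_hom_mult[OF corner_proj[OF i]] ring_hom_mult[OF corner_proj[OF c(1,2)]]
        ring_hom_add[OF corner_proj[OF i]] ring_hom_add[OF corner_proj[OF c(1,2)]]
      have "\<beta> \<in> ring_iso R (RDirProd F G)"
      proof (rule ring_iso_memI)
        show "bij_betw \<beta> ?C (carrier (RDirProd F G))"
          using bb normal_cringsD(2)[OF F(1)] normal_cringsD(2)[OF G(1)] by simp
        then show "\<beta> r \<in> carrier (RDirProd F G)" if "r \<in> ?C" for r using that by (blast dest: bij_betwE)
        fix r s assume rs: "r \<in> ?C" "s \<in> ?C"
        have "\<beta> (r \<otimes> s) = (u (e \<otimes> (r \<otimes> s)), v ((\<one> \<ominus> e) \<otimes> (r \<otimes> s)))" using rs by (simp add: \<beta>_def)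
        also have "\<dots> = (u (e \<otimes> r) \<otimes>\<^bsub>F\<^esub> u (e \<otimes> s), v ((\<one> \<ominus> e) \<otimes> r) \<otimes>\<^bsub>G\<^esub> v ((\<one> \<ominus> e) \<otimes> s))"
          by (simp only: hm rs Fm(2)[OF pe(1)[OF rs(1)] pe(1)[OF rs(2)]] Gm(2)[OF pe(2)[OF rs(1)] pe(2)[OF rs(2)]])
        also have "\<dots> = \<beta> r \<otimes>\<^bsub>RDirProd F G\<^esub> \<beta> s" using rs by (simp add: \<beta>_def)
        finally show "\<beta> (r \<otimes> s) = \<beta> r \<otimes>\<^bsub>RDirProd F G\<^esub> \<beta> s" .
        have "\<beta> (r \<oplus> s) = (u (e \<otimes> (r \<oplus> s)), v ((\<one> \<ominus> e) \<otimes> (r \<oplus> s)))" using rs by (simp add: \<beta>_def)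
        also have "\<dots> = (u (e \<otimes> r) \<oplus>\<^bsub>F\<^esub> u (e \<otimes> s), v ((\<one> \<ominus> e) \<otimes> r) \<oplus>\<^bsub>G\<^esub> v ((\<one> \<ominus> e) \<otimes> s))"
          by (simp only: hm rs Fm(3)[OF pe(1)[OF rs(1)] pe(1)[OF rs(2)]] Gm(3)[OF pe(2)[OF rs(1)] pe(2)[OF rs(2)]])
        also have "\<dots> = \<beta> r \<oplus>\<^bsub>RDirProd F G\<^esub> \<beta> s" using rs by (simp add: \<beta>_def)
        finally show "\<beta> (r \<oplus> s) = \<beta> r \<oplus>\<^bsub>RDirProd F G\<^esub> \<beta> s" .
      next
        show "\<beta> \<one> = \<one>\<^bsub>RDirProd F G\<^esub>" using i(1) c(1) Fm(4) Gm(4) by (simp add: \<beta>_def)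
      qed
      then have D: "(\<beta>, F, G) \<in> splittings Q M R"
        using bb FF GG by (simp add: splittings_def bijections_def \<beta>_def)
      have be: "\<beta> e = (\<one>\<^bsub>F\<^esub>, \<zero>\<^bsub>G\<^esub>)"
        using i c(4) Fm(4) ring_iso_zero[OF cr(2) normal_cringsD(1)[OF G(1)] G(2)] by (simp add: \<beta>_def)
      have ie: "inv_into ?C \<beta> (\<one>\<^bsub>F\<^esub>, \<zero>\<^bsub>G\<^esub>) = e"
        using bij_betw_inv_into_left[OF bb i(1)] be by simp
      have "restrict (fst \<circ> \<beta>) (carrier (corner R e)) = u"
      proof
        fix z show "restrict (fst \<circ> \<beta>) (carrier (corner R e)) z = u z"
          using bu(2) by (cases "z \<in> carrier (corner R e)") (auto simp: \<beta>_def extensional_def)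
      qed
      moreover have "restrict (snd \<circ> \<beta>) (carrier (corner R (\<one> \<ominus> e))) = v"
      proof
        fix z show "restrict (snd \<circ> \<beta>) (carrier (corner R (\<one> \<ominus> e))) z = v z"
          using bv(2) by (cases "z \<in> carrier (corner R (\<one> \<ominus> e))") (auto simp: \<beta>_def extensional_def)
      qed
      ultimately have "\<Phi> (\<beta>, F, G) = x" unfolding \<Phi>_def x(1) by (simp add: Let_def ie)
      then show "x \<in> \<Phi> ` splittings Q M R" using D by blast
    qed
  qed
  then have "card (splittings Q M R) = card (SIGMA e:?E. ?B e)" by (rule bij_betw_same_card)
  also have "\<dots> = (\<Sum>e\<in>?E. card (?B e))"
  proof (rule card_SigmaI)
    show "finite ?E" using sum_ln_card_corner(1)[OF R(1)] by simp
    show "\<forall>e\<in>?E. finite (?B e)"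
    proof
      fix e assume e: "e \<in> ?E"
      then have "card (carrier (corner R e)) = Q" by simp
      then show "finite (?B e)" by (intro finite_cartesian_product card_bijections(1)) (use card_cor[OF e] in auto)
    qed
  qed
  also have "\<dots> = (\<Sum>e\<in>?E. fact Q * fact M)"
  proof (rule sum.cong)
    fix e assume e: "e \<in> ?E"
    then have "card (carrier (corner R e)) = Q" by simp
    then show "card (?B e) = fact Q * fact M"
      using card_bijections(2)[of "carrier (corner R e)" "{..<Q}"]
        card_bijections(2)[of "carrier (corner R (\<one> \<ominus> e))" "{..<M}"] card_cor[OF e]
      by (simp add: card_cartesian_product)
  qed simp
  finally show ?thesis by simp
qed

section \<open>The recurrence for the zeta species\<close>

text \<open>Sort the q! bijections from q points onto \<open>F0\<close>, where q = p^n, by the field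
  structure they pull back: each structure arises from its n isomorphisms to
  \<open>F0\<close>.\<close>

lemma card_field_structs:
  assumes p: "Factorial_Ring.prime p" "n \<ge> 1" and F0: "field F0" "finite (carrier F0)" "card (carrier F0) = p ^ n"
  shows "card (field_structs (p ^ n)) * n = fact (p ^ n)"
proof -
  let ?q = "p ^ n"
  let ?B = "bijections {..<?q} (carrier F0)"
  let ?I = "\<lambda>F. {\<beta> \<in> ?B. \<beta> \<in> ring_iso F F0}"
  have cr: "cring F0" using F0(1) by (simp add: field_def domain_def)
  have cardI: "card (?I F) = n" if F: "F \<in> field_structs ?q" for F
  proof -
    have F': "field F" "carrier F = {..<?q}" using F normal_cringsD by (auto simp: field_structs_def)
    have "?I F = {\<phi> \<in> extensional (carrier F). \<phi> \<in> ring_hom F F0}"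
      using field_hom_imp_iso[OF F'(1) F0(1,2)] F'(2) F0(3)
      by (auto simp: bijections_def ring_iso_def)
    then show ?thesis using card_finite_field_hom[OF F'(1) _ F0(1,2) p(1) _ F0(3) p(2)] F'(2) by simp
  qed
  have "?B = (\<Union>F\<in>field_structs ?q. ?I F)"
  proof (intro equalityI subsetI)
    fix \<beta> assume \<beta>: "\<beta> \<in> ?B"
    obtain R where R: "R \<in> normal_crings ?q" "\<beta> \<in> ring_iso R F0"
      using ex1_normal_cring[OF cr, of \<beta> ?q] \<beta> by (auto simp: bijections_def)
    then have "field R"
      using ring_iso_imp_field'[OF F0(1) normal_cringsD(1)[OF R(1)] ring_iso_inv[OF normal_cringsD(1)[OF R(1)] R(2)]] by simp
    then show "\<beta> \<in> (\<Union>F\<in>field_structs ?q. ?I F)" using R \<beta> by (auto simp: field_structs_def)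
  qed auto
  then have "card ?B = card (\<Union>F\<in>field_structs ?q. ?I F)" by simp
  also have "\<dots> = (\<Sum>F\<in>field_structs ?q. card (?I F))"
  proof (rule card_UN_disjoint)
    show "finite (field_structs ?q)" by (rule finite_ring_structs)
    show "\<forall>F\<in>field_structs ?q. finite (?I F)"
      using card_bijections(1)[of "{..<?q}" "carrier F0"] F0 by simp
    show "\<forall>F\<in>field_structs ?q. \<forall>F'\<in>field_structs ?q. F \<noteq> F' \<longrightarrow> ?I F \<inter> ?I F' = {}"
      using normal_crings_iso_unique[OF _ _ cr] by (auto simp: field_structs_def)
  qed
  also have "\<dots> = card (field_structs ?q) * n" using cardI by simp
  finally show ?thesis using card_bijections(2)[of "{..<?q}" "carrier F0"] F0 by simp
qed

text \<open>The number of homomorphisms is the positive exponent n, so one exists, and between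
  fields of equal finite size it is bijective.\<close>

lemma finite_field_iso:
  assumes "field F" "finite (carrier F)" "field F'" "finite (carrier F')" "card (carrier F) = card (carrier F')"
  shows "\<exists>f. f \<in> ring_iso F F'"
proof -
  obtain p n where p: "Factorial_Ring.prime p" "n \<ge> 1" "card (carrier F) = p ^ n"
    using finite_field_card[OF assms(1,2)] by blast
  have "card {\<phi> \<in> extensional (carrier F). \<phi> \<in> ring_hom F F'} \<noteq> 0"
    using card_finite_field_hom[OF assms(1-4) p(1,3) _ p(2)] assms(5) p by simp
  then obtain \<phi> where "\<phi> \<in> ring_hom F F'" by (metis (mono_tags, lifting) card.empty empty_Collect_eq)
  then show ?thesis using field_hom_imp_iso[OF assms(1,3,4,5)] by blast
qed

lemma field_structs_prime_power:
  assumes "F \<in> field_structs Q"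
  obtains p n where "Factorial_Ring.prime p" "n \<ge> 1" "Q = p ^ n"
proof -
  have "field F" "carrier F = {..<Q}" using assms normal_cringsD by (auto simp: field_structs_def)
  then show thesis using that finite_field_card[of F] by auto
qed

text \<open>The one-element ring is the empty product of fields. This fixes the constant
  coefficient, on which the recurrence gives no information.\<close>

lemma ring_structs_1: "\<exists>R. ring_structs 1 = {R}"
proof -
  define R0 :: "nat ring" where "R0 = \<lparr>carrier = {..<1}, monoid.mult = \<lambda>_ _. 0, one = 0, zero = 0, add = \<lambda>_ _. 0\<rparr>"
  have s: "carrier R0 = {0}" "monoid.mult R0 = (\<lambda>_ _. 0)" "\<one>\<^bsub>R0\<^esub> = 0" "\<zero>\<^bsub>R0\<^esub> = 0" "add R0 = (\<lambda>_ _. 0)"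
    by (auto simp: R0_def)
  have "abelian_group R0" by (rule abelian_groupI) (auto simp: s)
  moreover have "Group.comm_monoid R0" by (rule comm_monoidI) (auto simp: s)
  ultimately have cr: "cring R0" by (rule cringI) (auto simp: s)
  have "field_decomp R0 {..<0::nat} F \<phi>" for F \<phi>
    by (auto simp: field_decomp_def s bij_betw_def)
  then have "fin_semisimple R0" using cr fin_semisimple_iff_decomp by blast
  then have R0: "R0 \<in> ring_structs 1" using s cr by (auto simp: ring_structs_eq normal_crings_def)
  have "R = R0" if R: "R \<in> ring_structs 1" for R
  proof (rule normal_crings_eqI)
    show Rn: "R \<in> normal_crings 1" "R0 \<in> normal_crings 1" using R R0 by (auto simp: ring_structs_eq)
    interpret R: cring R by (rule normal_cringsD(1)[OF Rn(1)])
    have c: "x \<in> carrier R \<Longrightarrow> x = 0" for x using normal_cringsD(2)[OF Rn(1)] by auto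
    have z: "0 \<in> carrier R" using normal_cringsD(2)[OF Rn(1)] by auto
    show "\<one>\<^bsub>R\<^esub> = \<one>\<^bsub>R0\<^esub>" "\<zero>\<^bsub>R\<^esub> = \<zero>\<^bsub>R0\<^esub>" using c[OF R.one_closed] c[OF R.zero_closed] s by auto
    fix x y :: nat assume "x < 1" "y < 1"
    then show "x \<otimes>\<^bsub>R\<^esub> y = x \<otimes>\<^bsub>R0\<^esub> y" "x \<oplus>\<^bsub>R\<^esub> y = x \<oplus>\<^bsub>R0\<^esub> y"
      using c[OF R.m_closed[OF z z]] c[OF R.a_closed[OF z z]] s by auto
  qed
  then show ?thesis using R0 by blast
qed

text \<open>These properties of the numbers |X(R)| are all that the counting uses. Products are
  stated through projections to match \<open>multiplicative\<close>.\<close>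

locale multiplicative_weight =
  fixes W :: "nat ring \<Rightarrow> nat"
  assumes W_iso: "cring A \<Longrightarrow> cring B \<Longrightarrow> f \<in> ring_iso A B \<Longrightarrow> W A = W B"
    and W_prod: "cring A \<Longrightarrow> cring B \<Longrightarrow> cring C \<Longrightarrow> p \<in> ring_hom C A \<Longrightarrow> q \<in> ring_hom C B \<Longrightarrow>
      bij_betw (\<lambda>c. (p c, q c)) (carrier C) (carrier A \<times> carrier B) \<Longrightarrow> W C = W A * W B"
    and W_trivial: "cring C \<Longrightarrow> card (carrier C) = 1 \<Longrightarrow> W C = 1"
begin

text \<open>These turn out to be the coefficients of the formal logarithm of the series with
  coefficients \<open>ring_mass\<close>.\<close>

definition field_mass :: "nat \<Rightarrow> real" where
  "field_mass Q = real (\<Sum>F\<in>field_structs Q. W F) / fact Q"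

definition ring_mass :: "nat \<Rightarrow> real" where
  "ring_mass N = real (\<Sum>R\<in>ring_structs N. W R) / fact N"

text \<open>Given \<open>\<beta>\<close>, F and G, pulling the product ring back along
  \<open>\<beta>\<close> yields R, which is semisimple because F is a finite field and G is
  semisimple. The coordinates of \<open>\<beta>\<close> are product projections, so the weight
  splits.\<close>

lemma splittings_cover:
  "(\<Union>R\<in>ring_structs (Q * M). splittings Q M R) =
    bijections {..<Q * M} ({..<Q} \<times> {..<M}) \<times> field_structs Q \<times> ring_structs M" (is "?U = ?T")
  "R \<in> ring_structs (Q * M) \<Longrightarrow> (\<beta>, F, G) \<in> splittings Q M R \<Longrightarrow> W R = W F * W G"
proof -
  have hom: "(fst \<circ> \<beta>) \<in> ring_hom R F" "(snd \<circ> \<beta>) \<in> ring_hom R G"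
      "bij_betw (\<lambda>x. ((fst \<circ> \<beta>) x, (snd \<circ> \<beta>) x)) (carrier R) (carrier F \<times> carrier G)"
    if \<beta>: "\<beta> \<in> ring_iso R (RDirProd F G)" for R :: "nat ring" and F G :: "nat ring" and \<beta>
  proof -
    note I = ring_iso_memE[OF \<beta>]
    have pr: "fst (x \<otimes>\<^bsub>RDirProd F G\<^esub> y) = fst x \<otimes>\<^bsub>F\<^esub> fst y" "snd (x \<otimes>\<^bsub>RDirProd F G\<^esub> y) = snd x \<otimes>\<^bsub>G\<^esub> snd y"
      "fst (x \<oplus>\<^bsub>RDirProd F G\<^esub> y) = fst x \<oplus>\<^bsub>F\<^esub> fst y" "snd (x \<oplus>\<^bsub>RDirProd F G\<^esub> y) = snd x \<oplus>\<^bsub>G\<^esub> snd y" for x y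
      by (cases x; cases y; simp)+
    show "(fst \<circ> \<beta>) \<in> ring_hom R F" "(snd \<circ> \<beta>) \<in> ring_hom R G"
      by (rule ring_hom_memI; use I(1) in \<open>fastforce simp: I(2,3,4) pr\<close>)+
    show "bij_betw (\<lambda>x. ((fst \<circ> \<beta>) x, (snd \<circ> \<beta>) x)) (carrier R) (carrier F \<times> carrier G)"
      using I(5) by simp
  qed
  show "W R = W F * W G" if "R \<in> ring_structs (Q * M)" "(\<beta>, F, G) \<in> splittings Q M R"
  proof -
    have "\<beta> \<in> ring_iso R (RDirProd F G)" "cring F" "cring G" "cring R"
      using that by (auto simp: splittings_def field_structs_def ring_structs_eq normal_cringsD)
    then show ?thesis using W_prod hom by blast
  qed
  show "?U = ?T"
  proof (intro equalityI subsetI)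
    fix d assume "d \<in> ?T"
    then obtain \<beta> F G where d: "d = (\<beta>, F, G)" "\<beta> \<in> bijections {..<Q * M} ({..<Q} \<times> {..<M})"
      "F \<in> field_structs Q" "G \<in> ring_structs M" by auto
    have F: "F \<in> normal_crings Q" "field F" and G: "G \<in> normal_crings M" "fin_semisimple G"
      using d by (auto simp: field_structs_def ring_structs_eq)
    have "bij_betw \<beta> {..<Q * M} (carrier (RDirProd F G))"
      using d(2) normal_cringsD(2)[OF F(1)] normal_cringsD(2)[OF G(1)] by (simp add: bijections_def)
    then obtain R where R: "R \<in> normal_crings (Q * M)" "\<beta> \<in> ring_iso R (RDirProd F G)"
      using ex1_normal_cring[OF cring_RDirProd[OF normal_cringsD(1)[OF F(1)] normal_cringsD(1)[OF G(1)]]] by blast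
    have "fin_semisimple R"
      by (rule fin_semisimple_prod[OF normal_cringsD(1)[OF R(1)] F(2) _ G(2) hom[OF R(2)]])
        (use normal_cringsD(2)[OF F(1)] in simp)
    then have "R \<in> ring_structs (Q * M)" using R(1) by (simp add: ring_structs_eq)
    moreover have "d \<in> splittings Q M R"
      using d R normal_cringsD(2)[OF R(1)] by (simp add: splittings_def)
    ultimately show "d \<in> ?U" by blast
  next
    fix d assume "d \<in> ?U"
    then show "d \<in> ?T" by (auto simp: splittings_def ring_structs_eq normal_cringsD)
  qed
qed

text \<open>The weight \<open>W F * W G\<close> is constant on the splittings of one R. Splittings
  of different R are disjoint because \<open>\<beta>\<close>, F and G determine R, and their union
  is a full product, so the sum factors.\<close>

lemma sum_card_splittings:
  assumes QM: "Q > 0" "M > 0"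
  shows "(\<Sum>R\<in>ring_structs (Q * M). W R * card (splittings Q M R)) =
    fact (Q * M) * ((\<Sum>F\<in>field_structs Q. W F) * (\<Sum>G\<in>ring_structs M. W G))"
proof -
  let ?B = "bijections {..<Q * M} ({..<Q} \<times> {..<M})"
  let ?w = "\<lambda>(\<beta> :: nat \<Rightarrow> nat \<times> nat, F, G). W F * W G"
  have B: "finite ?B" "card ?B = fact (Q * M)"
    using card_bijections[of "{..<Q * M}" "{..<Q} \<times> {..<M}"] by (simp_all add: card_cartesian_product)
  have fin: "finite (splittings Q M R)" if "R \<in> ring_structs (Q * M)" for R
  proof (rule finite_subset)
    show "splittings Q M R \<subseteq> ?B \<times> field_structs Q \<times> ring_structs M"
      using splittings_cover(1)[of Q M] that by blast
    show "finite (?B \<times> field_structs Q \<times> ring_structs M)" using B finite_ring_structs by simp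
  qed
  have "(\<Sum>R\<in>ring_structs (Q * M). W R * card (splittings Q M R)) =
     (\<Sum>R\<in>ring_structs (Q * M). \<Sum>d\<in>splittings Q M R. ?w d)"
  proof (rule sum.cong[OF refl])
    fix R assume R: "R \<in> ring_structs (Q * M)"
    have "(\<Sum>d\<in>splittings Q M R. ?w d) = (\<Sum>d\<in>splittings Q M R. W R)"
      by (rule sum.cong[OF refl]) (use splittings_cover(2)[OF R] in auto)
    then show "W R * card (splittings Q M R) = (\<Sum>d\<in>splittings Q M R. ?w d)" by simp
  qed
  also have "\<dots> = (\<Sum>d\<in>(\<Union>R\<in>ring_structs (Q * M). splittings Q M R). ?w d)"
  proof (rule sum.UNION_disjoint[symmetric])
    show "finite (ring_structs (Q * M))" by (rule finite_ring_structs)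
    show "\<forall>R\<in>ring_structs (Q * M). finite (splittings Q M R)" using fin by blast
    show "\<forall>R\<in>ring_structs (Q * M). \<forall>R'\<in>ring_structs (Q * M). R \<noteq> R' \<longrightarrow> splittings Q M R \<inter> splittings Q M R' = {}"
    proof (intro ballI impI)
      fix R R' assume R: "R \<in> ring_structs (Q * M)" "R' \<in> ring_structs (Q * M)" "R \<noteq> R'"
      have "R = R'" if "(\<beta>, F, G) \<in> splittings Q M R" "(\<beta>, F, G) \<in> splittings Q M R'" for \<beta> F G
        by (rule normal_crings_iso_unique[of R "Q * M" R' "RDirProd F G" \<beta>])
          (use R that in \<open>auto simp: splittings_def field_structs_def ring_structs_eq normal_cringsD intro!: cring_RDirProd\<close>)
      then show "splittings Q M R \<inter> splittings Q M R' = {}" using R(3) by auto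
    qed
  qed
  also have "\<dots> = (\<Sum>\<beta>\<in>?B. \<Sum>F\<in>field_structs Q. \<Sum>G\<in>ring_structs M. W F * W G)"
    unfolding splittings_cover(1) by (simp only: sum.cartesian_product)
  also have "\<dots> = fact (Q * M) * ((\<Sum>F\<in>field_structs Q. W F) * (\<Sum>G\<in>ring_structs M. W G))"
    by (simp add: B(2) sum_product)
  finally show ?thesis .
qed

text \<open>All field structures on p^n points are isomorphic and so share one weight, and there are
  (p^n)!/n of them.\<close>

lemma field_mass_prime_power:
  assumes p: "Factorial_Ring.prime p" "n \<ge> 1" and F0: "field F0" "finite (carrier F0)" "card (carrier F0) = p ^ n"
  shows "field_mass (p ^ n) = real (W F0) / real n"
proof -
  have "W F = W F0" if F: "F \<in> field_structs (p ^ n)" for F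
  proof -
    have F': "field F" "carrier F = {..<p ^ n}" using F normal_cringsD by (auto simp: field_structs_def)
    then obtain f where "f \<in> ring_iso F F0" using finite_field_iso[OF F'(1) _ F0(1,2)] F0(3) by auto
    then show ?thesis using W_iso F'(1) F0(1) by (auto simp: field_def domain_def)
  qed
  then have "field_mass (p ^ n) = real (card (field_structs (p ^ n)) * W F0) / fact (p ^ n)"
    by (simp add: field_mass_def)
  also have "fact (p ^ n) = (real (card (field_structs (p ^ n))) * real n :: real)"
    using card_field_structs[OF p F0] by (metis of_nat_fact of_nat_mult)
  finally have "field_mass (p ^ n) = real (card (field_structs (p ^ n))) * real (W F0) / (real (card (field_structs (p ^ n))) * real n)"
    by simp
  moreover have "card (field_structs (p ^ n)) \<noteq> 0" using card_field_structs[OF p F0] by (metis fact_nonzero mult_0)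
  ultimately show ?thesis by simp
qed

lemma field_mass_eq_0:
  assumes "\<And>p n. Factorial_Ring.prime p \<Longrightarrow> n \<ge> 1 \<Longrightarrow> Q \<noteq> p ^ n"
  shows "field_mass Q = 0"
proof -
  have "field_structs Q = {}" using assms field_structs_prime_power by (metis equals0I)
  then show ?thesis by (simp add: field_mass_def)
qed

lemma ring_mass_1: "ring_mass 1 = 1"
proof -
  obtain R where R: "ring_structs 1 = {R}" using ring_structs_1 by blast
  then have "R \<in> normal_crings 1" by (auto simp: ring_structs_eq)
  then have "W R = 1" using W_trivial[of R] normal_cringsD[of R 1] by simp
  then show ?thesis unfolding ring_mass_def R by simp
qed

text \<open>For each ring, ln N is replaced by the sum over its field idempotents, grouped by corner
  size Q. After the sums are exchanged, each Q contributes a double count of splittings.\<close>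

lemma ring_mass_recurrence:
  assumes N: "N \<ge> 1"
  shows "ln (real N) * ring_mass N = (\<Sum>Q\<in>{d. d dvd N}. ln (real Q) * field_mass Q * ring_mass (N div Q))"
proof -
  let ?D = "{d. d dvd N}"
  have finD: "finite ?D" using N by simp
  let ?c = "\<lambda>R Q. card {e \<in> field_idems R. card (carrier (corner R e)) = Q}"
  have ln: "ln (real N) = (\<Sum>Q\<in>?D. ln (real Q) * real (?c R Q))" if R: "R \<in> ring_structs N" for R
  proof -
    have R': "fin_semisimple R" "carrier R = {..<N}" "cring R"
      using R by (auto simp: ring_structs_eq normal_cringsD)
    interpret cring R by (rule R'(3))
    note s = sum_ln_card_corner[OF R'(1)]
    \<comment> \<open>Corner sizes divide N by the Peirce decomposition, so grouping over the
      divisors misses no idempotent.\<close>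
    have dv: "card (carrier (corner R e)) dvd N" if "e \<in> field_idems R" for e
    proof -
      have "e \<in> carrier R" "e \<otimes>\<^bsub>R\<^esub> e = e" using that by (auto simp: field_idems_def)
      from bij_betw_same_card[OF corner_bij[OF this]]
      show ?thesis using R'(2) by (simp add: card_cartesian_product)
    qed
    have "ln (real N) = (\<Sum>e\<in>field_idems R. ln (real (card (carrier (corner R e)))))"
      using s(2) R'(2) by simp
    also have "\<dots> = (\<Sum>Q\<in>?D. \<Sum>e\<in>{e \<in> field_idems R. card (carrier (corner R e)) = Q}. ln (real (card (carrier (corner R e)))))"
      by (rule sum.group[symmetric, OF s(1) finD]) (use dv in auto)
    also have "\<dots> = (\<Sum>Q\<in>?D. ln (real Q) * real (?c R Q))"
      by (rule sum.cong[OF refl]) simp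
    finally show ?thesis .
  qed
  have count: "(\<Sum>R\<in>ring_structs N. real (W R) * real (?c R Q)) = fact N * (field_mass Q * ring_mass (N div Q))"
    if Q: "Q \<in> ?D" for Q
  proof -
    obtain M where M: "N = Q * M" using Q by auto
    then have pos: "Q > 0" "M > 0" using N by (auto intro!: Nat.gr0I)
    \<comment> \<open>Each such idempotent accounts for Q! M! splittings, the labellings of its two
      corners; these factorials become the denominators of the two masses.\<close>
    have "real (W R) * real (?c R Q) = real (W R * card (splittings Q M R)) / (fact Q * fact M)"
      if "R \<in> ring_structs N" for R
    proof -
      have R': "fin_semisimple R" "carrier R = {..<N}" using that by (auto simp: ring_structs_eq normal_cringsD)
      have "card (splittings Q M R) = ?c R Q * (fact Q * fact M)"
        by (rule card_splittings) (use R' M pos in auto)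
      then show ?thesis by simp
    qed
    then have "(\<Sum>R\<in>ring_structs N. real (W R) * real (?c R Q)) =
       (\<Sum>R\<in>ring_structs N. real (W R * card (splittings Q M R)) / (fact Q * fact M))"
      by (rule sum.cong[OF refl])
    also have "\<dots> = real (\<Sum>R\<in>ring_structs N. W R * card (splittings Q M R)) / (fact Q * fact M)"
      by (simp add: sum_divide_distrib)
    also have "\<dots> = fact N * (field_mass Q * ring_mass M)"
      unfolding M sum_card_splittings[OF pos] by (simp add: field_mass_def ring_mass_def del: of_nat_sum)
    finally show ?thesis using M pos by simp
  qed
  have "fact N * (ln (real N) * ring_mass N) = real (\<Sum>R\<in>ring_structs N. W R) * ln (real N)"
    by (simp add: ring_mass_def del: of_nat_sum)
  also have "\<dots> = (\<Sum>R\<in>ring_structs N. real (W R) * ln (real N))"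
    by (simp add: sum_distrib_right)
  also have "\<dots> = (\<Sum>R\<in>ring_structs N. real (W R) * (\<Sum>Q\<in>?D. ln (real Q) * real (?c R Q)))"
    by (rule sum.cong[OF refl]) (use ln in simp)
  also have "\<dots> = (\<Sum>R\<in>ring_structs N. \<Sum>Q\<in>?D. ln (real Q) * (real (W R) * real (?c R Q)))"
    by (simp add: sum_distrib_left mult.left_commute)
  also have "\<dots> = (\<Sum>Q\<in>?D. \<Sum>R\<in>ring_structs N. ln (real Q) * (real (W R) * real (?c R Q)))"
    by (rule sum.swap)
  also have "\<dots> = (\<Sum>Q\<in>?D. ln (real Q) * (fact N * (field_mass Q * ring_mass (N div Q))))"
    by (rule sum.cong[OF refl]) (simp only: sum_distrib_left[symmetric] count)
  also have "\<dots> = fact N * (\<Sum>Q\<in>?D. ln (real Q) * field_mass Q * ring_mass (N div Q))"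
    by (simp add: sum_distrib_left mult_ac)
  finally show ?thesis by simp
qed

end

section \<open>Formal Dirichlet series\<close>

text \<open>Summing over factor pairs makes the symmetry visible, so that commutativity and
  associativity become reindexings.\<close>

lemma dmult_altdef:
  assumes "N \<ge> 1"
  shows "dmult f g N = (\<Sum>(a, b)\<in>{(a, b). a * b = N}. f a * g b)"
proof -
  have "(\<Sum>(a, b)\<in>{(a, b). a * b = N}. f a * g b) = (\<Sum>d\<in>{d. d dvd N}. f d * g (N div d))"
    by (rule sum.reindex_bij_witness[of _ "\<lambda>d. (d, N div d)" fst]) (use assms in auto)
  then show ?thesis using assms by (simp add: dmult_def)
qed

lemma dmult_cong:
  assumes "\<And>d. d \<ge> 1 \<Longrightarrow> d dvd N \<Longrightarrow> f d = f' d" "\<And>d. d \<ge> 1 \<Longrightarrow> d dvd N \<Longrightarrow> g d = g' d"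
  shows "dmult f g N = dmult f' g' N"
proof (cases "N = 0")
  case False
  have "f d * g (N div d) = f' d * g' (N div d)" if "d dvd N" for d
  proof -
    have "d \<ge> 1" "N div d \<ge> 1" "N div d dvd N"
      using that False by (auto simp: Suc_le_eq dvd_div_eq_0_iff intro!: Nat.gr0I)
    then show ?thesis using assms that by simp
  qed
  then show ?thesis using False by (simp add: dmult_def)
qed (simp add: dmult_def)

lemma dmult_commute: "dmult f g = dmult g f"
proof
  fix N show "dmult f g N = dmult g f N"
  proof (cases "N \<ge> 1")
    case True
    have "(\<Sum>(a, b)\<in>{(a, b). a * b = N}. f a * g b) = (\<Sum>(a, b)\<in>{(a, b). a * b = N}. g a * f b)"
      by (rule sum.reindex_bij_witness[of _ prod.swap prod.swap]) (auto simp: mult.commute)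
    then show ?thesis using True by (simp add: dmult_altdef)
  qed (simp add: dmult_def)
qed

lemma finite_factor_pairs: "(N::nat) \<ge> 1 \<Longrightarrow> finite {(a, b). a * b = N}"
proof (rule finite_subset)
  show "N \<ge> 1 \<Longrightarrow> {(a, b). a * b = N} \<subseteq> {..N} \<times> {..N}"
    by (auto intro: dvd_imp_le)
qed simp

lemma dmult_assoc: "dmult (dmult f g) h = dmult f (dmult g h)"
proof
  fix N show "dmult (dmult f g) h N = dmult f (dmult g h) N"
  proof (cases "N \<ge> 1")
    case True
    have ge: "fst p \<ge> 1" "snd p \<ge> 1" if "p \<in> {(a, b). a * b = N}" for p
      using that True by (auto simp: Suc_le_eq intro!: Nat.gr0I)
    have "dmult (dmult f g) h N = (\<Sum>p\<in>{(a, b). a * b = N}. \<Sum>q\<in>{(a, b). a * b = fst p}. f (fst q) * g (snd q) * h (snd p))"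
      unfolding dmult_altdef[OF True]
      by (rule sum.cong[OF refl]) (use ge in \<open>auto simp: dmult_altdef sum_distrib_right split_def\<close>)
    also have "\<dots> = (\<Sum>(p, q)\<in>(SIGMA p:{(a, b). a * b = N}. {(a, b). a * b = fst p}). f (fst q) * g (snd q) * h (snd p))"
      by (rule sum.Sigma) (rule finite_factor_pairs[OF True], intro ballI finite_factor_pairs ge)
    also have "\<dots> = (\<Sum>(p, q)\<in>(SIGMA p:{(a, b). a * b = N}. {(a, b). a * b = snd p}). f (fst p) * (g (fst q) * h (snd q)))"
      by (rule sum.reindex_bij_witness[of _ "\<lambda>((a, b), (c, d)). ((a * c, d), (a, c))" "\<lambda>((a, b), (c, d)). ((c, d * b), (d, b))"])
        (auto simp: mult_ac)
    also have "\<dots> = (\<Sum>p\<in>{(a, b). a * b = N}. \<Sum>q\<in>{(a, b). a * b = snd p}. f (fst p) * (g (fst q) * h (snd q)))"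
      by (rule sum.Sigma[symmetric]) (rule finite_factor_pairs[OF True], intro ballI finite_factor_pairs ge)
    also have "\<dots> = dmult f (dmult g h) N"
      unfolding dmult_altdef[OF True]
      by (rule sum.cong[OF refl]) (use ge in \<open>auto simp: dmult_altdef sum_distrib_left split_def\<close>)
    finally show ?thesis .
  qed (simp add: dmult_def)
qed

lemma dmult_add_left: "dmult (\<lambda>n. f n + g n) h N = dmult f h N + dmult g h N"
  by (simp add: dmult_def distrib_right sum.distrib)

lemma dmult_sum_right: "dmult f (\<lambda>n. \<Sum>m\<in>A. c m * g m n) N = (\<Sum>m\<in>A. c m * dmult f (g m) N)"
proof -
  have "(\<Sum>d | d dvd N. f d * (\<Sum>m\<in>A. c m * g m (N div d))) = (\<Sum>m\<in>A. c m * (\<Sum>d | d dvd N. f d * g m (N div d)))"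
    unfolding sum_distrib_left by (subst sum.swap) (simp add: mult_ac)
  then show ?thesis by (simp add: dmult_def)
qed

text \<open>Minus the formal derivative with respect to \<open>s\<close>.\<close>
definition dderiv :: "(nat \<Rightarrow> real) \<Rightarrow> nat \<Rightarrow> real" where
  "dderiv f n = ln (real n) * f n"

text \<open>The Leibniz rule holds because ln (a * b) = ln a + ln b for positive factors.\<close>

lemma dderiv_dmult:
  "dderiv (dmult f g) N = dmult (dderiv f) g N + dmult f (dderiv g) N"
proof (cases "N \<ge> 1")
  case True
  have "ln (real N) * (f a * g b) = ln (real a) * f a * g b + f a * (ln (real b) * g b)" if "a * b = N" for a b
  proof -
    have "a > 0" "b > 0" using that True by (auto intro!: Nat.gr0I)
    then have "ln (real N) = ln (real a) + ln (real b)" using that by (auto simp: ln_mult)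
    then show ?thesis by (simp add: algebra_simps)
  qed
  then have "(\<Sum>p\<in>{(a, b). a * b = N}. ln (real N) * (f (fst p) * g (snd p))) =
     (\<Sum>p\<in>{(a, b). a * b = N}. ln (real (fst p)) * f (fst p) * g (snd p) + f (fst p) * (ln (real (snd p)) * g (snd p)))"
    by (intro sum.cong) auto
  then show ?thesis
    using True by (simp add: dmult_altdef dderiv_def sum_distrib_left sum.distrib split_def)
next
  case False
  then show ?thesis by (simp add: dmult_def dderiv_def)
qed

text \<open>Writing the logarithmic derivative as a product avoids inverting a series. Index 0 is
  not a coefficient of a Dirichlet series, hence N \<ge> 1.\<close>

definition has_log_deriv :: "(nat \<Rightarrow> real) \<Rightarrow> (nat \<Rightarrow> real) \<Rightarrow> bool" where
  "has_log_deriv g h \<longleftrightarrow> (\<forall>N\<ge>1. dderiv g N = dmult h g N)"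

lemma dderiv_dunit: "dderiv dunit n = 0"
  by (simp add: dderiv_def dunit_def)

lemma has_log_deriv_dunit: "has_log_deriv dunit (\<lambda>_. 0)"
  by (auto simp: has_log_deriv_def dderiv_def dunit_def dmult_def)

lemma has_log_deriv_dmult:
  assumes "has_log_deriv g h" "has_log_deriv g' h'"
  shows "has_log_deriv (dmult g g') (\<lambda>n. h n + h' n)"
  unfolding has_log_deriv_def
proof (intro allI impI)
  fix N :: nat assume N: "N \<ge> 1"
  have "dderiv (dmult g g') N = dmult (dderiv g) g' N + dmult g (dderiv g') N"
    by (rule dderiv_dmult)
  also have "dmult (dderiv g) g' N = dmult (dmult h g) g' N"
    by (rule dmult_cong) (use assms in \<open>auto simp: has_log_deriv_def\<close>)
  also have "dmult g (dderiv g') N = dmult g (dmult h' g') N"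
    by (rule dmult_cong) (use assms in \<open>auto simp: has_log_deriv_def\<close>)
  also have "dmult g (dmult h' g') = dmult h' (dmult g g')"
    by (metis dmult_assoc dmult_commute)
  finally show "dderiv (dmult g g') N = dmult (\<lambda>n. h n + h' n) (dmult g g') N"
    by (simp add: dmult_assoc dmult_add_left)
qed

lemma has_log_deriv_prod:
  assumes "\<And>p. p \<in> set ps \<Longrightarrow> has_log_deriv (E p) (h p)"
  shows "has_log_deriv (foldr dmult (map E ps) dunit) (\<lambda>n. \<Sum>p\<leftarrow>ps. h p n)"
  using assms
proof (induction ps)
  case Nil
  then show ?case by (simp add: has_log_deriv_dunit)
next
  case (Cons p ps)
  then show ?case using has_log_deriv_dmult[of "E p" "h p"] by simp
qed

text \<open>Since \<open>h 1 = 0\<close>, the right side of the recurrence involves \<open>g\<close>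
  only at proper divisors of N, and ln N is nonzero for N > 1; so the coefficients are determined
  successively. The cutoff K is there because a partial Euler product matches the zeta series only
  up to a bound.\<close>

lemma has_log_deriv_unique:
  assumes g: "has_log_deriv g h" and g': "has_log_deriv g' h'" and one: "g 1 = g' 1" "h 1 = 0"
    and h: "\<And>d. 1 \<le> d \<Longrightarrow> d \<le> K \<Longrightarrow> h d = h' d"
    and N: "1 \<le> N" "N \<le> K"
  shows "g N = g' N"
  using N
proof (induction N rule: less_induct)
  case (less N)
  show ?case
  proof (cases "N = 1")
    case True
    then show ?thesis using one by simp
  next
    case False
    then have N2: "N > 1" using less.prems by simp
    have "dmult h g N = dmult h' g' N"
      unfolding dmult_def
    proof (simp add: N2 less_imp_neq[OF N2, symmetric], rule impI, rule sum.cong[OF refl])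
      fix d assume "d \<in> {d. d dvd N}"
      then have d: "d dvd N" "1 \<le> d" "d \<le> N" using N2 by (auto simp: Suc_le_eq intro!: Nat.gr0I dvd_imp_le)
      show "h d * g (N div d) = h' d * g' (N div d)"
      proof (cases "d = 1")
        case True
        then show ?thesis using h[of 1] one(2) less.prems d by simp
      next
        case False
        then have "N div d < N" "1 \<le> N div d" using d N2 by (auto simp: Suc_le_eq div_greater_zero_iff)
        then show ?thesis using less.IH[of "N div d"] h[of d] d less.prems by simp
      qed
    qed
    then have "ln (real N) * g N = ln (real N) * g' N"
      using g g' less.prems by (simp add: has_log_deriv_def dderiv_def)
    then show ?thesis using N2 by simp
  qed
qed

section \<open>Powers and exponentials of Dirichlet series\<close>

lemma dpow_0 [simp]: "dpow f 0 = dunit" and dpow_Suc: "dpow f (Suc m) = dmult f (dpow f m)"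
  by (simp_all add: dpow_def)

text \<open>Without a constant term every factor has index at least 2, so the m-th power starts no
  earlier than index 2^m.\<close>

lemma dpow_eq_0:
  assumes "f 1 = 0" "N < 2 ^ m" "N \<ge> 1"
  shows "dpow f m N = 0"
  using assms(2,3)
proof (induction m arbitrary: N)
  case (Suc m)
  have "f d * dpow f m (N div d) = 0" if "d dvd N" for d
  proof (cases "d = 1")
    case False
    have "d > 0" using that Suc.prems by (auto intro!: Nat.gr0I)
    then have d: "d \<ge> 2" using False by simp
    have "N div d \<le> N div 2" using d by (rule div_le_mono2[rotated]) simp
    also have "\<dots> < 2 ^ m" using Suc.prems by simp
    finally have "N div d < 2 ^ m" .
    moreover have "N div d \<ge> 1" using that Suc.prems \<open>d > 0\<close>
      by (auto simp: Suc_le_eq div_greater_zero_iff intro: dvd_imp_le)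
    ultimately show ?thesis using Suc.IH by simp
  qed (use assms(1) in simp)
  then have "(\<Sum>d | d dvd N. f d * dpow f m (N div d)) = 0" by (intro sum.neutral) simp
  then show ?case by (simp add: dpow_Suc dmult_def)
qed simp

text \<open>The cutoff K may exceed N, so that one finite sum serves all divisors of a number
  simultaneously.\<close>

lemma dexp_eq_sum:
  assumes "f 1 = 0" "1 \<le> N" "N \<le> K"
  shows "dexp f N = (\<Sum>m\<le>K. dpow f m N / fact m)"
  unfolding dexp_def
proof (rule suminf_finite)
  fix m assume "m \<notin> {..K}"
  then have "N < m" using assms(3) by simp
  also have "m < 2 ^ m" by (rule less_exp)
  finally show "dpow f m N / fact m = 0" using dpow_eq_0[of f N m] assms by simp
qed simp

lemma dderiv_dpow:
  assumes "N \<ge> 1"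
  shows "dderiv (dpow f (Suc m)) N = real (Suc m) * dmult (dderiv f) (dpow f m) N"
  using assms
proof (induction m arbitrary: N)
  case 0
  have "dmult f (dderiv dunit) N = 0" by (simp add: dmult_def dderiv_dunit)
  then show ?case using dderiv_dmult[of f dunit N] by (simp add: dpow_Suc)
next
  case (Suc m)
  have "dderiv (dpow f (Suc (Suc m))) N
      = dmult (dderiv f) (dpow f (Suc m)) N + dmult f (dderiv (dpow f (Suc m))) N"
    by (subst dpow_Suc) (rule dderiv_dmult)
  \<comment> \<open>The sum over the one-point set \<open>{()}\<close> merely puts the scalar into
    the shape expected by \<open>dmult_sum_right\<close>.\<close>
  also have "dmult f (dderiv (dpow f (Suc m))) N = dmult f (\<lambda>n. \<Sum>i\<in>{()}. real (Suc m) * dmult (dderiv f) (dpow f m) n) N"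
    by (rule dmult_cong) (use Suc.IH in auto)
  also have "\<dots> = real (Suc m) * dmult f (dmult (dderiv f) (dpow f m)) N"
    by (subst dmult_sum_right) simp
  also have "dmult f (dmult (dderiv f) (dpow f m)) = dmult (dderiv f) (dpow f (Suc m))"
    unfolding dpow_Suc by (metis dmult_assoc dmult_commute)
  finally show ?case by (simp add: algebra_simps)
qed

text \<open>Differentiation lowers each power by one and turns 1/m! into 1/(m-1)!, which reproduces
  the exponential series.\<close>

lemma has_log_deriv_dexp:
  assumes "f 1 = 0"
  shows "has_log_deriv (dexp f) (dderiv f)"
  unfolding has_log_deriv_def
proof (intro allI impI)
  fix N :: nat assume N: "N \<ge> 1"
  \<comment> \<open>Summing up to \<open>Suc N\<close> leaves, after the index shift, a sum up to N,
    which is again a valid cutoff for all divisors of N.\<close>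
  have "dderiv (dexp f) N = (\<Sum>m\<le>Suc N. dderiv (dpow f m) N / fact m)"
    using dexp_eq_sum[where f = f and N = N and K = "Suc N", OF assms N] by (simp add: dderiv_def sum_distrib_left del: sum.atMost_Suc fact_Suc)
  also have "\<dots> = dderiv dunit N + (\<Sum>m\<le>N. dderiv (dpow f (Suc m)) N / fact (Suc m))"
    by (subst sum.atMost_Suc_shift) simp
  also have "dderiv dunit N = 0" by (simp add: dderiv_def dunit_def)
  also have "(\<Sum>m\<le>N. dderiv (dpow f (Suc m)) N / fact (Suc m)) = (\<Sum>m\<le>N. (1 / fact m) * dmult (dderiv f) (dpow f m) N)"
    by (rule sum.cong[OF refl]) (simp add: dderiv_dpow[OF N] field_simps del: of_nat_Suc)
  also have "\<dots> = dmult (dderiv f) (\<lambda>n. \<Sum>m\<le>N. (1 / fact m) * dpow f m n) N"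
    by (rule dmult_sum_right[symmetric])
  also have "\<dots> = dmult (dderiv f) (dexp f) N"
    by (rule dmult_cong) (use N assms in \<open>auto simp: dexp_eq_sum[where K = N] dvd_imp_le\<close>)
  finally show "dderiv (dexp f) N = dmult (dderiv f) (dexp f) N" by simp
qed

lemma dexp_1:
  assumes "f 1 = 0"
  shows "dexp f 1 = 1"
  using dexp_eq_sum[where f = f and N = 1 and K = 1, OF assms] dpow_eq_0[where f = f and N = 1 and m = 1, OF assms] by (simp add: dunit_def)

lemma dmult_1: "dmult f g 1 = f 1 * g 1"
  by (simp add: dmult_def)

lemma foldr_dmult_1:
  assumes "\<And>p. p \<in> set ps \<Longrightarrow> E p 1 = 1"
  shows "foldr dmult (map E ps) dunit 1 = 1"
  using assms
proof (induction ps)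
  case Nil
  then show ?case by (simp add: dunit_def)
next
  case (Cons p ps)
  then show ?case using dmult_1[of "E p" "foldr dmult (map E ps) dunit"] by simp
qed

section \<open>The zeta species\<close>

text \<open>Inherited from \<^theory>\<open>HOL-Algebra.Polynomials\<close>, this notation makes \<open>X\<close> unusable as a variable.\<close>
no_notation Polynomials.var (\<open>X\<index>\<close>)

text \<open>A functor sends isomorphisms to bijections. The composites with the inverse equal the
  identity only on the carriers, which is where the identification of morphisms agreeing there
  enters.\<close>

lemma multiplicative_weight_card:
  assumes "is_functor X Xm" "multiplicative X Xm"
  shows "multiplicative_weight (\<lambda>R. card (X R))"
proof
  have map: "Xm A B f x \<in> X B" if "cring A" "cring B" "f \<in> ring_hom A B" "x \<in> X A" for A B f x
    using assms(1) that unfolding is_functor_def by blast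
  have map_id: "Xm A A id x = x" if "cring A" "x \<in> X A" for A x
    using assms(1) that unfolding is_functor_def by blast
  have map_cong: "Xm A B f x = Xm A B g x"
    if "cring A" "cring B" "f \<in> ring_hom A B" "g \<in> ring_hom A B" "\<And>a. a \<in> carrier A \<Longrightarrow> f a = g a" "x \<in> X A"
    for A B f g x
    using assms(1)[unfolded is_functor_def, THEN conjunct2, THEN conjunct2, THEN conjunct1, rule_format, of A B f g x]
      that by simp
  have map_comp: "Xm B C g (Xm A B f x) = Xm A C (g \<circ> f) x"
    if "cring A" "cring B" "cring C" "f \<in> ring_hom A B" "g \<in> ring_hom B C" "x \<in> X A" for A B C f g x
    using assms(1)[unfolded is_functor_def, THEN conjunct2, THEN conjunct2, THEN conjunct2, rule_format, of A B C f g x]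
      that by simp
  have inverse: "Xm B A g (Xm A B f x) = x"
    if "cring A" "cring B" "f \<in> ring_hom A B" "g \<in> ring_hom B A" "\<And>a. a \<in> carrier A \<Longrightarrow> g (f a) = a" "x \<in> X A"
    for A B f g x
  proof -
    have "Xm B A g (Xm A B f x) = Xm A A (g \<circ> f) x" using map_comp that by blast
    also have "\<dots> = Xm A A id x"
      by (rule map_cong) (use that ring_hom_trans[OF that(3,4)] in \<open>auto simp: ring_hom_def\<close>)
    also have "\<dots> = x" using map_id that by blast
    finally show ?thesis .
  qed
  fix A B :: "nat ring" and f
  assume AB: "cring A" "cring B" "f \<in> ring_iso A B"
  let ?g = "inv_into (carrier A) f"
  have g: "?g \<in> ring_iso B A" using ring_iso_inv[OF AB(1,3)] .
  then have fg: "f \<in> ring_hom A B" "?g \<in> ring_hom B A" using AB(3) by (auto simp: ring_iso_def)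
  have b: "bij_betw f (carrier A) (carrier B)" using AB(3) by (simp add: ring_iso_def)
  have 1: "Xm B A ?g (Xm A B f x) = x" if "x \<in> X A" for x
    by (rule inverse[OF AB(1,2) fg _ that]) (rule bij_betw_inv_into_left[OF b])
  have 2: "Xm A B f (Xm B A ?g x) = x" if "x \<in> X B" for x
    by (rule inverse[OF AB(2,1) fg(2,1) _ that]) (rule bij_betw_inv_into_right[OF b])
  have "bij_betw (Xm A B f) (X A) (X B)"
    by (rule bij_betw_byWitness[where f' = "Xm B A ?g"]) (use 1 2 map[OF AB(1,2) fg(1)] map[OF AB(2,1) fg(2)] in blast)+
  then show "card (X A) = card (X B)" by (rule bij_betw_same_card)
next
  fix A B C :: "nat ring" and p q
  assume "cring A" "cring B" "cring C" "p \<in> ring_hom C A" "q \<in> ring_hom C B"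
    "bij_betw (\<lambda>c. (p c, q c)) (carrier C) (carrier A \<times> carrier B)"
  then have "bij_betw (\<lambda>x. (Xm C A p x, Xm C B q x)) (X C) (X A \<times> X B)"
    using assms(2) unfolding multiplicative_def by blast
  from bij_betw_same_card[OF this] show "card (X C) = card (X A) * card (X B)" by (simp add: card_cartesian_product)
next
  fix C :: "nat ring" assume "cring C" "card (carrier C) = 1"
  then have "\<exists>!x. x \<in> X C" using assms(2) unfolding multiplicative_def by blast
  then show "card (X C) = 1" by (simp add: card_1_singleton_iff) blast
qed

lemma GF_props:
  assumes "Factorial_Ring.prime p" "n \<ge> 1"
  shows "field (GF p n)" "finite (carrier (GF p n))" "card (carrier (GF p n)) = p ^ n"
  using someI_ex[OF exists_finite_field[OF assms]] unfolding GF_def by auto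

text \<open>A prime power determines its prime and its exponent, so the sum defining the series has
  at most one term.\<close>

lemma local_series_prime_power:
  assumes "Factorial_Ring.prime p" "Factorial_Ring.prime q" "n \<ge> 1"
  shows "local_series X q (p ^ n) = (if q = p then real (card (X (GF p n))) / real n else 0)"
proof -
  have "{k. 1 \<le> k \<and> q ^ k = p ^ n} = (if q = p then {n} else {})"
    using assms by (auto dest: prime_power_inj'' intro: prime_power_inj simp: prime_power_inj'')
  then show ?thesis by (simp add: local_series_def)
qed

lemma local_series_eq_0:
  assumes "\<And>n. n \<ge> 1 \<Longrightarrow> N \<noteq> p ^ n"
  shows "local_series X p N = 0"
proof -
  have "{n. 1 \<le> n \<and> p ^ n = N} = {}" using assms by auto
  then show ?thesis by (simp only: local_series_def sum.empty)
qed

theorem theorem5p1: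
  fixes X :: "nat ring \<Rightarrow> 'x set"
    and Xm :: "nat ring \<Rightarrow> nat ring \<Rightarrow> (nat \<Rightarrow> nat) \<Rightarrow> 'x \<Rightarrow> 'x"
  assumes "is_functor X Xm" and "tame X" and "multiplicative X Xm"
  shows "\<forall>N\<ge>1. zeta_coeff X N = euler_prod (\<lambda>p. dexp (local_series X p)) N"
proof (intro allI impI)
  fix N :: nat assume N: "N \<ge> 1"
  interpret multiplicative_weight "\<lambda>R. card (X R)" using multiplicative_weight_card[OF assms(1,3)] .
  \<comment> \<open>Tameness makes the fibres finite, so the cardinality of the disjoint union is
    the sum of the |X(R)|.\<close>
  have zeta: "zeta_coeff X n = ring_mass n" if "n \<ge> 1" for n
  proof -
    have "finite (X R)" if "R \<in> ring_structs n" for R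
      using assms(2) that by (simp add: tame_def ring_structs_def)
    then have "card (SIGMA R:ring_structs n. X R) = (\<Sum>R\<in>ring_structs n. card (X R))"
      by (intro card_SigmaI finite_ring_structs) auto
    then show ?thesis using that by (simp add: zeta_coeff_def ring_mass_def)
  qed
  let ?E = "\<lambda>p. dexp (local_series X p)"
  let ?P = "\<lambda>M::nat. sorted_list_of_set {p. Factorial_Ring.prime p \<and> p \<le> M}"
  have set_P: "set (?P M) = {p. Factorial_Ring.prime p \<and> p \<le> M}" "distinct (?P M)" for M
  proof -
    have "finite {p. Factorial_Ring.prime p \<and> p \<le> M}" by (rule finite_subset[of _ "{..M}"]) auto
    then show "set (?P M) = {p. Factorial_Ring.prime p \<and> p \<le> M}" "distinct (?P M)" by auto
  qed
  have loc1: "local_series X p 1 = 0" if "Factorial_Ring.prime p" for p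
    by (rule local_series_eq_0)
      (use one_less_power[OF prime_gt_1_nat[OF that]] in \<open>metis less_irrefl less_le_trans zero_less_one\<close>)
  \<comment> \<open>At most one prime contributes at index d. If d is a power of p with positive
    exponent, then p \<le> d \<le> M, so this prime is already present in the partial
    product.\<close>
  have mass: "(\<Sum>p\<leftarrow>?P M. local_series X p d) = field_mass d" if "d \<le> M" for M d
  proof -
    have s: "(\<Sum>p\<leftarrow>?P M. local_series X p d) = (\<Sum>p | Factorial_Ring.prime p \<and> p \<le> M. local_series X p d)"
      using set_P sum_list_distinct_conv_sum_set by metis
    show ?thesis
    proof (cases "\<exists>p n. Factorial_Ring.prime p \<and> n \<ge> 1 \<and> d = p ^ n")
      case True
      then obtain p n where p: "Factorial_Ring.prime p" "n \<ge> 1" "d = p ^ n" by blast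
      have "p ^ 1 \<le> d" unfolding p(3) by (rule power_increasing) (use p prime_gt_0_nat[of p] in auto)
      then have pM: "p \<le> M" using that by simp
      have "(\<Sum>q | Factorial_Ring.prime q \<and> q \<le> M. local_series X q d)
          = (\<Sum>q | Factorial_Ring.prime q \<and> q \<le> M. if q = p then real (card (X (GF p n))) / real n else 0)"
        by (rule sum.cong[OF refl]) (use p in \<open>simp add: local_series_prime_power\<close>)
      also have "\<dots> = real (card (X (GF p n))) / real n" using p pM by (simp add: sum.delta)
      also have "\<dots> = field_mass d"
        using field_mass_prime_power[OF p(1,2) GF_props[OF p(1,2)]] p(3) by simp
      finally show ?thesis using s by simp
    next
      case False
      then have "field_mass d = 0" using field_mass_eq_0 by blast
      moreover have "(\<Sum>p | Factorial_Ring.prime p \<and> p \<le> M. local_series X p d) = 0"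
      proof (rule sum.neutral, intro ballI)
        fix p assume "p \<in> {p. Factorial_Ring.prime p \<and> p \<le> M}"
        then show "local_series X p d = 0" by (intro local_series_eq_0) (use False in blast)
      qed
      ultimately show ?thesis using s by simp
    qed
  qed
  have ring: "has_log_deriv ring_mass (dderiv field_mass)"
    unfolding has_log_deriv_def
    by (auto simp: dderiv_def dmult_def ring_mass_recurrence)
  \<comment> \<open>Up to index M the partial product over the primes \<le> M has the same
    logarithmic derivative as the zeta series, so its coefficients there are final and the limit is
    attained at every M \<ge> N.\<close>
  have eq: "foldr dmult (map ?E (?P M)) dunit N = ring_mass N" if M: "N \<le> M" for M
  proof (rule has_log_deriv_unique[symmetric, OF ring, where K = M])
    show "has_log_deriv (foldr dmult (map ?E (?P M)) dunit) (\<lambda>n. \<Sum>p\<leftarrow>?P M. dderiv (local_series X p) n)"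
      by (rule has_log_deriv_prod) (use loc1 has_log_deriv_dexp set_P in auto)
    have "foldr dmult (map ?E (?P M)) dunit 1 = 1"
      by (rule foldr_dmult_1) (use loc1 dexp_1 set_P in auto)
    then show "ring_mass 1 = foldr dmult (map ?E (?P M)) dunit 1" using ring_mass_1 by simp
    show "dderiv field_mass d = (\<Sum>p\<leftarrow>?P M. dderiv (local_series X p) d)" if "d \<le> M" for d
      unfolding dderiv_def sum_list_const_mult mass[OF that] ..
  qed (use N M in \<open>auto simp: dderiv_def\<close>)
  have "(\<lambda>M. foldr dmult (map ?E (?P M)) dunit N) \<longlonglongrightarrow> ring_mass N"
    by (rule tendsto_eventually) (rule eventually_sequentiallyI[of N], rule eq)
  then have "euler_prod ?E N = ring_mass N" unfolding euler_prod_def by (rule limI)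
  then show "zeta_coeff X N = euler_prod ?E N" using zeta[OF N] by simp
qed

end
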